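(* (Subject reduction.) In $\mu\mathrm{NJ}$ modulo $\equiv$, if $\Gamma\vdash_\equiv\pi:P$ and $\pi\to\pi'$, then $\Gamma\vdash_\equiv\pi':P$.
   Context: Logic $\mu\mathrm{NJ}$ modulo. Expressions are simply typed $\lambda$-terms up to $\beta\eta$; $o$ is the type of propositions; term types do not contain $o$. Formulas: $P ::= \top \mid \bot \mid P\supset Q \mid P\wedge Q \mid P\vee Q \mid \forall x.P \mid \exists x.P \mid t=t' \mid \mu\,B\,\vec t \mid \nu\,B\,\vec t \mid p\,\vec t \mid a\,\vec t$; $B=\lambda p\lambda\vec x.P$ with $p$ only positive in $P$. A congruence $\equiv$ (containing $\beta\eta$, closed under substitution) is fixed. $\mathrm{csu}(u,v)$: a set $\{\theta_i\}$ of substitutions with $u\theta_i\equiv v\theta_i$ such that every such unifier is $\theta_i\theta'$ for some $i,\theta'$. Proof terms: $\pi ::= \alpha \mid \langle\rangle \mid \delta_\bot(\pi) \mid \lambda\alpha.\pi \mid \pi\,\pi' \mid \langle\pi,\pi'\rangle \mid \mathrm{proj}_i(\pi) \mid \mathrm{in}_i(\pi) \mid \delta_\vee(\pi,\alpha.\pi_1,\beta.\pi_2) \mid \lambda x.\pi \mid \pi\,t \mid \langle t,\pi\rangle \mid \delta_\exists(\pi,x.\alpha.\pi') \mid \mathrm{refl}(t) \mid \delta_=(\Gamma,\theta,\sigma,u,v,Q,\pi;(\theta'_i.\pi_i)_i) \mid \mu(B,\vec t,\pi) \mid \delta_\mu(\pi,\vec x.\alpha.\pi') \mid \nu(\pi,\vec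 x.\alpha.\pi') \mid \delta_\nu(B,\vec t,\pi)$ ($\sigma$ a proof substitution, $(\theta'_i.\pi_i)_i$ a finite possibly empty family). Typing $\Gamma\vdash_\equiv\pi:P$ ($\Gamma$ a finite map from proof variables to formulas; $\Gamma'\vdash\sigma:\Gamma$ means $\Gamma'\vdash\sigma(\alpha):\Gamma(\alpha)$ for all $\alpha$ in the common domain; bound variables fresh): variable rule with $P\equiv\Gamma(\alpha)$; $\langle\rangle:P$ if $P\equiv\top$; $\delta_\bot(\pi):P$ from $\pi:\bot$; $\lambda\alpha.\pi:P$ from $\Gamma,\alpha:P_1\vdash\pi:P_2$ if $P\equiv P_1\supset P_2$; $\pi\pi':P$ from $\pi:Q\supset P$, $\pi':Q$; $\langle\pi_1,\pi_2\rangle:P$ from $\pi_j:P_j$ if $P\equiv P_1\wedge P_2$; $\mathrm{proj}_i(\pi):P'$ from $\pi:P_1\wedge P_2$ if $P'\equiv P_i$; $\mathrm{in}_i(\pi):P$ from $\pi:P_i$ if $P\equiv P_1\vee P_2$; $\delta_\vee(\pi,\alpha.\pi_1,\beta.\pi_2):P$ from $\pi:P_1\vee P_2$, $\Gamma,\alpha:P_1\vdash\pi_1:P$, $\Gamma,\beta:P_2\vdash\pi_2:P$; $\lambda x.\pi:P$ from $\pi:Q$ if $P\equiv\forall x.Q$; $\pi t:P$ from $\pi:\forall x.Q$ if $P\equiv Q[t/x]$; $\langle t,\pi\rangle:P$ from $\pi:Q[t/x]$ if $P\equiv\exists x.Q$; $\delta_\exists(\pi,x.\alpha.\pi'):P$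 from $\pi:\exists x.Q$, $\Gamma,\alpha:Q\vdash\pi':P$; $\mathrm{refl}(t):P$ if $P\equiv(t=t)$; $\Gamma'\vdash\delta_=(\Gamma,\theta,\sigma,u,v,Q,\pi;(\theta'_i.\pi_i)_i):P$ from $\Gamma'\vdash\pi:u\theta=v\theta$, $\Gamma'\vdash\sigma:\Gamma\theta$, $\Gamma\theta'_i\vdash\pi_i:Q\theta'_i$ for all $i$, where $(\theta'_i)_i$ is a $\mathrm{csu}(u,v)$ and $P\equiv Q\theta$; $\mu(B,\vec t,\pi):P$ from $\pi:B(\mu B)\vec t$ if $P\equiv\mu B\vec t$; $\delta_\mu(\pi,\vec x.\alpha.\pi'):P$ from $\pi:\mu B\vec t$, $\Gamma,\alpha:BS\vec x\vdash\pi':S\vec x$ if $P\equiv S\vec t$; $\nu(\pi,\vec x.\alpha.\pi'):P$ from $\pi:S\vec t$, $\Gamma,\alpha:S\vec x\vdash\pi':BS\vec x$ if $P\equiv\nu B\vec t$; $\delta_\nu(B,\vec t,\pi):P$ from $\pi:\nu B\vec t$ if $P\equiv B(\nu B)\vec t$. Substitutions $\pi\theta$, $\pi\sigma$ are capture-avoiding and homomorphic except that in $\delta_=(\Gamma,\theta',\sigma',u,v,Q,\pi;(\theta''_i.\pi_i)_i)$ a term substitution $\theta$ acts only as $\theta'\mapsto\theta'\theta$, $\sigma'\mapsto\sigma'\theta$, $\pi\mapsto\pi\theta$, and a proof substitution $\sigma$ only as $\sigma'\mapsto\sigma'\sigma$, $\pi\mapsto\pi\sigma$ (branches untouched). Functoriality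 $F^*_B(\vec x.\alpha.\pi)$, $*\in\{+,-\}$, for $B$ of type $(\vec\gamma\to o)\to o$: $F^+_{\lambda p.p\vec t}=\lambda\alpha.\pi[\vec t/\vec x]$; $F^*_{\lambda p.Q}=\lambda\beta.\beta$ ($p\notin Q$); $\wedge$: $\lambda\beta.\langle F^*_{B_1}(\mathrm{proj}_1\beta),F^*_{B_2}(\mathrm{proj}_2\beta)\rangle$; $\vee$: $\lambda\beta.\delta_\vee(\beta,\gamma.\mathrm{in}_1(F^*_{B_1}\gamma),\gamma.\mathrm{in}_2(F^*_{B_2}\gamma))$; $\supset$: $\lambda\beta\lambda\gamma.F^*_{B_2}(\beta(F^{-*}_{B_1}\gamma))$; $\forall$: $\lambda\beta\lambda x.F^*_{\lambda p.Bpx}(\beta x)$; $\exists$: $\lambda\beta.\delta_\exists(\beta,x.\gamma.\langle x,F^*_{\lambda p.Bpx}\gamma\rangle)$; $F^*_{\lambda p.\mu(Bp)\vec t}=\lambda\beta.\delta_\mu(\beta,\vec x.\gamma.\mu(BP',\vec x,F^*_{\lambda p.Bp(\mu(BP'))\vec x}\gamma))$; $F^*_{\lambda p.\nu(Bp)\vec t}=\lambda\beta.\nu(\beta,\vec x.\gamma.F^*_{\lambda p.Bp(\nu(BP))\vec x}(\delta_\nu(BP,\vec x,\gamma)))$ (all $F$'s applied to $(\vec x.\alpha.\pi)$; $\alpha:P\vec x\vdash\pi:P'\vec x$); $F_B:=F^+_B$. Reduction $\to$ is the contextual closure of: $(\lambda\alpha.\pi)\pi'\to\pi[\pi'/\alpha]$;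 $\mathrm{proj}_i\langle\pi_1,\pi_2\rangle\to\pi_i$; $\delta_\vee(\mathrm{in}_i(\pi),\alpha.\pi_1,\alpha.\pi_2)\to\pi_i[\pi/\alpha]$; $(\lambda x.\pi)t\to\pi[t/x]$; $\delta_\exists(\langle t,\pi\rangle,x.\alpha.\pi')\to\pi'[t/x][\pi/\alpha]$; $\delta_\mu(\mu(B,\vec t,\pi),\vec x.\alpha.\pi')\to\pi'[\vec t/\vec x][(F_{\lambda p.Bp\vec t}(\vec x.\beta.\delta_\mu(\beta,\vec x.\alpha.\pi'))\,\pi)/\alpha]$; $\delta_\nu(B,\vec t,\nu(\pi,\vec x.\alpha.\pi'))\to F_{\lambda p.Bp\vec t}(\vec x.\beta.\nu(\beta,\vec x.\alpha.\pi'))(\pi'[\vec t/\vec x][\pi/\alpha])$; $\delta_=(\Gamma,\theta,\sigma,u,v,Q,\mathrm{refl}(w);(\theta'_i.\pi_i)_i)\to\pi_i\theta''\sigma$ whenever $\theta=\theta'_i\theta''$.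
   Formalization: Assumes ⊃, ∧, ∨, ∀, ∃, μ, ν are injective modulo ≡ (false otherwise: take ⊤∧⊥≡⊤∧⊤); δ_μ and ν record their (co)invariant S, without which F and → are not determined; F⁻ swaps P and P′ in the μ/ν annotations; in δ_=, σ and Γ have the same domain. *)

theory Defs
  imports Main
begin

section \<open>Terms\<close>

text \<open>
  Types of terms. The type o of propositions is not among them; a predicate type
  \<open>\<gamma>\<^sub>1 \<rightarrow> \<dots> \<rightarrow> \<gamma>\<^sub>n \<rightarrow> o\<close> is represented by the list \<open>[\<gamma>\<^sub>1, \<dots>, \<gamma>\<^sub>n]\<close>.
\<close>

datatype 'b ty = Base 'b | Fun "'b ty" "'b ty"

text \<open>
  Variables carry their type, and there are infinitely many of every type, so that no typing
  context for them is needed. De Bruijn indices are counted per type: \<open>Var i \<gamma>\<close> skips \<open>i\<close>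
  enclosing binders of type \<open>\<gamma>\<close> and ignores the binders of other types.
  In a block of binders \<open>\<gamma>\<^sub>1, \<dots>, \<gamma>\<^sub>n\<close> the last one is the innermost.
\<close>

datatype ('b, 'c) tm =
    Var nat "'b ty"
  | Cst 'c
  | App "('b, 'c) tm" "('b, 'c) tm"
  | Lam "'b ty" "('b, 'c) tm"

type_synonym ('b, 'c) tsub = "nat \<Rightarrow> 'b ty \<Rightarrow> ('b, 'c) tm"

definition up_ren :: "'b ty \<Rightarrow> (nat \<Rightarrow> 'b ty \<Rightarrow> nat) \<Rightarrow> nat \<Rightarrow> 'b ty \<Rightarrow> nat" where
  "up_ren \<gamma> r i \<delta> = (if \<delta> = \<gamma> then (case i of 0 \<Rightarrow> 0 | Suc j \<Rightarrow> Suc (r j \<delta>)) else r i \<delta>)"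

fun ren_tm :: "(nat \<Rightarrow> 'b ty \<Rightarrow> nat) \<Rightarrow> ('b, 'c) tm \<Rightarrow> ('b, 'c) tm" where
  "ren_tm r (Var i \<gamma>) = Var (r i \<gamma>) \<gamma>"
| "ren_tm r (Cst c) = Cst c"
| "ren_tm r (App t u) = App (ren_tm r t) (ren_tm r u)"
| "ren_tm r (Lam \<gamma> t) = Lam \<gamma> (ren_tm (up_ren \<gamma> r) t)"

definition scons :: "'b ty \<Rightarrow> ('b, 'c) tm \<Rightarrow> ('b, 'c) tsub \<Rightarrow> ('b, 'c) tsub" where
  "scons \<gamma> t \<theta> i \<delta> = (if \<delta> = \<gamma> then (case i of 0 \<Rightarrow> t | Suc j \<Rightarrow> \<theta> j \<delta>) else \<theta> i \<delta>)"

definition up :: "'b ty \<Rightarrow> ('b, 'c) tsub \<Rightarrow> ('b, 'c) tsub" where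
  "up \<gamma> \<theta> = scons \<gamma> (Var 0 \<gamma>) (\<lambda>i \<delta>. ren_tm (\<lambda>j \<epsilon>. if \<epsilon> = \<gamma> then Suc j else j) (\<theta> i \<delta>))"

definition ups :: "'b ty list \<Rightarrow> ('b, 'c) tsub \<Rightarrow> ('b, 'c) tsub" where
  "ups \<gamma>s \<theta> = fold up \<gamma>s \<theta>"

fun sub_tm :: "('b, 'c) tsub \<Rightarrow> ('b, 'c) tm \<Rightarrow> ('b, 'c) tm" where
  "sub_tm \<theta> (Var i \<gamma>) = \<theta> i \<gamma>"
| "sub_tm \<theta> (Cst c) = Cst c"
| "sub_tm \<theta> (App t u) = App (sub_tm \<theta> t) (sub_tm \<theta> u)"
| "sub_tm \<theta> (Lam \<gamma> t) = Lam \<gamma> (sub_tm (up \<gamma> \<theta>) t)"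

text \<open>\<open>tcomp \<theta> \<theta>'\<close> is \<open>\<theta>\<theta>'\<close> in postfix notation: first \<open>\<theta>\<close>, then \<open>\<theta>'\<close>.\<close>

definition tcomp :: "('b, 'c) tsub \<Rightarrow> ('b, 'c) tsub \<Rightarrow> ('b, 'c) tsub" where
  "tcomp \<theta> \<theta>' i \<gamma> = sub_tm \<theta>' (\<theta> i \<gamma>)"

text \<open>\<open>shifts \<gamma>s\<close> weakens by the binders \<open>\<gamma>s\<close>; \<open>insts \<gamma>s ts\<close> instantiates them with \<open>ts\<close>;
  \<open>vars \<gamma>s\<close> is the list of the variables that they bind, seen from inside.\<close>

definition shifts :: "'b ty list \<Rightarrow> ('b, 'c) tsub" where
  "shifts \<gamma>s i \<delta> = Var (i + count_list \<gamma>s \<delta>) \<delta>"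

definition insts :: "'b ty list \<Rightarrow> ('b, 'c) tm list \<Rightarrow> ('b, 'c) tsub" where
  "insts \<gamma>s ts = fold (\<lambda>(\<gamma>, t). scons \<gamma> t) (zip \<gamma>s ts) Var"

fun vars :: "'b ty list \<Rightarrow> ('b, 'c) tm list" where
  "vars [] = []"
| "vars (\<gamma> # \<gamma>s) = Var (count_list \<gamma>s \<gamma>) \<gamma> # vars \<gamma>s"


section \<open>Formulas\<close>

text \<open>
  \<open>Mu \<gamma>s B ts\<close> is \<open>\<mu> (\<lambda>p \<lambda>x\<^sub>1 \<dots> x\<^sub>n. B) t\<^sub>1 \<dots> t\<^sub>n\<close>: the body \<open>B\<close> is in the scope of the term
  variables of types \<open>\<gamma>s\<close> and of the predicate variable \<open>PVar 0 \<gamma>s\<close>. Predicate variables are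
  indexed per type, like term variables. Formulas are thus \<open>\<beta>\<close>-normal above the level of terms:
  an expression \<open>S\<close> of type \<open>\<gamma>s \<rightarrow> o\<close> is represented by the formula \<open>S x\<^sub>1 \<dots> x\<^sub>n\<close> in the scope
  of \<open>\<gamma>s\<close>, and applications are represented by substitutions.
\<close>

datatype ('b, 'c, 'a) fm =
    Top
  | Bot
  | Imp "('b, 'c, 'a) fm" "('b, 'c, 'a) fm"
  | And "('b, 'c, 'a) fm" "('b, 'c, 'a) fm"
  | Or "('b, 'c, 'a) fm" "('b, 'c, 'a) fm"
  | All "'b ty" "('b, 'c, 'a) fm"
  | Ex "'b ty" "('b, 'c, 'a) fm"
  | Eq "('b, 'c) tm" "('b, 'c) tm"
  | Mu "'b ty list" "('b, 'c, 'a) fm" "('b, 'c) tm list"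
  | Nu "'b ty list" "('b, 'c, 'a) fm" "('b, 'c) tm list"
  | PVar nat "'b ty list" "('b, 'c) tm list"
  | Atom 'a "('b, 'c) tm list"

fun sub_fm :: "('b, 'c) tsub \<Rightarrow> ('b, 'c, 'a) fm \<Rightarrow> ('b, 'c, 'a) fm" where
  "sub_fm \<theta> Top = Top"
| "sub_fm \<theta> Bot = Bot"
| "sub_fm \<theta> (Imp A B) = Imp (sub_fm \<theta> A) (sub_fm \<theta> B)"
| "sub_fm \<theta> (And A B) = And (sub_fm \<theta> A) (sub_fm \<theta> B)"
| "sub_fm \<theta> (Or A B) = Or (sub_fm \<theta> A) (sub_fm \<theta> B)"
| "sub_fm \<theta> (All \<gamma> A) = All \<gamma> (sub_fm (up \<gamma> \<theta>) A)"
| "sub_fm \<theta> (Ex \<gamma> A) = Ex \<gamma> (sub_fm (up \<gamma> \<theta>) A)"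
| "sub_fm \<theta> (Eq t u) = Eq (sub_tm \<theta> t) (sub_tm \<theta> u)"
| "sub_fm \<theta> (Mu \<gamma>s B ts) = Mu \<gamma>s (sub_fm (ups \<gamma>s \<theta>) B) (map (sub_tm \<theta>) ts)"
| "sub_fm \<theta> (Nu \<gamma>s B ts) = Nu \<gamma>s (sub_fm (ups \<gamma>s \<theta>) B) (map (sub_tm \<theta>) ts)"
| "sub_fm \<theta> (PVar i \<gamma>s ts) = PVar i \<gamma>s (map (sub_tm \<theta>) ts)"
| "sub_fm \<theta> (Atom a ts) = Atom a (map (sub_tm \<theta>) ts)"

text \<open>Weakening of a formula by the binders \<open>\<gamma>s\<close>, and the same below the binders \<open>\<delta>s\<close>.\<close>

abbreviation wk :: "'b ty list \<Rightarrow> ('b, 'c, 'a) fm \<Rightarrow> ('b, 'c, 'a) fm" where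
  "wk \<gamma>s \<equiv> sub_fm (shifts \<gamma>s)"

abbreviation wk_under :: "'b ty list \<Rightarrow> 'b ty list \<Rightarrow> ('b, 'c, 'a) fm \<Rightarrow> ('b, 'c, 'a) fm" where
  "wk_under \<delta>s \<gamma>s \<equiv> sub_fm (ups \<delta>s (shifts \<gamma>s))"

definition up_pren ::
    "'b ty list \<Rightarrow> (nat \<Rightarrow> 'b ty list \<Rightarrow> nat) \<Rightarrow> nat \<Rightarrow> 'b ty list \<Rightarrow> nat" where
  "up_pren \<gamma>s r i \<delta>s = (if \<delta>s = \<gamma>s then (case i of 0 \<Rightarrow> 0 | Suc j \<Rightarrow> Suc (r j \<delta>s)) else r i \<delta>s)"

fun pren_fm :: "(nat \<Rightarrow> 'b ty list \<Rightarrow> nat) \<Rightarrow> ('b, 'c, 'a) fm \<Rightarrow> ('b, 'c, 'a) fm" where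
  "pren_fm r Top = Top"
| "pren_fm r Bot = Bot"
| "pren_fm r (Imp A B) = Imp (pren_fm r A) (pren_fm r B)"
| "pren_fm r (And A B) = And (pren_fm r A) (pren_fm r B)"
| "pren_fm r (Or A B) = Or (pren_fm r A) (pren_fm r B)"
| "pren_fm r (All \<gamma> A) = All \<gamma> (pren_fm r A)"
| "pren_fm r (Ex \<gamma> A) = Ex \<gamma> (pren_fm r A)"
| "pren_fm r (Eq t u) = Eq t u"
| "pren_fm r (Mu \<gamma>s B ts) = Mu \<gamma>s (pren_fm (up_pren \<gamma>s r) B) ts"
| "pren_fm r (Nu \<gamma>s B ts) = Nu \<gamma>s (pren_fm (up_pren \<gamma>s r) B) ts"
| "pren_fm r (PVar i \<gamma>s ts) = PVar (r i \<gamma>s) \<gamma>s ts"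
| "pren_fm r (Atom a ts) = Atom a ts"

definition pwk :: "'b ty list \<Rightarrow> ('b, 'c, 'a) fm \<Rightarrow> ('b, 'c, 'a) fm" where
  "pwk \<gamma>s = pren_fm (\<lambda>i \<delta>s. if \<delta>s = \<gamma>s then Suc i else i)"

text \<open>A predicate substitution maps \<open>PVar i \<delta>s\<close> to a formula in the scope of \<open>\<delta>s\<close>.\<close>

type_synonym ('b, 'c, 'a) psub = "nat \<Rightarrow> 'b ty list \<Rightarrow> ('b, 'c, 'a) fm"

definition pscons ::
    "'b ty list \<Rightarrow> ('b, 'c, 'a) fm \<Rightarrow> ('b, 'c, 'a) psub \<Rightarrow> ('b, 'c, 'a) psub" where
  "pscons \<gamma>s S \<rho> i \<delta>s =
    (if \<delta>s = \<gamma>s then (case i of 0 \<Rightarrow> S | Suc j \<Rightarrow> \<rho> j \<delta>s) else \<rho> i \<delta>s)"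

definition pshift :: "'b ty list \<Rightarrow> ('b, 'c, 'a) psub \<Rightarrow> ('b, 'c, 'a) psub" where
  "pshift \<gamma>s \<rho> i \<delta>s = wk_under \<delta>s \<gamma>s (\<rho> i \<delta>s)"

definition pup :: "'b ty list \<Rightarrow> ('b, 'c, 'a) psub \<Rightarrow> ('b, 'c, 'a) psub" where
  "pup \<gamma>s \<rho> = pscons \<gamma>s (PVar 0 \<gamma>s (vars \<gamma>s)) (\<lambda>i \<delta>s. pwk \<gamma>s (pshift \<gamma>s \<rho> i \<delta>s))"

fun psub_fm :: "('b, 'c, 'a) psub \<Rightarrow> ('b, 'c, 'a) fm \<Rightarrow> ('b, 'c, 'a) fm" where
  "psub_fm \<rho> Top = Top"
| "psub_fm \<rho> Bot = Bot"
| "psub_fm \<rho> (Imp A B) = Imp (psub_fm \<rho> A) (psub_fm \<rho> B)"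
| "psub_fm \<rho> (And A B) = And (psub_fm \<rho> A) (psub_fm \<rho> B)"
| "psub_fm \<rho> (Or A B) = Or (psub_fm \<rho> A) (psub_fm \<rho> B)"
| "psub_fm \<rho> (All \<gamma> A) = All \<gamma> (psub_fm (pshift [\<gamma>] \<rho>) A)"
| "psub_fm \<rho> (Ex \<gamma> A) = Ex \<gamma> (psub_fm (pshift [\<gamma>] \<rho>) A)"
| "psub_fm \<rho> (Eq t u) = Eq t u"
| "psub_fm \<rho> (Mu \<gamma>s B ts) = Mu \<gamma>s (psub_fm (pup \<gamma>s \<rho>) B) ts"
| "psub_fm \<rho> (Nu \<gamma>s B ts) = Nu \<gamma>s (psub_fm (pup \<gamma>s \<rho>) B) ts"
| "psub_fm \<rho> (PVar i \<gamma>s ts) = sub_fm (insts \<gamma>s ts) (\<rho> i \<gamma>s)"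
| "psub_fm \<rho> (Atom a ts) = Atom a ts"

text \<open>The substitution of \<open>S\<close> for \<open>PVar 0 \<gamma>s\<close>, and \<open>(\<lambda>p. Q) S\<close> for \<open>p\<close> of type \<open>\<gamma>s \<rightarrow> o\<close>.\<close>

definition pinst :: "'b ty list \<Rightarrow> ('b, 'c, 'a) fm \<Rightarrow> ('b, 'c, 'a) psub" where
  "pinst \<gamma>s S = pscons \<gamma>s S (\<lambda>i \<delta>s. PVar i \<delta>s (vars \<delta>s))"

definition papp :: "'b ty list \<Rightarrow> ('b, 'c, 'a) fm \<Rightarrow> ('b, 'c, 'a) fm \<Rightarrow> ('b, 'c, 'a) fm" where
  "papp \<gamma>s Q S = psub_fm (pinst \<gamma>s S) Q"

text \<open>For \<open>B = \<lambda>p \<lambda>x\<^sub>1 \<dots> x\<^sub>n. Q\<close> given by its body: \<open>B S t\<^sub>1 \<dots> t\<^sub>n\<close>; \<open>B S x\<^sub>1 \<dots> x\<^sub>n\<close> in the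
  scope of \<open>x\<^sub>1 \<dots> x\<^sub>n\<close>; and the predicates \<open>\<mu> B\<close> and \<open>\<nu> B\<close>.\<close>

definition unfold ::
    "'b ty list \<Rightarrow> ('b, 'c, 'a) fm \<Rightarrow> ('b, 'c, 'a) fm \<Rightarrow> ('b, 'c) tm list \<Rightarrow> ('b, 'c, 'a) fm" where
  "unfold \<gamma>s B S ts = papp \<gamma>s (sub_fm (insts \<gamma>s ts) B) S"

definition unfold_vars ::
    "'b ty list \<Rightarrow> ('b, 'c, 'a) fm \<Rightarrow> ('b, 'c, 'a) fm \<Rightarrow> ('b, 'c, 'a) fm" where
  "unfold_vars \<gamma>s B S = papp \<gamma>s B (wk_under \<gamma>s \<gamma>s S)"

definition mu_pred :: "'b ty list \<Rightarrow> ('b, 'c, 'a) fm \<Rightarrow> ('b, 'c, 'a) fm" where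
  "mu_pred \<gamma>s B = Mu \<gamma>s (wk_under \<gamma>s \<gamma>s B) (vars \<gamma>s)"

definition nu_pred :: "'b ty list \<Rightarrow> ('b, 'c, 'a) fm \<Rightarrow> ('b, 'c, 'a) fm" where
  "nu_pred \<gamma>s B = Nu \<gamma>s (wk_under \<gamma>s \<gamma>s B) (vars \<gamma>s)"

datatype polarity = Pos | Neg

fun flip :: "polarity \<Rightarrow> polarity" where
  "flip Pos = Neg"
| "flip Neg = Pos"

text \<open>\<open>occ s i \<delta>s Q\<close>: the predicate variable \<open>PVar i \<delta>s\<close> has an occurrence of polarity \<open>s\<close> in \<open>Q\<close>.\<close>

fun occ :: "polarity \<Rightarrow> nat \<Rightarrow> 'b ty list \<Rightarrow> ('b, 'c, 'a) fm \<Rightarrow> bool" where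
  "occ s i \<delta>s Top = False"
| "occ s i \<delta>s Bot = False"
| "occ s i \<delta>s (Imp A B) = (occ (flip s) i \<delta>s A \<or> occ s i \<delta>s B)"
| "occ s i \<delta>s (And A B) = (occ s i \<delta>s A \<or> occ s i \<delta>s B)"
| "occ s i \<delta>s (Or A B) = (occ s i \<delta>s A \<or> occ s i \<delta>s B)"
| "occ s i \<delta>s (All \<gamma> A) = occ s i \<delta>s A"
| "occ s i \<delta>s (Ex \<gamma> A) = occ s i \<delta>s A"
| "occ s i \<delta>s (Eq t u) = False"
| "occ s i \<delta>s (Mu \<gamma>s B ts) = occ s (if \<gamma>s = \<delta>s then Suc i else i) \<delta>s B"
| "occ s i \<delta>s (Nu \<gamma>s B ts) = occ s (if \<gamma>s = \<delta>s then Suc i else i) \<delta>s B"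
| "occ s i \<delta>s (PVar j \<gamma>s ts) = (s = Pos \<and> j = i \<and> \<gamma>s = \<delta>s)"
| "occ s i \<delta>s (Atom a ts) = False"

definition occurs :: "nat \<Rightarrow> 'b ty list \<Rightarrow> ('b, 'c, 'a) fm \<Rightarrow> bool" where
  "occurs i \<delta>s Q \<longleftrightarrow> occ Pos i \<delta>s Q \<or> occ Neg i \<delta>s Q"


section \<open>Proof terms\<close>

datatype side = First | Second

fun pick :: "side \<Rightarrow> 'x \<Rightarrow> 'x \<Rightarrow> 'x" where
  "pick First x y = x"
| "pick Second x y = y"

text \<open>
  Proof variables are de Bruijn indices into the list of hypotheses. Binders of term variables
  carry the types of these variables.

  \<open>CaseEq \<Gamma> \<theta> \<sigma> u v Q \<pi> bs\<close> binds, in each branch, all term variables and the proof variables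
  of \<open>\<Gamma>\<close>; correspondingly, \<open>\<sigma>\<close> lists one proof for every hypothesis in \<open>\<Gamma>\<close>.

  \<open>MuE \<gamma>s S \<pi> \<pi>'\<close> and \<open>NuI \<gamma>s S \<pi> \<pi>'\<close>, where \<open>\<pi>'\<close> is in the scope of \<open>\<gamma>s\<close> and of one proof
  variable, record the (co)invariant \<open>S\<close>: the functoriality proofs created by reducing them
  mention \<open>S\<close>, which the proofs \<open>\<pi>\<close> and \<open>\<pi>'\<close> alone do not determine.
\<close>

datatype ('b, 'c, 'a) pf =
    Hyp nat
  | Unit
  | BotE "('b, 'c, 'a) pf"
  | LamP "('b, 'c, 'a) pf"
  | AppP "('b, 'c, 'a) pf" "('b, 'c, 'a) pf"
  | PairP "('b, 'c, 'a) pf" "('b, 'c, 'a) pf"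
  | Proj side "('b, 'c, 'a) pf"
  | In side "('b, 'c, 'a) pf"
  | CaseOr "('b, 'c, 'a) pf" "('b, 'c, 'a) pf" "('b, 'c, 'a) pf"
  | LamT "'b ty" "('b, 'c, 'a) pf"
  | AppT "('b, 'c, 'a) pf" "('b, 'c) tm"
  | Pack "('b, 'c) tm" "('b, 'c, 'a) pf"
  | CaseEx "'b ty" "('b, 'c, 'a) pf" "('b, 'c, 'a) pf"
  | Refl "('b, 'c) tm"
  | CaseEq "('b, 'c, 'a) fm list" "('b, 'c) tsub" "('b, 'c, 'a) pf list" "('b, 'c) tm" "('b, 'c) tm"
      "('b, 'c, 'a) fm" "('b, 'c, 'a) pf" "(('b, 'c) tsub \<times> ('b, 'c, 'a) pf) list"
  | MuI "'b ty list" "('b, 'c, 'a) fm" "('b, 'c) tm list" "('b, 'c, 'a) pf"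
  | MuE "'b ty list" "('b, 'c, 'a) fm" "('b, 'c, 'a) pf" "('b, 'c, 'a) pf"
  | NuI "'b ty list" "('b, 'c, 'a) fm" "('b, 'c, 'a) pf" "('b, 'c, 'a) pf"
  | NuE "'b ty list" "('b, 'c, 'a) fm" "('b, 'c) tm list" "('b, 'c, 'a) pf"

fun tsub_pf :: "('b, 'c) tsub \<Rightarrow> ('b, 'c, 'a) pf \<Rightarrow> ('b, 'c, 'a) pf" where
  "tsub_pf \<theta> (Hyp n) = Hyp n"
| "tsub_pf \<theta> Unit = Unit"
| "tsub_pf \<theta> (BotE \<pi>) = BotE (tsub_pf \<theta> \<pi>)"
| "tsub_pf \<theta> (LamP \<pi>) = LamP (tsub_pf \<theta> \<pi>)"
| "tsub_pf \<theta> (AppP \<pi> \<pi>') = AppP (tsub_pf \<theta> \<pi>) (tsub_pf \<theta> \<pi>')"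
| "tsub_pf \<theta> (PairP \<pi> \<pi>') = PairP (tsub_pf \<theta> \<pi>) (tsub_pf \<theta> \<pi>')"
| "tsub_pf \<theta> (Proj k \<pi>) = Proj k (tsub_pf \<theta> \<pi>)"
| "tsub_pf \<theta> (In k \<pi>) = In k (tsub_pf \<theta> \<pi>)"
| "tsub_pf \<theta> (CaseOr \<pi> \<pi>1 \<pi>2) = CaseOr (tsub_pf \<theta> \<pi>) (tsub_pf \<theta> \<pi>1) (tsub_pf \<theta> \<pi>2)"
| "tsub_pf \<theta> (LamT \<gamma> \<pi>) = LamT \<gamma> (tsub_pf (up \<gamma> \<theta>) \<pi>)"
| "tsub_pf \<theta> (AppT \<pi> t) = AppT (tsub_pf \<theta> \<pi>) (sub_tm \<theta> t)"
| "tsub_pf \<theta> (Pack t \<pi>) = Pack (sub_tm \<theta> t) (tsub_pf \<theta> \<pi>)"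
| "tsub_pf \<theta> (CaseEx \<gamma> \<pi> \<pi>') = CaseEx \<gamma> (tsub_pf \<theta> \<pi>) (tsub_pf (up \<gamma> \<theta>) \<pi>')"
| "tsub_pf \<theta> (Refl t) = Refl (sub_tm \<theta> t)"
| "tsub_pf \<theta> (CaseEq \<Gamma> \<theta>' \<sigma> u v Q \<pi> bs) =
    CaseEq \<Gamma> (tcomp \<theta>' \<theta>) (map (tsub_pf \<theta>) \<sigma>) u v Q (tsub_pf \<theta> \<pi>) bs"
| "tsub_pf \<theta> (MuI \<gamma>s B ts \<pi>) =
    MuI \<gamma>s (sub_fm (ups \<gamma>s \<theta>) B) (map (sub_tm \<theta>) ts) (tsub_pf \<theta> \<pi>)"
| "tsub_pf \<theta> (MuE \<gamma>s S \<pi> \<pi>') =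
    MuE \<gamma>s (sub_fm (ups \<gamma>s \<theta>) S) (tsub_pf \<theta> \<pi>) (tsub_pf (ups \<gamma>s \<theta>) \<pi>')"
| "tsub_pf \<theta> (NuI \<gamma>s S \<pi> \<pi>') =
    NuI \<gamma>s (sub_fm (ups \<gamma>s \<theta>) S) (tsub_pf \<theta> \<pi>) (tsub_pf (ups \<gamma>s \<theta>) \<pi>')"
| "tsub_pf \<theta> (NuE \<gamma>s B ts \<pi>) =
    NuE \<gamma>s (sub_fm (ups \<gamma>s \<theta>) B) (map (sub_tm \<theta>) ts) (tsub_pf \<theta> \<pi>)"

definition up_hren :: "(nat \<Rightarrow> nat) \<Rightarrow> nat \<Rightarrow> nat" where
  "up_hren r n = (case n of 0 \<Rightarrow> 0 | Suc m \<Rightarrow> Suc (r m))"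

fun ren_pf :: "(nat \<Rightarrow> nat) \<Rightarrow> ('b, 'c, 'a) pf \<Rightarrow> ('b, 'c, 'a) pf" where
  "ren_pf r (Hyp n) = Hyp (r n)"
| "ren_pf r Unit = Unit"
| "ren_pf r (BotE \<pi>) = BotE (ren_pf r \<pi>)"
| "ren_pf r (LamP \<pi>) = LamP (ren_pf (up_hren r) \<pi>)"
| "ren_pf r (AppP \<pi> \<pi>') = AppP (ren_pf r \<pi>) (ren_pf r \<pi>')"
| "ren_pf r (PairP \<pi> \<pi>') = PairP (ren_pf r \<pi>) (ren_pf r \<pi>')"
| "ren_pf r (Proj k \<pi>) = Proj k (ren_pf r \<pi>)"
| "ren_pf r (In k \<pi>) = In k (ren_pf r \<pi>)"
| "ren_pf r (CaseOr \<pi> \<pi>1 \<pi>2) =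
    CaseOr (ren_pf r \<pi>) (ren_pf (up_hren r) \<pi>1) (ren_pf (up_hren r) \<pi>2)"
| "ren_pf r (LamT \<gamma> \<pi>) = LamT \<gamma> (ren_pf r \<pi>)"
| "ren_pf r (AppT \<pi> t) = AppT (ren_pf r \<pi>) t"
| "ren_pf r (Pack t \<pi>) = Pack t (ren_pf r \<pi>)"
| "ren_pf r (CaseEx \<gamma> \<pi> \<pi>') = CaseEx \<gamma> (ren_pf r \<pi>) (ren_pf (up_hren r) \<pi>')"
| "ren_pf r (Refl t) = Refl t"
| "ren_pf r (CaseEq \<Gamma> \<theta> \<sigma> u v Q \<pi> bs) =
    CaseEq \<Gamma> \<theta> (map (ren_pf r) \<sigma>) u v Q (ren_pf r \<pi>) bs"
| "ren_pf r (MuI \<gamma>s B ts \<pi>) = MuI \<gamma>s B ts (ren_pf r \<pi>)"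
| "ren_pf r (MuE \<gamma>s S \<pi> \<pi>') = MuE \<gamma>s S (ren_pf r \<pi>) (ren_pf (up_hren r) \<pi>')"
| "ren_pf r (NuI \<gamma>s S \<pi> \<pi>') = NuI \<gamma>s S (ren_pf r \<pi>) (ren_pf (up_hren r) \<pi>')"
| "ren_pf r (NuE \<gamma>s B ts \<pi>) = NuE \<gamma>s B ts (ren_pf r \<pi>)"

type_synonym ('b, 'c, 'a) hsub = "nat \<Rightarrow> ('b, 'c, 'a) pf"

definition up_h :: "('b, 'c, 'a) hsub \<Rightarrow> ('b, 'c, 'a) hsub" where
  "up_h \<sigma> n = (case n of 0 \<Rightarrow> Hyp 0 | Suc m \<Rightarrow> ren_pf Suc (\<sigma> m))"

definition shift_h :: "'b ty list \<Rightarrow> ('b, 'c, 'a) hsub \<Rightarrow> ('b, 'c, 'a) hsub" where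
  "shift_h \<gamma>s \<sigma> n = tsub_pf (shifts \<gamma>s) (\<sigma> n)"

fun hsub_pf :: "('b, 'c, 'a) hsub \<Rightarrow> ('b, 'c, 'a) pf \<Rightarrow> ('b, 'c, 'a) pf" where
  "hsub_pf \<sigma> (Hyp n) = \<sigma> n"
| "hsub_pf \<sigma> Unit = Unit"
| "hsub_pf \<sigma> (BotE \<pi>) = BotE (hsub_pf \<sigma> \<pi>)"
| "hsub_pf \<sigma> (LamP \<pi>) = LamP (hsub_pf (up_h \<sigma>) \<pi>)"
| "hsub_pf \<sigma> (AppP \<pi> \<pi>') = AppP (hsub_pf \<sigma> \<pi>) (hsub_pf \<sigma> \<pi>')"
| "hsub_pf \<sigma> (PairP \<pi> \<pi>') = PairP (hsub_pf \<sigma> \<pi>) (hsub_pf \<sigma> \<pi>')"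
| "hsub_pf \<sigma> (Proj k \<pi>) = Proj k (hsub_pf \<sigma> \<pi>)"
| "hsub_pf \<sigma> (In k \<pi>) = In k (hsub_pf \<sigma> \<pi>)"
| "hsub_pf \<sigma> (CaseOr \<pi> \<pi>1 \<pi>2) =
    CaseOr (hsub_pf \<sigma> \<pi>) (hsub_pf (up_h \<sigma>) \<pi>1) (hsub_pf (up_h \<sigma>) \<pi>2)"
| "hsub_pf \<sigma> (LamT \<gamma> \<pi>) = LamT \<gamma> (hsub_pf (shift_h [\<gamma>] \<sigma>) \<pi>)"
| "hsub_pf \<sigma> (AppT \<pi> t) = AppT (hsub_pf \<sigma> \<pi>) t"
| "hsub_pf \<sigma> (Pack t \<pi>) = Pack t (hsub_pf \<sigma> \<pi>)"
| "hsub_pf \<sigma> (CaseEx \<gamma> \<pi> \<pi>') =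
    CaseEx \<gamma> (hsub_pf \<sigma> \<pi>) (hsub_pf (up_h (shift_h [\<gamma>] \<sigma>)) \<pi>')"
| "hsub_pf \<sigma> (Refl t) = Refl t"
| "hsub_pf \<sigma> (CaseEq \<Gamma> \<theta> \<sigma>' u v Q \<pi> bs) =
    CaseEq \<Gamma> \<theta> (map (hsub_pf \<sigma>) \<sigma>') u v Q (hsub_pf \<sigma> \<pi>) bs"
| "hsub_pf \<sigma> (MuI \<gamma>s B ts \<pi>) = MuI \<gamma>s B ts (hsub_pf \<sigma> \<pi>)"
| "hsub_pf \<sigma> (MuE \<gamma>s S \<pi> \<pi>') =
    MuE \<gamma>s S (hsub_pf \<sigma> \<pi>) (hsub_pf (up_h (shift_h \<gamma>s \<sigma>)) \<pi>')"
| "hsub_pf \<sigma> (NuI \<gamma>s S \<pi> \<pi>') =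
    NuI \<gamma>s S (hsub_pf \<sigma> \<pi>) (hsub_pf (up_h (shift_h \<gamma>s \<sigma>)) \<pi>')"
| "hsub_pf \<sigma> (NuE \<gamma>s B ts \<pi>) = NuE \<gamma>s B ts (hsub_pf \<sigma> \<pi>)"

definition hsubs :: "('b, 'c, 'a) pf list \<Rightarrow> ('b, 'c, 'a) hsub" where
  "hsubs \<sigma> n = (if n < length \<sigma> then \<sigma> ! n else Hyp (n - length \<sigma>))"

text \<open>\<open>hinst \<pi> \<pi>'\<close> is \<open>\<pi>'[\<pi>/\<alpha>]\<close> for the outermost proof variable \<open>\<alpha> = Hyp 0\<close>.\<close>

abbreviation hinst :: "('b, 'c, 'a) pf \<Rightarrow> ('b, 'c, 'a) pf \<Rightarrow> ('b, 'c, 'a) pf" where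
  "hinst \<pi> \<equiv> hsub_pf (hsubs [\<pi>])"


section \<open>Functoriality\<close>

text \<open>Number of connectives above some occurrence of \<open>PVar i \<delta>s\<close>, plus its number of
  occurrences; used for termination only.\<close>

fun psize :: "nat \<Rightarrow> 'b ty list \<Rightarrow> ('b, 'c, 'a) fm \<Rightarrow> nat" where
  "psize i \<delta>s (Imp A B) = (let n = psize i \<delta>s A + psize i \<delta>s B in if n = 0 then 0 else Suc n)"
| "psize i \<delta>s (And A B) = (let n = psize i \<delta>s A + psize i \<delta>s B in if n = 0 then 0 else Suc n)"
| "psize i \<delta>s (Or A B) = (let n = psize i \<delta>s A + psize i \<delta>s B in if n = 0 then 0 else Suc n)"
| "psize i \<delta>s (All \<gamma> A) = (let n = psize i \<delta>s A in if n = 0 then 0 else Suc n)"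
| "psize i \<delta>s (Ex \<gamma> A) = (let n = psize i \<delta>s A in if n = 0 then 0 else Suc n)"
| "psize i \<delta>s (Mu \<gamma>s B ts) =
    (let n = psize (if \<gamma>s = \<delta>s then Suc i else i) \<delta>s B in if n = 0 then 0 else Suc n)"
| "psize i \<delta>s (Nu \<gamma>s B ts) =
    (let n = psize (if \<gamma>s = \<delta>s then Suc i else i) \<delta>s B in if n = 0 then 0 else Suc n)"
| "psize i \<delta>s (PVar j \<gamma>s ts) = (if j = i \<and> \<gamma>s = \<delta>s then 1 else 0)"
| "psize i \<delta>s _ = 0"

lemma psize_eq_0: "psize i \<delta>s Q = 0 \<longleftrightarrow> \<not> occurs i \<delta>s Q"
proof (induction Q arbitrary: i)
  case (Imp A B)
  then show ?case by (auto simp: occurs_def Let_def)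
qed (auto simp: occurs_def Let_def)

lemma psize_sub_fm [simp]: "psize i \<delta>s (sub_fm \<theta> Q) = psize i \<delta>s Q"
  by (induction Q arbitrary: i \<theta>) auto

lemma psize_pren_fm:
  assumes "\<And>j \<gamma>s. (r j \<gamma>s = i \<and> \<gamma>s = \<delta>s) \<longleftrightarrow> (j = k \<and> \<gamma>s = \<delta>s \<and> b)"
  shows "psize i \<delta>s (pren_fm r Q) = (if b then psize k \<delta>s Q else 0)"
  using assms
proof (induction Q arbitrary: i k r)
  case (Mu \<gamma>s B ts)
  have "psize (if \<gamma>s = \<delta>s then Suc i else i) \<delta>s (pren_fm (up_pren \<gamma>s r) B)
      = (if b then psize (if \<gamma>s = \<delta>s then Suc k else k) \<delta>s B else 0)"
    by (rule Mu.IH) (use Mu.prems in \<open>auto simp: up_pren_def split: nat.splits\<close>)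
  then show ?case by auto
next
  case (Nu \<gamma>s B ts)
  have "psize (if \<gamma>s = \<delta>s then Suc i else i) \<delta>s (pren_fm (up_pren \<gamma>s r) B)
      = (if b then psize (if \<gamma>s = \<delta>s then Suc k else k) \<delta>s B else 0)"
    by (rule Nu.IH) (use Nu.prems in \<open>auto simp: up_pren_def split: nat.splits\<close>)
  then show ?case by auto
qed (simp_all, (metis+)?)

lemma psize_pwk_same [simp]: "psize 0 \<delta>s (pwk \<delta>s Q) = 0"
  using psize_pren_fm[of "\<lambda>i \<gamma>s. if \<gamma>s = \<delta>s then Suc i else i" 0 \<delta>s 0 False Q]
  by (simp add: pwk_def)

lemma psize_pwk_up [simp]:
  "psize (Suc i) \<delta>s (pwk \<delta>s Q) = psize i \<delta>s Q"
  "\<gamma>s \<noteq> \<delta>s \<Longrightarrow> psize i \<delta>s (pwk \<gamma>s Q) = psize i \<delta>s Q"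
  unfolding pwk_def by (subst psize_pren_fm[where k = i and b = True]; auto)+

lemma psize_pup:
  assumes "\<And>j \<epsilon>s. psize i \<delta>s (\<rho> j \<epsilon>s) = (if j = k \<and> \<epsilon>s = \<delta>s then 1 else 0)"
  shows "psize (if \<gamma>s = \<delta>s then Suc i else i) \<delta>s (pup \<gamma>s \<rho> j \<epsilon>s)
    = (if j = (if \<gamma>s = \<delta>s then Suc k else k) \<and> \<epsilon>s = \<delta>s then 1 else 0)"
proof (cases "\<gamma>s = \<delta>s")
  case True
  then show ?thesis using assms by (cases j) (simp_all add: pup_def pscons_def pshift_def)
next
  case False
  then show ?thesis using assms by (cases j) (auto simp: pup_def pscons_def pshift_def)
qed

lemma psize_psub_fm:
  assumes "\<And>j \<gamma>s. psize i \<delta>s (\<rho> j \<gamma>s) = (if j = k \<and> \<gamma>s = \<delta>s then 1 else 0)"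
  shows "psize i \<delta>s (psub_fm \<rho> Q) = psize k \<delta>s Q"
  using assms
proof (induction Q arbitrary: i k \<rho>)
  case (Mu \<gamma>s B ts)
  from Mu.IH[OF psize_pup[OF Mu.prems]] show ?case by simp
next
  case (Nu \<gamma>s B ts)
  from Nu.IH[OF psize_pup[OF Nu.prems]] show ?case by simp
qed (simp_all add: pshift_def)

lemma psize_papp_pwk:
  "psize 0 \<delta>s (papp \<gamma>s Q (pwk \<delta>s M)) = psize (if \<gamma>s = \<delta>s then Suc 0 else 0) \<delta>s Q"
  unfolding papp_def
  by (rule psize_psub_fm) (auto simp: pinst_def pscons_def split: nat.splits)

text \<open>
  \<open>functoriality s \<delta>s P P' Q \<pi>\<close> is \<open>F\<^sup>s\<^bsub>\<lambda>p.Q\<^esub>(x\<^sub>1 \<dots> x\<^sub>n.\<alpha>.\<pi>)\<close> for \<open>p = PVar 0 \<delta>s\<close> and \<open>\<pi>\<close> proving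
  \<open>P' x\<^sub>1 \<dots> x\<^sub>n\<close> from \<open>\<alpha> : P x\<^sub>1 \<dots> x\<^sub>n\<close>. The result proves \<open>(\<lambda>p.Q) P \<supset> (\<lambda>p.Q) P'\<close> if \<open>s = Pos\<close>
  and \<open>(\<lambda>p.Q) P' \<supset> (\<lambda>p.Q) P\<close> if \<open>s = Neg\<close>; so \<open>P\<close> and \<open>P'\<close> change roles in the annotations of
  the fixed point cases if \<open>s = Neg\<close>. In these cases \<open>R\<close> is the body of \<open>B p\<close>, the bodies of
  \<open>B P\<close> and \<open>B P'\<close> are obtained by \<open>psub_fm (pup \<gamma>s (pinst \<delta>s _)) R\<close>, and \<open>pwk \<delta>s\<close> makes room
  for \<open>p\<close> in the formulas that replace the variable bound by the fixed point.
  Negative occurrences of \<open>p\<close> itself are excluded by the monotonicity of \<open>\<lambda>p.Q\<close>.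
\<close>

abbreviation wk_fun :: "'b ty list \<Rightarrow> 'b ty list \<Rightarrow> ('b, 'c, 'a) pf \<Rightarrow> ('b, 'c, 'a) pf" where
  "wk_fun \<delta>s \<gamma>s \<equiv> tsub_pf (ups \<delta>s (shifts \<gamma>s))"

abbreviation hwk :: "nat \<Rightarrow> ('b, 'c, 'a) pf \<Rightarrow> ('b, 'c, 'a) pf" where
  "hwk k \<equiv> ren_pf (\<lambda>n. n + k)"

function (sequential) functoriality ::
    "polarity \<Rightarrow> 'b ty list \<Rightarrow> ('b, 'c, 'a) fm \<Rightarrow> ('b, 'c, 'a) fm \<Rightarrow> ('b, 'c, 'a) fm
      \<Rightarrow> ('b, 'c, 'a) pf \<Rightarrow> ('b, 'c, 'a) pf" where
  "functoriality s \<delta>s P P' (PVar i \<gamma>s ts) \<pi> =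
    (if \<not> occurs 0 \<delta>s (PVar i \<gamma>s ts :: ('b, 'c, 'a) fm) then LamP (Hyp 0)
     else case s of Pos \<Rightarrow> LamP (tsub_pf (insts \<delta>s ts) \<pi>) | Neg \<Rightarrow> undefined)"
| "functoriality s \<delta>s P P' (And A B) \<pi> =
    (if \<not> occurs 0 \<delta>s (And A B) then LamP (Hyp 0)
     else LamP (PairP (AppP (hwk 1 (functoriality s \<delta>s P P' A \<pi>)) (Proj First (Hyp 0)))
                     (AppP (hwk 1 (functoriality s \<delta>s P P' B \<pi>)) (Proj Second (Hyp 0)))))"
| "functoriality s \<delta>s P P' (Or A B) \<pi> =
    (if \<not> occurs 0 \<delta>s (Or A B) then LamP (Hyp 0)
     else LamP (CaseOr (Hyp 0)
            (In First (AppP (hwk 2 (functoriality s \<delta>s P P' A \<pi>)) (Hyp 0)))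
            (In Second (AppP (hwk 2 (functoriality s \<delta>s P P' B \<pi>)) (Hyp 0)))))"
| "functoriality s \<delta>s P P' (Imp A B) \<pi> =
    (if \<not> occurs 0 \<delta>s (Imp A B) then LamP (Hyp 0)
     else LamP (LamP (AppP (hwk 2 (functoriality s \<delta>s P P' B \<pi>))
            (AppP (Hyp 1) (AppP (hwk 2 (functoriality (flip s) \<delta>s P P' A \<pi>)) (Hyp 0))))))"
| "functoriality s \<delta>s P P' (All \<gamma> A) \<pi> =
    (if \<not> occurs 0 \<delta>s (All \<gamma> A) then LamP (Hyp 0)
     else LamP (LamT \<gamma> (AppP
            (hwk 1 (functoriality s \<delta>s (wk_under \<delta>s [\<gamma>] P) (wk_under \<delta>s [\<gamma>] P') A (wk_fun \<delta>s [\<gamma>] \<pi>)))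
            (AppT (Hyp 0) (Var 0 \<gamma>)))))"
| "functoriality s \<delta>s P P' (Ex \<gamma> A) \<pi> =
    (if \<not> occurs 0 \<delta>s (Ex \<gamma> A) then LamP (Hyp 0)
     else LamP (CaseEx \<gamma> (Hyp 0) (Pack (Var 0 \<gamma>) (AppP
            (hwk 2 (functoriality s \<delta>s (wk_under \<delta>s [\<gamma>] P) (wk_under \<delta>s [\<gamma>] P') A (wk_fun \<delta>s [\<gamma>] \<pi>)))
            (Hyp 0)))))"
| "functoriality s \<delta>s P P' (Mu \<gamma>s R ts) \<pi> =
    (if \<not> occurs 0 \<delta>s (Mu \<gamma>s R ts) then LamP (Hyp 0)
     else let B' = psub_fm (pup \<gamma>s (pinst \<delta>s (case s of Pos \<Rightarrow> P' | Neg \<Rightarrow> P))) R in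
       LamP (MuE \<gamma>s (mu_pred \<gamma>s B') (Hyp 0)
         (MuI \<gamma>s (wk_under \<gamma>s \<gamma>s B') (vars \<gamma>s) (AppP
            (hwk 2 (functoriality s \<delta>s (wk_under \<delta>s \<gamma>s P) (wk_under \<delta>s \<gamma>s P')
              (papp \<gamma>s R (pwk \<delta>s (wk_under \<gamma>s \<gamma>s (mu_pred \<gamma>s B')))) (wk_fun \<delta>s \<gamma>s \<pi>)))
            (Hyp 0)))))"
| "functoriality s \<delta>s P P' (Nu \<gamma>s R ts) \<pi> =
    (if \<not> occurs 0 \<delta>s (Nu \<gamma>s R ts) then LamP (Hyp 0)
     else let B' = psub_fm (pup \<gamma>s (pinst \<delta>s (case s of Pos \<Rightarrow> P | Neg \<Rightarrow> P'))) R in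
       LamP (NuI \<gamma>s (nu_pred \<gamma>s B') (Hyp 0)
         (AppP
            (hwk 2 (functoriality s \<delta>s (wk_under \<delta>s \<gamma>s P) (wk_under \<delta>s \<gamma>s P')
              (papp \<gamma>s R (pwk \<delta>s (wk_under \<gamma>s \<gamma>s (nu_pred \<gamma>s B')))) (wk_fun \<delta>s \<gamma>s \<pi>)))
            (NuE \<gamma>s (wk_under \<gamma>s \<gamma>s B') (vars \<gamma>s) (Hyp 0)))))"
| "functoriality s \<delta>s P P' Q \<pi> = LamP (Hyp 0)"
  by pat_completeness auto
termination
  by (relation "measure (\<lambda>(s, \<delta>s, P, P', Q, \<pi>). psize 0 \<delta>s Q)")
     (auto simp: psize_eq_0[symmetric] psize_papp_pwk Let_def split: if_splits)


section \<open>Well-typed expressions, conversion and reduction\<close>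

locale signature =
  fixes ctyp :: "'c \<Rightarrow> 'b ty"
    and atyp :: "'a \<Rightarrow> 'b ty list"
begin

fun wt :: "('b, 'c) tm \<Rightarrow> 'b ty \<Rightarrow> bool" where
  "wt (Var i \<gamma>) \<tau> \<longleftrightarrow> \<tau> = \<gamma>"
| "wt (Cst c) \<tau> \<longleftrightarrow> \<tau> = ctyp c"
| "wt (App t u) \<tau> \<longleftrightarrow> (\<exists>\<gamma>. wt t (Fun \<gamma> \<tau>) \<and> wt u \<gamma>)"
| "wt (Lam \<gamma> t) \<tau> \<longleftrightarrow> (\<exists>\<tau>'. \<tau> = Fun \<gamma> \<tau>' \<and> wt t \<tau>')"

definition wt_sub :: "('b, 'c) tsub \<Rightarrow> bool" where
  "wt_sub \<theta> \<longleftrightarrow> (\<forall>i \<gamma>. wt (\<theta> i \<gamma>) \<gamma>)"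

fun wff :: "('b, 'c, 'a) fm \<Rightarrow> bool" where
  "wff Top \<longleftrightarrow> True"
| "wff Bot \<longleftrightarrow> True"
| "wff (Imp A B) \<longleftrightarrow> wff A \<and> wff B"
| "wff (And A B) \<longleftrightarrow> wff A \<and> wff B"
| "wff (Or A B) \<longleftrightarrow> wff A \<and> wff B"
| "wff (All \<gamma> A) \<longleftrightarrow> wff A"
| "wff (Ex \<gamma> A) \<longleftrightarrow> wff A"
| "wff (Eq t u) \<longleftrightarrow> (\<exists>\<tau>. wt t \<tau> \<and> wt u \<tau>)"
| "wff (Mu \<gamma>s B ts) \<longleftrightarrow> wff B \<and> \<not> occ Neg 0 \<gamma>s B \<and> list_all2 wt ts \<gamma>s"
| "wff (Nu \<gamma>s B ts) \<longleftrightarrow> wff B \<and> \<not> occ Neg 0 \<gamma>s B \<and> list_all2 wt ts \<gamma>s"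
| "wff (PVar i \<gamma>s ts) \<longleftrightarrow> list_all2 wt ts \<gamma>s"
| "wff (Atom a ts) \<longleftrightarrow> list_all2 wt ts (atyp a)"

definition wff_psub :: "('b, 'c, 'a) psub \<Rightarrow> bool" where
  "wff_psub \<rho> \<longleftrightarrow> (\<forall>i \<delta>s. wff (\<rho> i \<delta>s))"

inductive beta_eta :: "('b, 'c) tm \<Rightarrow> ('b, 'c) tm \<Rightarrow> 'b ty \<Rightarrow> bool" where
  be_refl: "wt t \<tau> \<Longrightarrow> beta_eta t t \<tau>"
| be_sym: "beta_eta t u \<tau> \<Longrightarrow> beta_eta u t \<tau>"
| be_trans: "beta_eta t u \<tau> \<Longrightarrow> beta_eta u v \<tau> \<Longrightarrow> beta_eta t v \<tau>"
| be_app: "beta_eta t t' (Fun \<gamma> \<tau>) \<Longrightarrow> beta_eta u u' \<gamma> \<Longrightarrow> beta_eta (App t u) (App t' u') \<tau>"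
| be_lam: "beta_eta t t' \<tau> \<Longrightarrow> beta_eta (Lam \<gamma> t) (Lam \<gamma> t') (Fun \<gamma> \<tau>)"
| be_beta: "wt t \<tau> \<Longrightarrow> wt u \<gamma> \<Longrightarrow> beta_eta (App (Lam \<gamma> t) u) (sub_tm (insts [\<gamma>] [u]) t) \<tau>"
| be_eta: "wt t (Fun \<gamma> \<tau>) \<Longrightarrow>
    beta_eta (Lam \<gamma> (App (sub_tm (shifts [\<gamma>]) t) (Var 0 \<gamma>))) t (Fun \<gamma> \<tau>)"

definition sub_eq :: "('b, 'c) tsub \<Rightarrow> ('b, 'c) tsub \<Rightarrow> bool" where
  "sub_eq \<theta> \<theta>' \<longleftrightarrow> (\<forall>i \<gamma>. beta_eta (\<theta> i \<gamma>) (\<theta>' i \<gamma>) \<gamma>)"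

inductive red :: "('b, 'c, 'a) pf \<Rightarrow> ('b, 'c, 'a) pf \<Rightarrow> bool" where
  red_imp: "red (AppP (LamP \<pi>) \<pi>') (hinst \<pi>' \<pi>)"
| red_and: "red (Proj k (PairP \<pi>1 \<pi>2)) (pick k \<pi>1 \<pi>2)"
| red_or: "red (CaseOr (In k \<pi>) \<pi>1 \<pi>2) (hinst \<pi> (pick k \<pi>1 \<pi>2))"
| red_all: "red (AppT (LamT \<gamma> \<pi>) t) (tsub_pf (insts [\<gamma>] [t]) \<pi>)"
| red_ex: "red (CaseEx \<gamma> (Pack t \<pi>) \<pi>') (hinst \<pi> (tsub_pf (insts [\<gamma>] [t]) \<pi>'))"
| red_mu: "red (MuE \<gamma>s S (MuI \<gamma>s B ts \<pi>) \<pi>')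
    (hinst
      (AppP
        (functoriality Pos \<gamma>s (mu_pred \<gamma>s B) S (sub_fm (insts \<gamma>s ts) B)
          (MuE \<gamma>s (wk_under \<gamma>s \<gamma>s S) (Hyp 0) (ren_pf (up_hren Suc) (wk_fun \<gamma>s \<gamma>s \<pi>'))))
        \<pi>)
      (tsub_pf (insts \<gamma>s ts) \<pi>'))"
| red_nu: "red (NuE \<gamma>s B ts (NuI \<gamma>s S \<pi> \<pi>'))
    (AppP
      (functoriality Pos \<gamma>s S (nu_pred \<gamma>s B) (sub_fm (insts \<gamma>s ts) B)
        (NuI \<gamma>s (wk_under \<gamma>s \<gamma>s S) (Hyp 0) (ren_pf (up_hren Suc) (wk_fun \<gamma>s \<gamma>s \<pi>'))))
      (hinst \<pi> (tsub_pf (insts \<gamma>s ts) \<pi>')))"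
| red_eq: "(\<theta>', \<pi>) \<in> set bs \<Longrightarrow> wt_sub \<theta>'' \<Longrightarrow> sub_eq \<theta> (tcomp \<theta>' \<theta>'') \<Longrightarrow>
    red (CaseEq \<Gamma> \<theta> \<sigma> u v Q (Refl w) bs) (hsub_pf (hsubs \<sigma>) (tsub_pf \<theta>'' \<pi>))"
| ctx_BotE: "red \<pi> \<pi>' \<Longrightarrow> red (BotE \<pi>) (BotE \<pi>')"
| ctx_LamP: "red \<pi> \<pi>' \<Longrightarrow> red (LamP \<pi>) (LamP \<pi>')"
| ctx_AppP1: "red \<pi> \<pi>' \<Longrightarrow> red (AppP \<pi> \<pi>1) (AppP \<pi>' \<pi>1)"
| ctx_AppP2: "red \<pi> \<pi>' \<Longrightarrow> red (AppP \<pi>1 \<pi>) (AppP \<pi>1 \<pi>')"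
| ctx_Pair1: "red \<pi> \<pi>' \<Longrightarrow> red (PairP \<pi> \<pi>1) (PairP \<pi>' \<pi>1)"
| ctx_Pair2: "red \<pi> \<pi>' \<Longrightarrow> red (PairP \<pi>1 \<pi>) (PairP \<pi>1 \<pi>')"
| ctx_Proj: "red \<pi> \<pi>' \<Longrightarrow> red (Proj k \<pi>) (Proj k \<pi>')"
| ctx_In: "red \<pi> \<pi>' \<Longrightarrow> red (In k \<pi>) (In k \<pi>')"
| ctx_CaseOr1: "red \<pi> \<pi>' \<Longrightarrow> red (CaseOr \<pi> \<pi>1 \<pi>2) (CaseOr \<pi>' \<pi>1 \<pi>2)"
| ctx_CaseOr2: "red \<pi> \<pi>' \<Longrightarrow> red (CaseOr \<pi>1 \<pi> \<pi>2) (CaseOr \<pi>1 \<pi>' \<pi>2)"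
| ctx_CaseOr3: "red \<pi> \<pi>' \<Longrightarrow> red (CaseOr \<pi>1 \<pi>2 \<pi>) (CaseOr \<pi>1 \<pi>2 \<pi>')"
| ctx_LamT: "red \<pi> \<pi>' \<Longrightarrow> red (LamT \<gamma> \<pi>) (LamT \<gamma> \<pi>')"
| ctx_AppT: "red \<pi> \<pi>' \<Longrightarrow> red (AppT \<pi> t) (AppT \<pi>' t)"
| ctx_Pack: "red \<pi> \<pi>' \<Longrightarrow> red (Pack t \<pi>) (Pack t \<pi>')"
| ctx_CaseEx1: "red \<pi> \<pi>' \<Longrightarrow> red (CaseEx \<gamma> \<pi> \<pi>1) (CaseEx \<gamma> \<pi>' \<pi>1)"
| ctx_CaseEx2: "red \<pi> \<pi>' \<Longrightarrow> red (CaseEx \<gamma> \<pi>1 \<pi>) (CaseEx \<gamma> \<pi>1 \<pi>')"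
| ctx_CaseEq1: "red \<pi> \<pi>' \<Longrightarrow> red (CaseEq \<Gamma> \<theta> \<sigma> u v Q \<pi> bs) (CaseEq \<Gamma> \<theta> \<sigma> u v Q \<pi>' bs)"
| ctx_CaseEq2: "red \<pi> \<pi>' \<Longrightarrow>
    red (CaseEq \<Gamma> \<theta> (\<sigma>1 @ \<pi> # \<sigma>2) u v Q \<pi>1 bs) (CaseEq \<Gamma> \<theta> (\<sigma>1 @ \<pi>' # \<sigma>2) u v Q \<pi>1 bs)"
| ctx_CaseEq3: "red \<pi> \<pi>' \<Longrightarrow>
    red (CaseEq \<Gamma> \<theta> \<sigma> u v Q \<pi>1 (bs1 @ (\<theta>', \<pi>) # bs2))
        (CaseEq \<Gamma> \<theta> \<sigma> u v Q \<pi>1 (bs1 @ (\<theta>', \<pi>') # bs2))"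
| ctx_MuI: "red \<pi> \<pi>' \<Longrightarrow> red (MuI \<gamma>s B ts \<pi>) (MuI \<gamma>s B ts \<pi>')"
| ctx_MuE1: "red \<pi> \<pi>' \<Longrightarrow> red (MuE \<gamma>s S \<pi> \<pi>1) (MuE \<gamma>s S \<pi>' \<pi>1)"
| ctx_MuE2: "red \<pi> \<pi>' \<Longrightarrow> red (MuE \<gamma>s S \<pi>1 \<pi>) (MuE \<gamma>s S \<pi>1 \<pi>')"
| ctx_NuI1: "red \<pi> \<pi>' \<Longrightarrow> red (NuI \<gamma>s S \<pi> \<pi>1) (NuI \<gamma>s S \<pi>' \<pi>1)"
| ctx_NuI2: "red \<pi> \<pi>' \<Longrightarrow> red (NuI \<gamma>s S \<pi>1 \<pi>) (NuI \<gamma>s S \<pi>1 \<pi>')"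
| ctx_NuE: "red \<pi> \<pi>' \<Longrightarrow> red (NuE \<gamma>s B ts \<pi>) (NuE \<gamma>s B ts \<pi>')"

end


section \<open>Congruences and typing\<close>

text \<open>
  The congruence is given by its restrictions to terms and to formulas; it only relates
  well-typed expressions of the same type. Compatibility with \<open>\<beta>\<close> at predicate types amounts
  to closure under predicate substitutions.
\<close>

locale congruence = signature ctyp atyp
  for ctyp :: "'c \<Rightarrow> 'b ty" and atyp :: "'a \<Rightarrow> 'b ty list" +
  fixes eqt :: "('b, 'c) tm \<Rightarrow> ('b, 'c) tm \<Rightarrow> bool"
    and eqf :: "('b, 'c, 'a) fm \<Rightarrow> ('b, 'c, 'a) fm \<Rightarrow> bool"
  assumes eqt_wt: "eqt t u \<Longrightarrow> \<exists>\<tau>. wt t \<tau> \<and> wt u \<tau>"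
    and eqt_beta_eta: "beta_eta t u \<tau> \<Longrightarrow> eqt t u"
    and eqt_sym: "eqt t u \<Longrightarrow> eqt u t"
    and eqt_trans: "eqt t u \<Longrightarrow> eqt u v \<Longrightarrow> eqt t v"
    and eqt_App: "eqt t t' \<Longrightarrow> eqt u u' \<Longrightarrow> wt (App t u) \<tau> \<Longrightarrow> eqt (App t u) (App t' u')"
    and eqt_Lam: "eqt t t' \<Longrightarrow> eqt (Lam \<gamma> t) (Lam \<gamma> t')"
    and eqt_sub: "eqt t u \<Longrightarrow> wt_sub \<theta> \<Longrightarrow> eqt (sub_tm \<theta> t) (sub_tm \<theta> u)"
    and eqf_wf: "eqf A B \<Longrightarrow> wff A \<and> wff B"
    and eqf_refl: "wff A \<Longrightarrow> eqf A A"
    and eqf_sym: "eqf A B \<Longrightarrow> eqf B A"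
    and eqf_trans: "eqf A B \<Longrightarrow> eqf B C \<Longrightarrow> eqf A C"
    and eqf_Imp: "eqf A A' \<Longrightarrow> eqf B B' \<Longrightarrow> eqf (Imp A B) (Imp A' B')"
    and eqf_And: "eqf A A' \<Longrightarrow> eqf B B' \<Longrightarrow> eqf (And A B) (And A' B')"
    and eqf_Or: "eqf A A' \<Longrightarrow> eqf B B' \<Longrightarrow> eqf (Or A B) (Or A' B')"
    and eqf_All: "eqf A A' \<Longrightarrow> eqf (All \<gamma> A) (All \<gamma> A')"
    and eqf_Ex: "eqf A A' \<Longrightarrow> eqf (Ex \<gamma> A) (Ex \<gamma> A')"
    and eqf_Eq: "eqt t t' \<Longrightarrow> eqt u u' \<Longrightarrow> wff (Eq t u) \<Longrightarrow> eqf (Eq t u) (Eq t' u')"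
    and eqf_Mu: "eqf B B' \<Longrightarrow> list_all2 eqt ts ts' \<Longrightarrow> wff (Mu \<gamma>s B ts) \<Longrightarrow> wff (Mu \<gamma>s B' ts') \<Longrightarrow>
      eqf (Mu \<gamma>s B ts) (Mu \<gamma>s B' ts')"
    and eqf_Nu: "eqf B B' \<Longrightarrow> list_all2 eqt ts ts' \<Longrightarrow> wff (Nu \<gamma>s B ts) \<Longrightarrow> wff (Nu \<gamma>s B' ts') \<Longrightarrow>
      eqf (Nu \<gamma>s B ts) (Nu \<gamma>s B' ts')"
    and eqf_PVar: "list_all2 eqt ts ts' \<Longrightarrow> wff (PVar i \<gamma>s ts) \<Longrightarrow> eqf (PVar i \<gamma>s ts) (PVar i \<gamma>s ts')"
    and eqf_Atom: "list_all2 eqt ts ts' \<Longrightarrow> wff (Atom a ts) \<Longrightarrow> eqf (Atom a ts) (Atom a ts')"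
    and eqf_sub: "eqf A B \<Longrightarrow> wt_sub \<theta> \<Longrightarrow> eqf (sub_fm \<theta> A) (sub_fm \<theta> B)"
    and eqf_psub: "eqf A B \<Longrightarrow> wff_psub \<rho> \<Longrightarrow> eqf (psub_fm \<rho> A) (psub_fm \<rho> B)"
begin

text \<open>
  Logical connectives, quantifiers and fixed points are injective modulo the congruence.
  (Subject reduction fails, for instance, if the congruence is generated by
  \<open>\<top> \<and> \<bottom> \<equiv> \<top> \<and> \<top>\<close>: then \<open>proj\<^sub>2 \<langle>\<langle>\<rangle>, \<langle>\<rangle>\<rangle>\<close> proves \<open>\<bottom>\<close> but \<open>\<langle>\<rangle>\<close> does not.)
\<close>

definition non_confusing :: bool where
  "non_confusing \<longleftrightarrow>
    (\<forall>A B A' B'. eqf (Imp A B) (Imp A' B') \<longrightarrow> eqf A A' \<and> eqf B B') \<and>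
    (\<forall>A B A' B'. eqf (And A B) (And A' B') \<longrightarrow> eqf A A' \<and> eqf B B') \<and>
    (\<forall>A B A' B'. eqf (Or A B) (Or A' B') \<longrightarrow> eqf A A' \<and> eqf B B') \<and>
    (\<forall>\<gamma> A \<gamma>' A'. eqf (All \<gamma> A) (All \<gamma>' A') \<longrightarrow> \<gamma> = \<gamma>' \<and> eqf A A') \<and>
    (\<forall>\<gamma> A \<gamma>' A'. eqf (Ex \<gamma> A) (Ex \<gamma>' A') \<longrightarrow> \<gamma> = \<gamma>' \<and> eqf A A') \<and>
    (\<forall>\<gamma>s B ts \<gamma>s' B' ts'. eqf (Mu \<gamma>s B ts) (Mu \<gamma>s' B' ts') \<longrightarrow>
      \<gamma>s = \<gamma>s' \<and> eqf B B' \<and> list_all2 eqt ts ts') \<and>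
    (\<forall>\<gamma>s B ts \<gamma>s' B' ts'. eqf (Nu \<gamma>s B ts) (Nu \<gamma>s' B' ts') \<longrightarrow>
      \<gamma>s = \<gamma>s' \<and> eqf B B' \<and> list_all2 eqt ts ts')"

definition unifier :: "('b, 'c) tm \<Rightarrow> ('b, 'c) tm \<Rightarrow> ('b, 'c) tsub \<Rightarrow> bool" where
  "unifier u v \<theta> \<longleftrightarrow> wt_sub \<theta> \<and> eqt (sub_tm \<theta> u) (sub_tm \<theta> v)"

definition csu :: "('b, 'c) tm \<Rightarrow> ('b, 'c) tm \<Rightarrow> ('b, 'c) tsub set \<Rightarrow> bool" where
  "csu u v \<Theta> \<longleftrightarrow> (\<forall>\<theta>\<in>\<Theta>. unifier u v \<theta>) \<and>
    (\<forall>\<theta>. unifier u v \<theta> \<longrightarrow> (\<exists>\<theta>'\<in>\<Theta>. \<exists>\<theta>''. wt_sub \<theta>'' \<and> sub_eq \<theta> (tcomp \<theta>' \<theta>'')))"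

inductive typing :: "('b, 'c, 'a) fm list \<Rightarrow> ('b, 'c, 'a) pf \<Rightarrow> ('b, 'c, 'a) fm \<Rightarrow> bool" where
  ty_Hyp: "n < length \<Gamma> \<Longrightarrow> eqf P (\<Gamma> ! n) \<Longrightarrow> typing \<Gamma> (Hyp n) P"
| ty_Unit: "eqf P Top \<Longrightarrow> typing \<Gamma> Unit P"
| ty_BotE: "typing \<Gamma> \<pi> Bot \<Longrightarrow> wff P \<Longrightarrow> typing \<Gamma> (BotE \<pi>) P"
| ty_LamP: "typing (P1 # \<Gamma>) \<pi> P2 \<Longrightarrow> eqf P (Imp P1 P2) \<Longrightarrow> typing \<Gamma> (LamP \<pi>) P"
| ty_AppP: "typing \<Gamma> \<pi> (Imp Q P) \<Longrightarrow> typing \<Gamma> \<pi>' Q \<Longrightarrow> typing \<Gamma> (AppP \<pi> \<pi>') P"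
| ty_Pair: "typing \<Gamma> \<pi>1 P1 \<Longrightarrow> typing \<Gamma> \<pi>2 P2 \<Longrightarrow> eqf P (And P1 P2) \<Longrightarrow> typing \<Gamma> (PairP \<pi>1 \<pi>2) P"
| ty_Proj: "typing \<Gamma> \<pi> (And P1 P2) \<Longrightarrow> eqf P (pick k P1 P2) \<Longrightarrow> typing \<Gamma> (Proj k \<pi>) P"
| ty_In: "typing \<Gamma> \<pi> (pick k P1 P2) \<Longrightarrow> eqf P (Or P1 P2) \<Longrightarrow> typing \<Gamma> (In k \<pi>) P"
| ty_CaseOr: "typing \<Gamma> \<pi> (Or P1 P2) \<Longrightarrow> typing (P1 # \<Gamma>) \<pi>1 P \<Longrightarrow> typing (P2 # \<Gamma>) \<pi>2 P \<Longrightarrow>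
    typing \<Gamma> (CaseOr \<pi> \<pi>1 \<pi>2) P"
| ty_LamT: "typing (map (wk [\<gamma>]) \<Gamma>) \<pi> Q \<Longrightarrow> eqf P (All \<gamma> Q) \<Longrightarrow> typing \<Gamma> (LamT \<gamma> \<pi>) P"
| ty_AppT: "typing \<Gamma> \<pi> (All \<gamma> Q) \<Longrightarrow> wt t \<gamma> \<Longrightarrow> eqf P (sub_fm (insts [\<gamma>] [t]) Q) \<Longrightarrow>
    typing \<Gamma> (AppT \<pi> t) P"
| ty_Pack: "typing \<Gamma> \<pi> (sub_fm (insts [\<gamma>] [t]) Q) \<Longrightarrow> wt t \<gamma> \<Longrightarrow> eqf P (Ex \<gamma> Q) \<Longrightarrow>
    typing \<Gamma> (Pack t \<pi>) P"
| ty_CaseEx: "typing \<Gamma> \<pi> (Ex \<gamma> Q) \<Longrightarrow> typing (Q # map (wk [\<gamma>]) \<Gamma>) \<pi>' (wk [\<gamma>] P) \<Longrightarrow>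
    typing \<Gamma> (CaseEx \<gamma> \<pi> \<pi>') P"
| ty_Refl: "eqf P (Eq t t) \<Longrightarrow> typing \<Gamma> (Refl t) P"
| ty_CaseEq: "wt_sub \<theta> \<Longrightarrow> \<forall>A\<in>set \<Gamma>. wff A \<Longrightarrow> wff (Eq u v) \<Longrightarrow> wff Q \<Longrightarrow>
    typing \<Gamma>' \<pi> (Eq (sub_tm \<theta> u) (sub_tm \<theta> v)) \<Longrightarrow>
    length \<sigma> = length \<Gamma> \<Longrightarrow> (\<forall>n<length \<Gamma>. typing \<Gamma>' (\<sigma> ! n) (sub_fm \<theta> (\<Gamma> ! n))) \<Longrightarrow>
    csu u v (fst ` set bs) \<Longrightarrow>
    (\<forall>(\<theta>', \<pi>')\<in>set bs. typing (map (sub_fm \<theta>') \<Gamma>) \<pi>' (sub_fm \<theta>' Q)) \<Longrightarrow>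
    eqf P (sub_fm \<theta> Q) \<Longrightarrow>
    typing \<Gamma>' (CaseEq \<Gamma> \<theta> \<sigma> u v Q \<pi> bs) P"
| ty_MuI: "typing \<Gamma> \<pi> (unfold \<gamma>s B (mu_pred \<gamma>s B) ts) \<Longrightarrow> eqf P (Mu \<gamma>s B ts) \<Longrightarrow>
    typing \<Gamma> (MuI \<gamma>s B ts \<pi>) P"
| ty_MuE: "typing \<Gamma> \<pi> (Mu \<gamma>s B ts) \<Longrightarrow>
    typing (unfold_vars \<gamma>s B S # map (wk \<gamma>s) \<Gamma>) \<pi>' S \<Longrightarrow>
    eqf P (sub_fm (insts \<gamma>s ts) S) \<Longrightarrow> typing \<Gamma> (MuE \<gamma>s S \<pi> \<pi>') P"
| ty_NuI: "typing \<Gamma> \<pi> (sub_fm (insts \<gamma>s ts) S) \<Longrightarrow>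
    typing (S # map (wk \<gamma>s) \<Gamma>) \<pi>' (unfold_vars \<gamma>s B S) \<Longrightarrow>
    eqf P (Nu \<gamma>s B ts) \<Longrightarrow> typing \<Gamma> (NuI \<gamma>s S \<pi> \<pi>') P"
| ty_NuE: "typing \<Gamma> \<pi> (Nu \<gamma>s B ts) \<Longrightarrow> eqf P (unfold \<gamma>s B (nu_pred \<gamma>s B) ts) \<Longrightarrow>
    typing \<Gamma> (NuE \<gamma>s B ts \<pi>) P"

end

end

theory Submission
  imports Defs
begin

text \<open>
  Typing is stable under term substitutions, under proof substitutions and under the congruence;
  redexes for the propositional connectives and the quantifiers then follow by injectivity of
  the connectives modulo the congruence. In a redex for equality, the branch is typed for a
  \<open>\<theta>'\<close> with \<open>\<theta> \<equiv> \<theta>'\<theta>''\<close>, and pointwise congruent substitutions give congruent formulas. In a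
  redex for a fixed point, the functoriality map \<open>F\<^sub>B(\<pi>)\<close> proves \<open>B P \<supset> B P'\<close> whenever \<open>\<pi>\<close> proves
  \<open>P' x\<close> from \<open>P x\<close>. At a nested fixed point \<open>\<mu> (B p)\<close> this holds because replacing the bound
  predicate by \<open>\<mu> (B P')\<close> and then \<open>p\<close> by \<open>P\<close> is the same as replacing them in the other order.

  Hypotheses need not be well formed, but an ill-formed one cannot be used; hence renamings and
  substitutions of hypotheses are only constrained on the well-formed ones.
\<close>

section \<open>Calculus of term substitutions\<close>

text \<open>Predicate application is represented by its normal form, so identities that hold by mere
  conversion on paper, such as B S x instantiated at t being B S t, become equations between de
  Bruijn substitutions. Those for terms are brought to a normal form, a block of values prepended to
  a tail, in which such equations can be computed; those for predicates are compared variable by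
  variable. The two rules that meet in a redex need not carry the same data: for a fixed point,
  bodies and argument lists agree only up to the congruence, and the type system has no conversion
  rule. Hence conversion is shown admissible, and hypotheses may be exchanged for congruent ones.
  Functoriality is not structural at a fixed point: it recurses on the body with the bound predicate
  already replaced, which need not be a smaller formula. Its typing therefore follows the recursion
  of the function, whose measure counts only occurrences of p and connectives above them.
  Implication exchanges source and target, so both polarities are treated together.\<close>

lemma up_ren_comp:
  "up_ren \<gamma> r' (up_ren \<gamma> r i \<delta>) \<delta> = up_ren \<gamma> (\<lambda>i \<delta>. r' (r i \<delta>) \<delta>) i \<delta>"
  by (auto simp: up_ren_def split: nat.splits)

lemma ren_ren_tm: "ren_tm r' (ren_tm r t) = ren_tm (\<lambda>i \<gamma>. r' (r i \<gamma>) \<gamma>) t"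
  by (induction t arbitrary: r r') (auto simp: up_ren_comp[abs_def])

lemma up_up_ren: "up \<gamma> \<theta> (up_ren \<gamma> r i \<delta>) \<delta> = up \<gamma> (\<lambda>i \<delta>. \<theta> (r i \<delta>) \<delta>) i \<delta>"
  by (auto simp: up_ren_def up_def scons_def split: nat.splits)

lemma sub_ren_tm: "sub_tm \<theta> (ren_tm r t) = sub_tm (\<lambda>i \<gamma>. \<theta> (r i \<gamma>) \<gamma>) t"
  by (induction t arbitrary: \<theta> r) (auto simp: up_up_ren[abs_def])

lemma ren_up: "ren_tm (up_ren \<gamma> r) (up \<gamma> \<theta> i \<delta>) = up \<gamma> (\<lambda>i \<delta>. ren_tm r (\<theta> i \<delta>)) i \<delta>"
  by (auto simp: up_ren_def up_def scons_def ren_ren_tm split: nat.splits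
      intro!: arg_cong[where f = "\<lambda>r. ren_tm r _"] ext)

lemma ren_sub_tm: "ren_tm r (sub_tm \<theta> t) = sub_tm (\<lambda>i \<gamma>. ren_tm r (\<theta> i \<gamma>)) t"
  by (induction t arbitrary: \<theta> r) (auto simp: ren_up[abs_def])

text \<open>The second lift meets terms already weakened by the first. Moving a weakening through a
  substitution is \<open>ren_sub_tm\<close> and \<open>sub_ren_tm\<close>; this is why renamings
  come before substitutions.\<close>

lemma tcomp_up_up: "tcomp (up \<gamma> \<theta>) (up \<gamma> \<theta>') = up \<gamma> (tcomp \<theta> \<theta>')"
  by (intro ext) (auto simp: tcomp_def up_def scons_def ren_sub_tm sub_ren_tm split: nat.splits
      intro!: arg_cong[where f = "\<lambda>r. sub_tm r _"] ext)

lemma sub_sub_tm [simp]: "sub_tm \<theta>' (sub_tm \<theta> t) = sub_tm (tcomp \<theta> \<theta>') t"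
proof (induction t arbitrary: \<theta> \<theta>')
  case (Var i \<gamma>)
  then show ?case by (simp add: tcomp_def)
qed (auto simp: tcomp_up_up)

lemma up_Var [simp]: "up \<gamma> Var = Var"
  by (intro ext) (auto simp: up_def scons_def split: nat.splits)

lemma sub_tm_Var [simp]: "sub_tm Var t = t"
  by (induction t) auto

lemma map_sub_tm_Var [simp]: "map (sub_tm Var) ts = ts"
  by (simp add: map_idI)

lemma tcomp_Var [simp]: "tcomp Var \<theta> = \<theta>" "tcomp \<theta> Var = \<theta>"
  by (auto simp: tcomp_def fun_eq_iff)

lemma tcomp_assoc [simp]: "tcomp (tcomp \<theta> \<theta>') \<theta>'' = tcomp \<theta> (tcomp \<theta>' \<theta>'')"
  by (auto simp: tcomp_def fun_eq_iff)

lemma ren_tm_eq_sub_tm: "ren_tm r t = sub_tm (\<lambda>i \<gamma>. Var (r i \<gamma>) \<gamma>) t"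
  using sub_ren_tm[of Var r t] by simp

lemma ren_tm_shift:
  "ren_tm (\<lambda>j \<epsilon>. if \<epsilon> = \<gamma> then Suc j else j) t = sub_tm (shifts [\<gamma>]) t"
  by (auto simp: ren_tm_eq_sub_tm shifts_def fun_eq_iff intro!: arg_cong[where f = "\<lambda>r. sub_tm r t"])

section \<open>Normal forms for instantiation, lifting and weakening by blocks of binders\<close>

text \<open>This is \<open>insts\<close> with an arbitrary tail in place of \<open>Var\<close>.
  Thanks to the tail, lifts are instances as well (\<open>ups_eq\<close>), and composites of lifts,
  weakenings and instantiations are computed by the rewrite rules for \<open>sconss\<close>.\<close>

definition sconss :: "'b ty list \<Rightarrow> ('b, 'c) tm list \<Rightarrow> ('b, 'c) tsub \<Rightarrow> ('b, 'c) tsub" where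
  "sconss \<gamma>s ts \<theta> = fold (\<lambda>(\<gamma>, t). scons \<gamma> t) (zip \<gamma>s ts) \<theta>"

lemma sconss_Nil [simp]: "sconss [] ts \<theta> = \<theta>"
  by (simp add: sconss_def)

lemma sconss_Cons [simp]: "sconss (\<gamma> # \<gamma>s) (t # ts) \<theta> = sconss \<gamma>s ts (scons \<gamma> t \<theta>)"
  by (simp add: sconss_def)

lemma insts_eq: "insts \<gamma>s ts = sconss \<gamma>s ts Var"
  by (simp add: insts_def sconss_def)

lemma tcomp_scons [simp]: "tcomp (scons \<gamma> t \<theta>) \<theta>' = scons \<gamma> (sub_tm \<theta>' t) (tcomp \<theta> \<theta>')"
  by (auto simp: tcomp_def scons_def fun_eq_iff split: nat.splits)

lemma length_vars [simp]: "length (vars \<gamma>s) = length \<gamma>s"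
  by (induction \<gamma>s) auto

lemma tcomp_sconss [simp]:
  "length ts = length \<gamma>s \<Longrightarrow>
    tcomp (sconss \<gamma>s ts \<theta>) \<theta>' = sconss \<gamma>s (map (sub_tm \<theta>') ts) (tcomp \<theta> \<theta>')"
  by (induction ts \<gamma>s arbitrary: \<theta> rule: list_induct2) auto

lemma tcomp_shifts_scons: "tcomp (shifts [\<gamma>]) (scons \<gamma> t \<theta>) = \<theta>"
  by (auto simp: tcomp_def shifts_def scons_def fun_eq_iff)

lemma shifts_Cons: "shifts (\<gamma> # \<gamma>s) = tcomp (shifts [\<gamma>]) (shifts \<gamma>s)"
  by (auto simp: tcomp_def shifts_def fun_eq_iff)

lemma shifts_Nil [simp]: "shifts [] = Var"
  by (auto simp: shifts_def fun_eq_iff)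

lemma tcomp_shifts_sconss [simp]:
  "length ts = length \<gamma>s \<Longrightarrow> tcomp (shifts \<gamma>s) (sconss \<gamma>s ts \<theta>) = \<theta>"
proof (induction ts \<gamma>s arbitrary: \<theta> rule: list_induct2)
  case (Cons t ts \<gamma> \<gamma>s)
  then show ?case by (simp add: shifts_Cons[of \<gamma> \<gamma>s] tcomp_shifts_scons)
qed simp

lemma sconss_shift:
  assumes "length ts = length \<gamma>s"
  shows "sconss \<gamma>s ts \<theta> (i + count_list \<gamma>s \<delta>) \<delta> = \<theta> i \<delta>"
  using fun_cong[OF fun_cong[OF tcomp_shifts_sconss[OF assms, of \<theta>]], of i \<delta>]
  by (simp add: tcomp_def shifts_def)

lemma map_sconss_vars [simp]:
  "length ts = length \<gamma>s \<Longrightarrow> map (sub_tm (sconss \<gamma>s ts \<theta>)) (vars \<gamma>s) = ts"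
proof (induction ts \<gamma>s arbitrary: \<theta> rule: list_induct2)
  case (Cons t ts \<gamma> \<gamma>s)
  \<comment> \<open>The head of \<open>vars\<close> skips exactly the later binders of its own type,
    so its lookup passes \<open>ts\<close> and finds the value t at index 0 of the tail.\<close>
  then show ?case using sconss_shift[of ts \<gamma>s "scons \<gamma> t \<theta>" 0 \<gamma>] by (simp add: scons_def)
qed simp

lemma up_eq: "up \<gamma> \<theta> = scons \<gamma> (Var 0 \<gamma>) (tcomp \<theta> (shifts [\<gamma>]))"
  unfolding up_def ren_tm_shift by (simp add: tcomp_def[abs_def])

text \<open>A single lift prepends variable 0, and the binders that follow push its index to the
  number of those having the same type. This is the index chosen in \<open>vars\<close>.\<close>

lemma ups_eq: "ups \<gamma>s \<theta> = sconss \<gamma>s (vars \<gamma>s) (tcomp \<theta> (shifts \<gamma>s))"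
proof (induction \<gamma>s arbitrary: \<theta>)
  case (Cons \<gamma> \<gamma>s)
  have "ups (\<gamma> # \<gamma>s) \<theta> = ups \<gamma>s (up \<gamma> \<theta>)" by (simp add: ups_def)
  also have "\<dots> = sconss (\<gamma> # \<gamma>s) (vars (\<gamma> # \<gamma>s)) (tcomp \<theta> (shifts (\<gamma> # \<gamma>s)))"
    unfolding Cons by (simp add: up_eq shifts_Cons[of \<gamma> \<gamma>s]) (simp add: shifts_def)
  finally show ?case .
qed (simp add: ups_def)

lemma ups_Var [simp]: "ups \<gamma>s Var = Var"
  by (induction \<gamma>s) (auto simp: ups_def)

lemma sconss_vars_shifts [simp]: "sconss \<gamma>s (vars \<gamma>s) (shifts \<gamma>s) = Var"
  by (metis ups_eq ups_Var tcomp_Var(1))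

lemma up_eq_ups: "up \<gamma> \<theta> = ups [\<gamma>] \<theta>"
  by (simp add: ups_def)

lemma tcomp_ups_ups [simp]: "tcomp (ups \<gamma>s \<theta>) (ups \<gamma>s \<theta>') = ups \<gamma>s (tcomp \<theta> \<theta>')"
  by (simp add: ups_eq)

text \<open>The law Q[t]\<theta> = (Q\<theta>)[t\<theta>], freed from Q. It is what the typing rules
  with an instantiated formula need under a term substitution.\<close>

lemma tcomp_ups_insts:
  "length ts = length \<gamma>s \<Longrightarrow>
    tcomp (ups \<gamma>s \<theta>) (insts \<gamma>s (map (sub_tm \<theta>) ts)) = tcomp (insts \<gamma>s ts) \<theta>"
  by (simp add: ups_eq insts_eq)

lemma tcomp_shifts_insts [simp]:
  "length ts = length \<gamma>s \<Longrightarrow> tcomp (shifts \<gamma>s) (insts \<gamma>s ts) = Var"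
  by (simp add: insts_eq)

lemma tcomp_shifts_ups: "tcomp (shifts \<gamma>s) (ups \<gamma>s \<theta>) = tcomp \<theta> (shifts \<gamma>s)"
  by (simp add: ups_eq)

lemma map_ups_vars [simp]: "map (sub_tm (ups \<gamma>s \<theta>)) (vars \<gamma>s) = vars \<gamma>s"
  by (simp add: ups_eq)

lemma map_insts_vars [simp]:
  "length ts = length \<gamma>s \<Longrightarrow> map (sub_tm (insts \<gamma>s ts)) (vars \<gamma>s) = ts"
  by (simp add: insts_eq)

lemma tcomp_ups_tcomp_shifts_insts_vars [simp]:
  "tcomp (ups \<gamma>s (tcomp \<theta> (shifts \<gamma>s))) (insts \<gamma>s (vars \<gamma>s)) = ups \<gamma>s \<theta>"
  by (simp add: ups_eq insts_eq)

text \<open>The eta law for predicates: an abstraction, weakened by a copy of its own block and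
  applied to the variables of that copy, gives back its body.\<close>

lemma tcomp_ups_shifts_insts_vars [simp]:
  "tcomp (ups \<gamma>s (shifts \<gamma>s)) (insts \<gamma>s (vars \<gamma>s)) = Var"
  by (simp add: ups_eq insts_eq)


lemma insts_Var0: "tcomp (up \<gamma> (shifts [\<gamma>])) (insts [\<gamma>] [Var 0 \<gamma>]) = Var"
  using tcomp_ups_shifts_insts_vars[of "[\<gamma>]"] by (simp add: up_eq_ups)


section \<open>Calculus of substitutions in formulas\<close>

lemma sub_sub_fm [simp]: "sub_fm \<theta>' (sub_fm \<theta> A) = sub_fm (tcomp \<theta> \<theta>') A"
  by (induction A arbitrary: \<theta> \<theta>') (auto simp: tcomp_up_up)

lemma sub_fm_Var [simp]: "sub_fm Var A = A"
  by (induction A) auto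

lemma sub_pren_fm: "sub_fm \<theta> (pren_fm r A) = pren_fm r (sub_fm \<theta> A)"
  by (induction A arbitrary: \<theta> r) auto

lemma sub_pwk: "sub_fm \<theta> (pwk \<gamma>s A) = pwk \<gamma>s (sub_fm \<theta> A)"
  by (simp add: pwk_def sub_pren_fm)

section \<open>Renaming of predicate variables\<close>

lemma up_pren_comp:
  "up_pren \<gamma>s r' (up_pren \<gamma>s r i \<delta>s) \<delta>s = up_pren \<gamma>s (\<lambda>i \<delta>s. r' (r i \<delta>s) \<delta>s) i \<delta>s"
  by (auto simp: up_pren_def split: nat.splits)

lemma pren_pren_fm: "pren_fm r' (pren_fm r A) = pren_fm (\<lambda>i \<gamma>s. r' (r i \<gamma>s) \<gamma>s) A"
  by (induction A arbitrary: r r') (auto simp: up_pren_comp[abs_def])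

lemma pren_pwk: "pren_fm (up_pren \<gamma>s r) (pwk \<gamma>s A) = pwk \<gamma>s (pren_fm r A)"
  unfolding pwk_def pren_pren_fm
  by (rule arg_cong[where f = "\<lambda>r. pren_fm r A"]) (auto simp: up_pren_def fun_eq_iff)

lemma pup_up_pren:
  "pup \<gamma>s \<rho> (up_pren \<gamma>s r i \<delta>s) \<delta>s = pup \<gamma>s (\<lambda>i \<delta>s. \<rho> (r i \<delta>s) \<delta>s) i \<delta>s"
  by (auto simp: up_pren_def pup_def pscons_def pshift_def split: nat.splits)

lemma psub_pren_fm: "psub_fm \<rho> (pren_fm r A) = psub_fm (\<lambda>i \<gamma>s. \<rho> (r i \<gamma>s) \<gamma>s) A"
  by (induction A arbitrary: \<rho> r) (auto simp: pup_up_pren[abs_def] pshift_def[abs_def])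

lemma pren_pup:
  "pren_fm (up_pren \<gamma>s r) (pup \<gamma>s \<rho> i \<delta>s) = pup \<gamma>s (\<lambda>i \<delta>s. pren_fm r (\<rho> i \<delta>s)) i \<delta>s"
  by (auto simp: pup_def pscons_def pshift_def pren_pwk sub_pren_fm up_pren_def split: nat.splits)

lemma pren_psub_fm: "pren_fm r (psub_fm \<rho> A) = psub_fm (\<lambda>i \<gamma>s. pren_fm r (\<rho> i \<gamma>s)) A"
  by (induction A arbitrary: \<rho> r)
    (auto simp: pren_pup[abs_def] pshift_def[abs_def] sub_pren_fm)

section \<open>Action of term substitutions on predicate substitutions\<close>

text \<open>The formula substituted for a predicate variable stands below its argument variables
  \<delta>s. These must stay fixed, hence the lift of \<theta>.\<close>

definition psub_shift :: "('b, 'c) tsub \<Rightarrow> ('b, 'c, 'a) psub \<Rightarrow> ('b, 'c, 'a) psub" where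
  "psub_shift \<theta> \<rho> i \<delta>s = sub_fm (ups \<delta>s \<theta>) (\<rho> i \<delta>s)"

lemma pshift_eq: "pshift \<gamma>s = psub_shift (shifts \<gamma>s)"
  by (simp add: pshift_def psub_shift_def fun_eq_iff)

lemma psub_shift_comp [simp]:
  "psub_shift \<theta>' (psub_shift \<theta> \<rho>) = psub_shift (tcomp \<theta> \<theta>') \<rho>"
  by (simp add: psub_shift_def fun_eq_iff)

lemma psub_shift_Var [simp]: "psub_shift Var \<rho> = \<rho>"
  by (simp add: psub_shift_def fun_eq_iff)

lemma psub_shift_pup: "psub_shift (ups \<gamma>s \<theta>) (pup \<gamma>s \<rho>) = pup \<gamma>s (psub_shift \<theta> \<rho>)"
  by (intro ext) (auto simp: psub_shift_def pup_def pscons_def pshift_def sub_pwk tcomp_shifts_ups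
      ups_eq split: nat.splits)

lemma psub_shift_pinst [simp]:
  "psub_shift \<theta> (pinst \<gamma>s S) = pinst \<gamma>s (sub_fm (ups \<gamma>s \<theta>) S)"
  by (intro ext) (auto simp: psub_shift_def pinst_def pscons_def split: nat.splits)

lemma psub_shift_pshift:
  "psub_shift (ups \<gamma>s \<theta>) (pshift \<gamma>s \<rho>) = pshift \<gamma>s (psub_shift \<theta> \<rho>)"
  by (simp add: pshift_eq tcomp_shifts_ups)

section \<open>Occurrences and polarity under substitution\<close>

lemma occ_sub_fm [simp]: "occ s i \<delta>s (sub_fm \<theta> Q) = occ s i \<delta>s Q"
  by (induction Q arbitrary: s i \<theta>) auto

text \<open>The assumption describes the preimage of variable i of type \<delta>s under r: it is k
  alone if b holds, and empty otherwise. Covering both cases at once yields the fresh index and the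
  shifted indices of \<open>pwk\<close> from the same induction.\<close>

lemma occ_pren_fm:
  assumes "\<And>j \<gamma>s. (r j \<gamma>s = i \<and> \<gamma>s = \<delta>s) \<longleftrightarrow> (j = k \<and> \<gamma>s = \<delta>s \<and> b)"
  shows "occ s i \<delta>s (pren_fm r Q) \<longleftrightarrow> b \<and> occ s k \<delta>s Q"
  using assms
proof (induction Q arbitrary: s i k r)
  case (Mu \<gamma>s B ts)
  have "occ s (if \<gamma>s = \<delta>s then Suc i else i) \<delta>s (pren_fm (up_pren \<gamma>s r) B)
      \<longleftrightarrow> b \<and> occ s (if \<gamma>s = \<delta>s then Suc k else k) \<delta>s B"
    by (rule Mu.IH) (use Mu.prems in \<open>auto simp: up_pren_def split: nat.splits\<close>)
  then show ?case by simp
next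
  case (Nu \<gamma>s B ts)
  have "occ s (if \<gamma>s = \<delta>s then Suc i else i) \<delta>s (pren_fm (up_pren \<gamma>s r) B)
      \<longleftrightarrow> b \<and> occ s (if \<gamma>s = \<delta>s then Suc k else k) \<delta>s B"
    by (rule Nu.IH) (use Nu.prems in \<open>auto simp: up_pren_def split: nat.splits\<close>)
  then show ?case by simp
next
  case (Imp A B)
  show ?case using Imp.IH[OF Imp.prems] by auto
next
  case (And A B)
  show ?case using And.IH[OF And.prems] by auto
next
  case (Or A B)
  show ?case using Or.IH[OF Or.prems] by auto
qed auto

lemma occ_pwk [simp]:
  "\<not> occ s 0 \<delta>s (pwk \<delta>s Q)"
  "occ s (Suc i) \<delta>s (pwk \<delta>s Q) = occ s i \<delta>s Q"
  "\<gamma>s \<noteq> \<delta>s \<Longrightarrow> occ s i \<delta>s (pwk \<gamma>s Q) = occ s i \<delta>s Q"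
  unfolding pwk_def
  by (subst occ_pren_fm[where k = 0 and b = False]; auto)
     (subst occ_pren_fm[where k = i and b = True]; auto)+

text \<open>The invariant that carries the assumption of \<open>occ_psub_fm\<close> below a fixed
  point: i and k both move exactly if the bound predicate has type \<delta>s.\<close>

lemma occ_pup:
  assumes "\<And>s j \<epsilon>s. occ s i \<delta>s (\<rho> j \<epsilon>s) \<longleftrightarrow> s = Pos \<and> j = k \<and> \<epsilon>s = \<delta>s"
  shows "occ s (if \<gamma>s = \<delta>s then Suc i else i) \<delta>s (pup \<gamma>s \<rho> j \<epsilon>s)
    \<longleftrightarrow> s = Pos \<and> j = (if \<gamma>s = \<delta>s then Suc k else k) \<and> \<epsilon>s = \<delta>s"
  using assms by (cases "\<gamma>s = \<delta>s"; cases j) (auto simp: pup_def pscons_def pshift_def)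

text \<open>The variable enters the result only through the formula substituted for k, and only
  positively there, so each occurrence keeps its polarity. The assumption ranges over all s because
  implication flips s in the induction.\<close>

lemma occ_psub_fm:
  assumes "\<And>s j \<epsilon>s. occ s i \<delta>s (\<rho> j \<epsilon>s) \<longleftrightarrow> s = Pos \<and> j = k \<and> \<epsilon>s = \<delta>s"
  shows "occ s i \<delta>s (psub_fm \<rho> Q) = occ s k \<delta>s Q"
  using assms
proof (induction Q arbitrary: s i k \<rho>)
  case (Mu \<gamma>s B ts)
  from Mu.IH[OF occ_pup[OF Mu.prems]] show ?case by simp
next
  case (Nu \<gamma>s B ts)
  from Nu.IH[OF occ_pup[OF Nu.prems]] show ?case by simp
qed (simp_all add: pshift_def, blast?)

text \<open>The formula put in place of the bound predicate is free of p, so what remains are the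
  occurrences of p in Q, with its index lowered if the two types coincide. This transfers
  monotonicity to the recursive call of \<open>functoriality\<close> at a fixed point.\<close>

lemma occ_papp_pwk:
  "occ s 0 \<delta>s (papp \<gamma>s Q (pwk \<delta>s M)) = occ s (if \<gamma>s = \<delta>s then Suc 0 else 0) \<delta>s Q"
  unfolding papp_def
  by (rule occ_psub_fm) (auto simp: pinst_def pscons_def split: nat.splits)

text \<open>A lifted substitution inserts only formulas weakened past the bound predicate, so it
  cannot spoil the positivity that well-formed fixed points require.\<close>

lemma occ_psub_pup [simp]: "occ s 0 \<gamma>s (psub_fm (pup \<gamma>s \<rho>) Q) = occ s 0 \<gamma>s Q"
  by (rule occ_psub_fm) (auto simp: pup_def pscons_def split: nat.splits)

lemma occurs_simps:
  "occurs i \<delta>s (Imp A B) \<longleftrightarrow> occurs i \<delta>s A \<or> occurs i \<delta>s B"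
  "occurs i \<delta>s (And A B) \<longleftrightarrow> occurs i \<delta>s A \<or> occurs i \<delta>s B"
  "occurs i \<delta>s (Or A B) \<longleftrightarrow> occurs i \<delta>s A \<or> occurs i \<delta>s B"
  "occurs i \<delta>s (All \<gamma> A) \<longleftrightarrow> occurs i \<delta>s A"
  "occurs i \<delta>s (Ex \<gamma> A) \<longleftrightarrow> occurs i \<delta>s A"
  "occurs i \<delta>s (Mu \<gamma>s A ts) \<longleftrightarrow> occurs (if \<gamma>s = \<delta>s then Suc i else i) \<delta>s A"
  "occurs i \<delta>s (Nu \<gamma>s A ts) \<longleftrightarrow> occurs (if \<gamma>s = \<delta>s then Suc i else i) \<delta>s A"
  "occurs i \<delta>s (PVar j \<gamma>s ts) \<longleftrightarrow> j = i \<and> \<gamma>s = \<delta>s"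
  by (auto simp: occurs_def)

lemma pup_cong:
  assumes "\<And>i \<delta>s. occurs (if \<gamma>s = \<delta>s then Suc i else i) \<delta>s B \<Longrightarrow> \<rho> i \<delta>s = \<rho>' i \<delta>s"
    and "occurs i \<delta>s B"
  shows "pup \<gamma>s \<rho> i \<delta>s = pup \<gamma>s \<rho>' i \<delta>s"
proof (cases "\<delta>s = \<gamma>s")
  case True
  then show ?thesis using assms
    by (cases i) (auto simp: pup_def pscons_def pshift_def)
next
  case False
  then show ?thesis using assms by (auto simp: pup_def pscons_def pshift_def)
qed

lemma psub_fm_cong:
  assumes "\<And>i \<delta>s. occurs i \<delta>s A \<Longrightarrow> \<rho> i \<delta>s = \<rho>' i \<delta>s"
  shows "psub_fm \<rho> A = psub_fm \<rho>' A"
  using assms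
proof (induction A arbitrary: \<rho> \<rho>')
  case (Mu \<gamma>s B ts)
  have "psub_fm (pup \<gamma>s \<rho>) B = psub_fm (pup \<gamma>s \<rho>') B"
    by (rule Mu.IH, rule pup_cong[where B = B]) (simp_all add: Mu.prems occurs_simps)
  then show ?case by simp
next
  case (Nu \<gamma>s B ts)
  have "psub_fm (pup \<gamma>s \<rho>) B = psub_fm (pup \<gamma>s \<rho>') B"
    by (rule Nu.IH, rule pup_cong[where B = B]) (simp_all add: Nu.prems occurs_simps)
  then show ?case by simp
next
  case (Imp A B)
  have "psub_fm \<rho> A = psub_fm \<rho>' A" "psub_fm \<rho> B = psub_fm \<rho>' B"
    by (rule Imp.IH, simp add: Imp.prems occurs_simps)+
  then show ?case by simp
next
  case (And A B)
  have "psub_fm \<rho> A = psub_fm \<rho>' A" "psub_fm \<rho> B = psub_fm \<rho>' B"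
    by (rule And.IH, simp add: And.prems occurs_simps)+
  then show ?case by simp
next
  case (Or A B)
  have "psub_fm \<rho> A = psub_fm \<rho>' A" "psub_fm \<rho> B = psub_fm \<rho>' B"
    by (rule Or.IH, simp add: Or.prems occurs_simps)+
  then show ?case by simp
next
  case (All \<gamma> A)
  have "psub_fm (pshift [\<gamma>] \<rho>) A = psub_fm (pshift [\<gamma>] \<rho>') A"
    by (rule All.IH) (simp add: All.prems occurs_simps pshift_def)
  then show ?case by simp
next
  case (Ex \<gamma> A)
  have "psub_fm (pshift [\<gamma>] \<rho>) A = psub_fm (pshift [\<gamma>] \<rho>') A"
    by (rule Ex.IH) (simp add: Ex.prems occurs_simps pshift_def)
  then show ?case by simp
qed (simp_all add: occurs_simps)

text \<open>This is why the identity proof has the required type in the branch of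
  \<open>functoriality\<close> where p does not occur.\<close>

lemma papp_not_occurs: "\<not> occurs 0 \<gamma>s Q \<Longrightarrow> papp \<gamma>s Q S = papp \<gamma>s Q S'"
  unfolding papp_def
  by (rule psub_fm_cong) (auto simp: pinst_def pscons_def split: nat.splits)

lemma pinst_simps [simp]:
  "pinst \<gamma>s S 0 \<gamma>s = S"
  "pinst \<gamma>s S (Suc i) \<gamma>s = PVar i \<gamma>s (vars \<gamma>s)"
  "\<delta>s \<noteq> \<gamma>s \<Longrightarrow> pinst \<gamma>s S i \<delta>s = PVar i \<delta>s (vars \<delta>s)"
  by (auto simp: pinst_def pscons_def)

lemma pup_id: "pup \<gamma>s (\<lambda>i \<delta>s. PVar i \<delta>s (vars \<delta>s)) = (\<lambda>i \<delta>s. PVar i \<delta>s (vars \<delta>s))"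
  by (intro ext) (auto simp: pup_def pscons_def pshift_def pwk_def split: nat.splits)

lemma papp_simps [simp]:
  "papp \<gamma>s Top S = Top"
  "papp \<gamma>s Bot S = Bot"
  "papp \<gamma>s (Imp A B) S = Imp (papp \<gamma>s A S) (papp \<gamma>s B S)"
  "papp \<gamma>s (And A B) S = And (papp \<gamma>s A S) (papp \<gamma>s B S)"
  "papp \<gamma>s (Or A B) S = Or (papp \<gamma>s A S) (papp \<gamma>s B S)"
  "papp \<gamma>s (All \<gamma> A) S = All \<gamma> (papp \<gamma>s A (wk_under \<gamma>s [\<gamma>] S))"
  "papp \<gamma>s (Ex \<gamma> A) S = Ex \<gamma> (papp \<gamma>s A (wk_under \<gamma>s [\<gamma>] S))"
  by (simp_all add: papp_def pshift_eq)

text \<open>The formula \<open>\<rho> i \<delta>s\<close> lives below its argument variables, so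
  \<rho>' has to be weakened by \<delta>s before it is applied there.\<close>

definition pcomp :: "('b, 'c, 'a) psub \<Rightarrow> ('b, 'c, 'a) psub \<Rightarrow> ('b, 'c, 'a) psub" where
  "pcomp \<rho> \<rho>' i \<delta>s = psub_fm (pshift \<delta>s \<rho>') (\<rho> i \<delta>s)"

section \<open>Preservation of well-typedness and well-formedness\<close>

context signature
begin

lemma wt_unique: "wt t \<tau> \<Longrightarrow> wt t \<tau>' \<Longrightarrow> \<tau> = \<tau>'"
  by (induction t arbitrary: \<tau> \<tau>') fastforce+

lemma wt_ren_tm [simp]: "wt (ren_tm r t) \<tau> = wt t \<tau>"
  by (induction t arbitrary: \<tau> r) auto

lemma wt_sub_scons: "wt t \<gamma> \<Longrightarrow> wt_sub \<theta> \<Longrightarrow> wt_sub (scons \<gamma> t \<theta>)"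
  by (auto simp: wt_sub_def scons_def split: nat.splits)

lemma wt_sub_up [simp]: "wt_sub \<theta> \<Longrightarrow> wt_sub (up \<gamma> \<theta>)"
  unfolding up_def by (rule wt_sub_scons) (auto simp: wt_sub_def)

lemma wt_sub_ups [simp]: "wt_sub \<theta> \<Longrightarrow> wt_sub (ups \<gamma>s \<theta>)"
  by (induction \<gamma>s arbitrary: \<theta>) (auto simp: ups_def wt_sub_up)

text \<open>The direction from right to left is the usual preservation; the converse rests on
  uniqueness of types and makes the statement a rewrite rule.\<close>

lemma wt_sub_tm [simp]: "wt_sub \<theta> \<Longrightarrow> wt (sub_tm \<theta> t) \<tau> = wt t \<tau>"
proof (induction t arbitrary: \<theta> \<tau>)
  case (Var i \<gamma>)
  then show ?case using wt_unique by (auto simp: wt_sub_def)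
qed (auto simp: wt_sub_up)

lemma wt_sub_Var [simp]: "wt_sub Var"
  by (simp add: wt_sub_def)

lemma wt_sub_shifts [simp]: "wt_sub (shifts \<gamma>s)"
  by (simp add: wt_sub_def shifts_def)

lemma wt_sub_tcomp [simp]: "wt_sub \<theta> \<Longrightarrow> wt_sub \<theta>' \<Longrightarrow> wt_sub (tcomp \<theta> \<theta>')"
  by (simp add: wt_sub_def[of \<theta>] wt_sub_def[of "tcomp \<theta> \<theta>'"] tcomp_def)

lemma wt_sub_sconss: "list_all2 wt ts \<gamma>s \<Longrightarrow> wt_sub \<theta> \<Longrightarrow> wt_sub (sconss \<gamma>s ts \<theta>)"
  by (induction ts \<gamma>s arbitrary: \<theta> rule: list_all2_induct) (auto simp: wt_sub_scons)

lemma wt_sub_insts [simp]: "list_all2 wt ts \<gamma>s \<Longrightarrow> wt_sub (insts \<gamma>s ts)"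
  by (simp add: insts_eq wt_sub_sconss)

lemma wt_vars [simp]: "list_all2 wt (vars \<gamma>s) \<gamma>s"
  by (induction \<gamma>s) auto

lemma wt_map_sub_tm [simp]:
  "wt_sub \<theta> \<Longrightarrow> list_all2 wt (map (sub_tm \<theta>) ts) \<gamma>s = list_all2 wt ts \<gamma>s"
  by (simp add: list_all2_conv_all_nth)

lemma wff_sub_fm [simp]: "wt_sub \<theta> \<Longrightarrow> wff (sub_fm \<theta> A) = wff A"
  by (induction A arbitrary: \<theta>) (auto simp: wt_sub_up)

lemma wff_pren_fm [simp]: "wff (pren_fm r A) = wff A"
proof (induction A arbitrary: r)
  case (Mu \<gamma>s B ts)
  have "occ Neg 0 \<gamma>s (pren_fm (up_pren \<gamma>s r) B) \<longleftrightarrow> True \<and> occ Neg 0 \<gamma>s B"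
    by (rule occ_pren_fm) (auto simp: up_pren_def split: nat.splits)
  with Mu show ?case by simp
next
  case (Nu \<gamma>s B ts)
  have "occ Neg 0 \<gamma>s (pren_fm (up_pren \<gamma>s r) B) \<longleftrightarrow> True \<and> occ Neg 0 \<gamma>s B"
    by (rule occ_pren_fm) (auto simp: up_pren_def split: nat.splits)
  with Nu show ?case by simp
qed auto

lemma wff_pwk [simp]: "wff (pwk \<gamma>s A) = wff A"
  by (simp add: pwk_def)

lemma wff_psub_pshift [simp]: "wff_psub \<rho> \<Longrightarrow> wff_psub (pshift \<gamma>s \<rho>)"
  by (simp add: wff_psub_def pshift_def)

lemma wff_psub_pscons: "wff S \<Longrightarrow> wff_psub \<rho> \<Longrightarrow> wff_psub (pscons \<gamma>s S \<rho>)"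
  by (auto simp: wff_psub_def pscons_def split: nat.splits)

lemma wff_psub_pup [simp]: "wff_psub \<rho> \<Longrightarrow> wff_psub (pup \<gamma>s \<rho>)"
  unfolding pup_def
  by (rule wff_psub_pscons) (simp, simp add: wff_psub_def pshift_def)

lemma wff_psub_pinst [simp]: "wff S \<Longrightarrow> wff_psub (pinst \<gamma>s S)"
  unfolding pinst_def by (rule wff_psub_pscons) (simp_all add: wff_psub_def)

lemma wff_psub_fm [simp]: "wff A \<Longrightarrow> wff_psub \<rho> \<Longrightarrow> wff (psub_fm \<rho> A)"
proof (induction A arbitrary: \<rho>)
  case (PVar i \<gamma>s ts)
  then show ?case by (simp add: wff_psub_def)
qed auto

lemma wff_papp [simp]: "wff A \<Longrightarrow> wff S \<Longrightarrow> wff (papp \<gamma>s A S)"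
  by (simp add: papp_def)

section \<open>Commutation and composition of substitutions in formulas\<close>

text \<open>Well-formedness supplies the length of argument lists: \<open>insts\<close> zips types
  with arguments, and with missing arguments instantiation would not commute with \<theta>.\<close>

lemma sub_psub_fm:
  "wff A \<Longrightarrow> sub_fm \<theta> (psub_fm \<rho> A) = psub_fm (psub_shift \<theta> \<rho>) (sub_fm \<theta> A)"
proof (induction A arbitrary: \<theta> \<rho>)
  case (PVar i \<gamma>s ts)
  then show ?case by (simp add: psub_shift_def tcomp_ups_insts list_all2_lengthD)
qed (auto simp: up_eq_ups psub_shift_pshift psub_shift_pup)

lemma psub_fm_id: "wff A \<Longrightarrow> psub_fm (\<lambda>i \<delta>s. PVar i \<delta>s (vars \<delta>s)) A = A"
proof (induction A)
  case (PVar i \<gamma>s ts)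
  then show ?case by (simp add: list_all2_lengthD)
qed (auto simp: pshift_def[abs_def] pup_id)

text \<open>A formula in the image of \<open>pwk\<close> never looks up index 0 of type \<gamma>s,
  and for all other variables the weakening cancels the lowering of the index in
  \<open>pinst\<close>.\<close>

lemma psub_pinst_pwk: "wff A \<Longrightarrow> psub_fm (pinst \<gamma>s S) (pwk \<gamma>s A) = A"
proof -
  assume "wff A"
  have "psub_fm (pinst \<gamma>s S) (pwk \<gamma>s A) = psub_fm (\<lambda>i \<delta>s. PVar i \<delta>s (vars \<delta>s)) A"
    unfolding pwk_def psub_pren_fm
    by (rule arg_cong[where f = "\<lambda>\<rho>. psub_fm \<rho> A"]) (auto simp: fun_eq_iff)
  then show ?thesis by (simp add: psub_fm_id \<open>wff A\<close>)
qed

lemma pshift_pcomp: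
  "wff_psub \<rho> \<Longrightarrow> pshift \<gamma>s (pcomp \<rho> \<rho>') = pcomp (pshift \<gamma>s \<rho>) (pshift \<gamma>s \<rho>')"
  by (intro ext) (simp add: pcomp_def pshift_eq psub_shift_def[of _ "pcomp \<rho> \<rho>'"] wff_psub_def sub_psub_fm
    tcomp_shifts_ups psub_shift_def[of _ \<rho>])

lemma pup_pcomp:
  assumes "wff_psub \<rho>"
  shows "pup \<gamma>s (pcomp \<rho> \<rho>') = pcomp (pup \<gamma>s \<rho>) (pup \<gamma>s \<rho>')"
proof (intro ext)
  fix i \<delta>s
  \<comment> \<open>A formula weakened past the bound predicate never reaches the entry that
    \<open>pup\<close> adds, so the lift acts on it like \<rho>' itself and the weakening moves
    outwards.\<close>
  have *: "psub_fm (pshift \<delta>s (pup \<gamma>s \<rho>')) (pwk \<gamma>s A) = pwk \<gamma>s (psub_fm (pshift \<delta>s (pshift \<gamma>s \<rho>')) A)"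
    for A :: "('b, 'c, 'a) fm" and \<delta>s
    unfolding pwk_def pren_psub_fm psub_pren_fm
    by (rule arg_cong[where f = "\<lambda>\<rho>. psub_fm \<rho> A"])
      (auto simp: fun_eq_iff pup_def pscons_def pwk_def pshift_def sub_pren_fm)
  have **: "pwk \<gamma>s (pshift \<gamma>s (pcomp \<rho> \<rho>') j \<delta>s) = psub_fm (pshift \<delta>s (pup \<gamma>s \<rho>')) (pwk \<gamma>s (pshift \<gamma>s \<rho> j \<delta>s))" for j
    by (simp add: * pshift_pcomp[OF assms]) (simp add: pcomp_def)
  have z: "pshift \<delta>s (pup \<gamma>s \<rho>') 0 \<gamma>s = PVar 0 \<gamma>s (vars \<gamma>s)"
    by (simp add: pshift_def pup_def pscons_def)
  show "pup \<gamma>s (pcomp \<rho> \<rho>') i \<delta>s = pcomp (pup \<gamma>s \<rho>) (pup \<gamma>s \<rho>') i \<delta>s"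
    unfolding pcomp_def[of "pup \<gamma>s \<rho>"]
    unfolding pup_def[of _ "pcomp \<rho> \<rho>'"] pup_def[of _ \<rho>]
    using ** z by (auto simp: pscons_def split: nat.splits)
qed

lemma psub_psub_fm:
  "wff A \<Longrightarrow> wff_psub \<rho> \<Longrightarrow> psub_fm \<rho>' (psub_fm \<rho> A) = psub_fm (pcomp \<rho> \<rho>') A"
proof (induction A arbitrary: \<rho> \<rho>')
  case (PVar i \<gamma>s ts)
  then have l: "length ts = length \<gamma>s" by (simp add: list_all2_lengthD)
  \<comment> \<open>\<open>pcomp\<close> weakens \<rho>' past the argument variables; instantiating
    these with \<open>ts\<close> cancels the weakening.\<close>
  with PVar show ?case
    by (simp add: wff_psub_def pcomp_def sub_psub_fm pshift_eq)
qed (auto simp: pshift_pcomp pup_pcomp)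

section \<open>Substitution in unfoldings of fixed points\<close>

lemma sub_papp:
  "wff Q \<Longrightarrow> sub_fm \<theta> (papp \<gamma>s Q S) = papp \<gamma>s (sub_fm \<theta> Q) (sub_fm (ups \<gamma>s \<theta>) S)"
  by (simp add: papp_def sub_psub_fm)

lemma sub_unfold:
  assumes "wff B" "list_all2 wt ts \<gamma>s"
  shows "sub_fm \<theta> (unfold \<gamma>s B S ts)
    = unfold \<gamma>s (sub_fm (ups \<gamma>s \<theta>) B) (sub_fm (ups \<gamma>s \<theta>) S) (map (sub_tm \<theta>) ts)"
  using assms by (simp add: unfold_def sub_papp tcomp_ups_insts list_all2_lengthD)

lemma sub_mu_pred: "sub_fm (ups \<gamma>s \<theta>) (mu_pred \<gamma>s B) = mu_pred \<gamma>s (sub_fm (ups \<gamma>s \<theta>) B)"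
  by (simp add: mu_pred_def tcomp_shifts_ups)

lemma sub_nu_pred: "sub_fm (ups \<gamma>s \<theta>) (nu_pred \<gamma>s B) = nu_pred \<gamma>s (sub_fm (ups \<gamma>s \<theta>) B)"
  by (simp add: nu_pred_def tcomp_shifts_ups)

lemma sub_unfold_vars:
  "wff B \<Longrightarrow> sub_fm (ups \<gamma>s \<theta>) (unfold_vars \<gamma>s B S)
    = unfold_vars \<gamma>s (sub_fm (ups \<gamma>s \<theta>) B) (sub_fm (ups \<gamma>s \<theta>) S)"
  by (simp add: unfold_vars_def sub_papp tcomp_shifts_ups)

text \<open>Links the open unfolding in the premise of a fixed point rule to the closed one that
  appears when contraction instantiates that premise.\<close>

lemma insts_unfold_vars:
  assumes "wff B" "list_all2 wt ts \<gamma>s"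
  shows "sub_fm (insts \<gamma>s ts) (unfold_vars \<gamma>s B S) = unfold \<gamma>s B S ts"
  using assms by (simp add: unfold_vars_def unfold_def sub_papp list_all2_lengthD)

lemma insts_mu_pred:
  "length ts = length \<gamma>s \<Longrightarrow> sub_fm (insts \<gamma>s ts) (mu_pred \<gamma>s B) = Mu \<gamma>s B ts"
  by (simp add: mu_pred_def)

lemma insts_nu_pred:
  "length ts = length \<gamma>s \<Longrightarrow> sub_fm (insts \<gamma>s ts) (nu_pred \<gamma>s B) = Nu \<gamma>s B ts"
  by (simp add: nu_pred_def)

lemma unfold_wk_vars: "unfold \<gamma>s (wk_under \<gamma>s \<gamma>s B) S (vars \<gamma>s) = papp \<gamma>s B S"
  by (simp add: unfold_def)

lemma wff_mu_pred [simp]: "wff B \<Longrightarrow> \<not> occ Neg 0 \<gamma>s B \<Longrightarrow> wff (mu_pred \<gamma>s B)"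
  by (simp add: mu_pred_def)

lemma wff_nu_pred [simp]: "wff B \<Longrightarrow> \<not> occ Neg 0 \<gamma>s B \<Longrightarrow> wff (nu_pred \<gamma>s B)"
  by (simp add: nu_pred_def)

text \<open>Functoriality replaces the variable bound by the fixed point before \<open>p\<close>, the typing rules
  replace \<open>p\<close> first.\<close>

lemma papp_papp_pwk:
  assumes "wff R" "wff M" "wff P"
  shows "papp \<delta>s (papp \<gamma>s R (pwk \<delta>s M)) (wk_under \<delta>s \<gamma>s P)
    = papp \<gamma>s (psub_fm (pup \<gamma>s (pinst \<delta>s P)) R) M"
proof -
  \<comment> \<open>Both sides apply two substitutions to R, so their composites are compared
    variable by variable. The fixed point variable yields M on both sides: on the left, substituting
    for p cancels \<open>pwk \<delta>s\<close>. Every other variable is sent to its value under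
    \<open>pinst \<delta>s (wk_under \<delta>s \<gamma>s P)\<close>, its index being lowered first
    if it has type \<gamma>s.\<close>
  have "pcomp (pinst \<gamma>s (pwk \<delta>s M)) (pinst \<delta>s (wk_under \<delta>s \<gamma>s P))
      = pcomp (pup \<gamma>s (pinst \<delta>s P)) (pinst \<gamma>s M)" (is "?l = ?r")
  proof (intro ext)
    fix i \<epsilon>s
    have pw: "pshift \<gamma>s (pinst \<delta>s P) = pinst \<delta>s (wk_under \<delta>s \<gamma>s P)"
      by (simp add: pshift_eq)
    show "?l i \<epsilon>s = ?r i \<epsilon>s"
    proof (cases "\<epsilon>s = \<gamma>s")
      case True
      show ?thesis
      proof (cases i)
        case 0
        have "?r i \<epsilon>s = M" unfolding 0 True
          by (simp add: pcomp_def pup_def pscons_def pshift_eq)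
        moreover have "?l i \<epsilon>s = M" unfolding 0 True
          by (simp add: pcomp_def pshift_eq psub_pinst_pwk assms sub_pwk)
        ultimately show ?thesis by simp
      next
        case (Suc j)
        have "?r i \<epsilon>s = pinst \<delta>s (wk_under \<delta>s \<gamma>s P) j \<gamma>s" unfolding Suc True using assms
          by (cases "\<gamma>s = \<delta>s"; cases j)
             (simp_all add: pcomp_def pup_def pscons_def pw pshift_eq psub_pinst_pwk)
        moreover have "?l i \<epsilon>s = pinst \<delta>s (wk_under \<delta>s \<gamma>s P) j \<gamma>s" unfolding Suc True
          by (cases "\<gamma>s = \<delta>s"; cases j) (simp_all add: pcomp_def pshift_eq)
        ultimately show ?thesis by simp
      qed
    next
      case False
      have "?r i \<epsilon>s = pinst \<delta>s (wk_under \<delta>s \<gamma>s P) i \<epsilon>s" using assms False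
        by (cases "\<epsilon>s = \<delta>s"; cases i)
           (simp_all add: pcomp_def pup_def pscons_def pw pshift_eq psub_pinst_pwk)
      moreover have "?l i \<epsilon>s = pinst \<delta>s (wk_under \<delta>s \<gamma>s P) i \<epsilon>s" using False
        by (cases "\<epsilon>s = \<delta>s"; cases i) (simp_all add: pcomp_def pshift_eq)
      ultimately show ?thesis by simp
    qed
  qed
  with assms show ?thesis by (simp add: papp_def psub_psub_fm)
qed

end

text \<open>\<open>source s P P'\<close> and \<open>source s P' P\<close> are the arguments of \<open>\<lambda>p. Q\<close> in the domain and in the
  codomain of the functoriality map of polarity \<open>s\<close>.\<close>

definition source :: "polarity \<Rightarrow> 'x \<Rightarrow> 'x \<Rightarrow> 'x" where
  "source s x y = (case s of Pos \<Rightarrow> x | Neg \<Rightarrow> y)"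

lemma source_app: "source s (f x) (f y) = f (source s x y)"
  by (simp add: source_def split: polarity.split)

lemma source_flip [simp]: "source (flip s) x y = source s y x"
  by (cases s) (simp_all add: source_def)

lemma flip_flip [simp]: "flip (flip s) = s"
  by (cases s) simp_all


section \<open>Typing and substitution\<close>

context congruence
begin

section \<open>Pointwise congruent substitutions\<close>

lemma eqt_refl: "wt t \<tau> \<Longrightarrow> eqt t t"
  by (rule eqt_beta_eta[OF be_refl])

lemma eqt_up:
  assumes "\<And>i \<gamma>. eqt (\<theta> i \<gamma>) (\<theta>' i \<gamma>)"
  shows "eqt (up \<gamma> \<theta> i \<delta>) (up \<gamma> \<theta>' i \<delta>)"
proof -
  have "eqt (Var 0 \<gamma>) (Var 0 \<gamma>)" by (rule eqt_refl[of _ \<gamma>]) simp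
  with assms show ?thesis
    by (auto simp: up_eq scons_def tcomp_def split: nat.splits intro: eqt_sub)
qed

lemma eqt_ups:
  "(\<And>i \<gamma>. eqt (\<theta> i \<gamma>) (\<theta>' i \<gamma>)) \<Longrightarrow> eqt (ups \<gamma>s \<theta> i \<delta>) (ups \<gamma>s \<theta>' i \<delta>)"
proof (induction \<gamma>s arbitrary: \<theta> \<theta>')
  case (Cons \<gamma> \<gamma>s)
  then show ?case using eqt_up[of \<theta> \<theta>'] by (simp add: ups_def)
qed (simp add: ups_def)

lemma eqt_sub_cong:
  "wt t \<tau> \<Longrightarrow> wt_sub \<theta> \<Longrightarrow> (\<And>i \<gamma>. eqt (\<theta> i \<gamma>) (\<theta>' i \<gamma>)) \<Longrightarrow> eqt (sub_tm \<theta> t) (sub_tm \<theta>' t)"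
proof (induction t arbitrary: \<tau> \<theta> \<theta>')
  case (Cst c)
  then show ?case by (auto intro: eqt_refl)
next
  case (App t u)
  then show ?case by (auto intro!: eqt_App)
next
  case (Lam \<gamma> t)
  then show ?case by (auto intro!: eqt_Lam simp: wt_sub_up eqt_up)
qed simp

lemma eqt_map_sub_cong:
  "list_all2 wt ts \<gamma>s \<Longrightarrow> wt_sub \<theta> \<Longrightarrow> (\<And>i \<gamma>. eqt (\<theta> i \<gamma>) (\<theta>' i \<gamma>)) \<Longrightarrow>
    list_all2 eqt (map (sub_tm \<theta>) ts) (map (sub_tm \<theta>') ts)"
  by (induction ts \<gamma>s rule: list_all2_induct) (auto intro: eqt_sub_cong)

text \<open>Serves two purposes: factoring \<theta> through a branch in an equality redex, and
  replacing an argument list by a congruent one in a fixed point redex.\<close>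

lemma eqf_sub_cong:
  "wff A \<Longrightarrow> wt_sub \<theta> \<Longrightarrow> wt_sub \<theta>' \<Longrightarrow> (\<And>i \<gamma>. eqt (\<theta> i \<gamma>) (\<theta>' i \<gamma>)) \<Longrightarrow>
    eqf (sub_fm \<theta> A) (sub_fm \<theta>' A)"
proof (induction A arbitrary: \<theta> \<theta>')
  case (Eq t u)
  then obtain \<tau> where "wt t \<tau>" "wt u \<tau>" by auto
  with Eq show ?case by (auto intro!: eqf_Eq intro: eqt_sub_cong)
next
  case (Mu \<gamma>s B ts)
  then show ?case by (auto intro!: eqf_Mu intro: eqt_map_sub_cong simp: eqt_ups)
next
  case (Nu \<gamma>s B ts)
  then show ?case by (auto intro!: eqf_Nu intro: eqt_map_sub_cong simp: eqt_ups)
next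
  case (PVar i \<gamma>s ts)
  then show ?case by (auto intro!: eqf_PVar intro: eqt_map_sub_cong)
next
  case (Atom a ts)
  then show ?case by (auto intro!: eqf_Atom intro: eqt_map_sub_cong)
qed (auto intro: eqf_refl eqf_Imp eqf_And eqf_Or eqf_All eqf_Ex simp: wt_sub_up eqt_up)

lemma eqt_sconss:
  "list_all2 eqt ts ts' \<Longrightarrow> (\<And>i \<gamma>. eqt (\<theta> i \<gamma>) (\<theta>' i \<gamma>)) \<Longrightarrow>
    length \<gamma>s = length ts \<Longrightarrow> eqt (sconss \<gamma>s ts \<theta> i \<delta>) (sconss \<gamma>s ts' \<theta>' i \<delta>)"
proof (induction ts ts' arbitrary: \<gamma>s \<theta> \<theta>' rule: list_all2_induct)
  case (Cons t ts t' ts')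
  then obtain \<gamma> \<gamma>s' where \<gamma>s: "\<gamma>s = \<gamma> # \<gamma>s'" by (cases \<gamma>s) auto
  have "eqt (scons \<gamma> t \<theta> i \<gamma>') (scons \<gamma> t' \<theta>' i \<gamma>')" for i \<gamma>'
    using Cons by (auto simp: scons_def split: nat.splits)
  then show ?case using Cons \<gamma>s by simp
qed simp

lemma eqt_insts:
  "list_all2 eqt ts ts' \<Longrightarrow> length \<gamma>s = length ts \<Longrightarrow> eqt (insts \<gamma>s ts i \<delta>) (insts \<gamma>s ts' i \<delta>)"
  unfolding insts_eq by (rule eqt_sconss) (auto intro: eqt_refl)

section \<open>Conversion of the type\<close>

lemma typing_wff: "typing \<Gamma> \<pi> P \<Longrightarrow> wff P"
  by (induction rule: typing.induct) (auto dest: eqf_wf)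

text \<open>Most rules end in a congruence premise, which absorbs the change by transitivity.
  \<open>BotE\<close> only asks for a well-formed conclusion, and the remaining rules pass the
  conclusion to a premise, where the induction hypothesis applies.\<close>

lemma typing_conv: "typing \<Gamma> \<pi> P \<Longrightarrow> eqf P P' \<Longrightarrow> typing \<Gamma> \<pi> P'"
proof (induction arbitrary: P' rule: typing.induct)
  case (ty_BotE \<Gamma> \<pi> P)
  then show ?case by (auto intro: typing.ty_BotE dest: eqf_wf)
next
  case (ty_AppP \<Gamma> \<pi> Q P \<pi>')
  \<comment> \<open>The conversion is pushed into the codomain of the function; its domain stays Q,
    so the argument keeps its type.\<close>
  then have "eqf (Imp Q P) (Imp Q P')"
    by (auto intro!: eqf_Imp eqf_refl dest: typing_wff)
  with ty_AppP show ?case by (auto intro: typing.ty_AppP)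
next
  case (ty_CaseEx \<Gamma> \<pi> \<gamma> Q \<pi>' P)
  then have "eqf (wk [\<gamma>] P) (wk [\<gamma>] P')" by (auto intro: eqf_sub)
  with ty_CaseEx show ?case by (auto intro: typing.ty_CaseEx)
next
  case (ty_CaseEq \<theta> \<Gamma> u v Q \<Gamma>' \<pi> \<sigma> bs P)
  show ?case
    by (rule typing.ty_CaseEq[OF ty_CaseEq.hyps(1-6) _ ty_CaseEq.hyps(7)])
       (use ty_CaseEq in \<open>auto intro: eqf_trans eqf_sym\<close>)
qed (blast intro: typing.intros eqf_sym eqf_trans)+

section \<open>Renaming of hypotheses\<close>

text \<open>A hypothesis may be sent to a merely congruent one, so that \<open>typing_ren\<close>
  also gives conversion inside the context. \<open>typing_wk_step\<close> relies on this.\<close>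

definition ren_ok :: "(nat \<Rightarrow> nat) \<Rightarrow> ('b, 'c, 'a) fm list \<Rightarrow> ('b, 'c, 'a) fm list \<Rightarrow> bool" where
  "ren_ok r \<Gamma> \<Gamma>' \<longleftrightarrow>
    (\<forall>n<length \<Gamma>. wff (\<Gamma> ! n) \<longrightarrow> r n < length \<Gamma>' \<and> eqf (\<Gamma> ! n) (\<Gamma>' ! r n))"

lemma ren_ok_up:
  assumes "wff A \<Longrightarrow> eqf A A'" "ren_ok r \<Gamma> \<Gamma>'"
  shows "ren_ok (up_hren r) (A # \<Gamma>) (A' # \<Gamma>')"
  using assms by (auto simp: ren_ok_def up_hren_def less_Suc_eq_0_disj)

lemma ren_ok_map: "ren_ok r \<Gamma> \<Gamma>' \<Longrightarrow> wt_sub \<theta> \<Longrightarrow> ren_ok r (map (sub_fm \<theta>) \<Gamma>) (map (sub_fm \<theta>) \<Gamma>')"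
  by (auto simp: ren_ok_def eqf_sub)

lemma ren_ok_up_same: "ren_ok r \<Gamma> \<Gamma>' \<Longrightarrow> ren_ok (up_hren r) (A # \<Gamma>) (A # \<Gamma>')"
  by (simp add: ren_ok_up eqf_refl)

lemma ren_ok_wk: "ren_ok r \<Gamma> \<Gamma>' \<Longrightarrow> ren_ok r (map (wk \<gamma>s) \<Gamma>) (map (wk \<gamma>s) \<Gamma>')"
  by (simp add: ren_ok_map)

lemma ren_ok_append: "ren_ok (\<lambda>n. n + length \<Delta>) \<Gamma> (\<Delta> @ \<Gamma>)"
  by (auto simp: ren_ok_def eqf_refl nth_append)

lemma typing_ren: "typing \<Gamma> \<pi> P \<Longrightarrow> ren_ok r \<Gamma> \<Gamma>' \<Longrightarrow> typing \<Gamma>' (ren_pf r \<pi>) P"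
proof (induction arbitrary: r \<Gamma>' rule: typing.induct)
  case (ty_Hyp n \<Gamma> P)
  then show ?case by (auto simp: ren_ok_def intro!: typing.ty_Hyp dest: eqf_wf intro: eqf_trans)
next
  case (ty_CaseEq \<theta> \<Gamma> u v Q \<Gamma>' \<pi> \<sigma> bs P r \<Gamma>'')
  then show ?case by (auto intro!: typing.ty_CaseEq)
next
  case (ty_CaseOr \<Gamma> \<pi> P1 P2 \<pi>1 P \<pi>2)
  show ?case
    using ty_CaseOr.IH(1)[OF ty_CaseOr.prems] ty_CaseOr.IH(2,3)[OF ren_ok_up_same[OF ty_CaseOr.prems]]
    by (auto intro: typing.ty_CaseOr)
next
  case (ty_LamT \<gamma> \<Gamma> \<pi> Q P)
  show ?case
    using ty_LamT.IH[OF ren_ok_wk[OF ty_LamT.prems]] ty_LamT.hyps(2)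
    by (auto intro: typing.ty_LamT)
next
  case (ty_CaseEx \<Gamma> \<pi> \<gamma> Q \<pi>' P)
  show ?case
    using ty_CaseEx.IH(1)[OF ty_CaseEx.prems] ty_CaseEx.IH(2)[OF ren_ok_up_same[OF ren_ok_wk[OF ty_CaseEx.prems]]]
    by (auto intro: typing.ty_CaseEx)
next
  case (ty_MuE \<Gamma> \<pi> \<gamma>s B ts S \<pi>' P)
  show ?case
    using ty_MuE.IH(1)[OF ty_MuE.prems] ty_MuE.IH(2)[OF ren_ok_up_same[OF ren_ok_wk[OF ty_MuE.prems]]]
      ty_MuE.hyps(3)
    by (auto intro: typing.ty_MuE)
next
  case (ty_NuI \<Gamma> \<pi> \<gamma>s ts S \<pi>' B P)
  show ?case
    using ty_NuI.IH(1)[OF ty_NuI.prems] ty_NuI.IH(2)[OF ren_ok_up_same[OF ren_ok_wk[OF ty_NuI.prems]]]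
      ty_NuI.hyps(3)
    by (auto intro: typing.ty_NuI)
qed (auto intro!: typing.intros intro: typing.intros ren_ok_up_same)

lemma typing_hwk: "typing \<Gamma> \<pi> P \<Longrightarrow> k = length \<Delta> \<Longrightarrow> typing (\<Delta> @ \<Gamma>) (hwk k \<pi>) P"
  using typing_ren ren_ok_append by blast

section \<open>Term substitution in typings\<close>

text \<open>Each binding rule needs its own commutation law: \<open>tcomp_shifts_ups\<close> for
  weakened contexts, \<open>tcomp_ups_insts\<close> for instantiated formulas, and the laws for
  unfoldings. In the equality rule \<theta> is only composed onto the recorded substitution, so the
  branches and the complete set of unifiers stay as they are.\<close>

lemma typing_tsub:
  "typing \<Gamma> \<pi> P \<Longrightarrow> wt_sub \<theta> \<Longrightarrow> typing (map (sub_fm \<theta>) \<Gamma>) (tsub_pf \<theta> \<pi>) (sub_fm \<theta> P)"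
proof (induction arbitrary: \<theta> rule: typing.induct)
  case (ty_Hyp n \<Gamma> P)
  then show ?case by (auto intro!: typing.ty_Hyp eqf_sub)
next
  case (ty_Unit P \<Gamma>)
  then show ?case using eqf_sub[of P Top \<theta>] by (auto intro!: typing.ty_Unit)
next
  case (ty_BotE \<Gamma> \<pi> P)
  then show ?case by (auto intro!: typing.ty_BotE)
next
  case (ty_LamP P1 \<Gamma> \<pi> P2 P)
  then show ?case using eqf_sub[of P "Imp P1 P2" \<theta>] by (auto intro!: typing.ty_LamP)
next
  case (ty_AppP \<Gamma> \<pi> Q P \<pi>')
  then show ?case by (auto intro!: typing.ty_AppP)
next
  case (ty_Pair \<Gamma> \<pi>1 P1 \<pi>2 P2 P)
  then show ?case using eqf_sub[of P "And P1 P2" \<theta>] by (auto intro!: typing.ty_Pair)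
next
  case (ty_Proj \<Gamma> \<pi> P1 P2 P k)
  then show ?case using eqf_sub[of P "pick k P1 P2" \<theta>]
    by (cases k) (auto intro!: typing.ty_Proj)
next
  case (ty_In \<Gamma> \<pi> k P1 P2 P)
  then show ?case using eqf_sub[of P "Or P1 P2" \<theta>]
    by (cases k) (auto intro!: typing.ty_In)
next
  case (ty_CaseOr \<Gamma> \<pi> P1 P2 \<pi>1 P \<pi>2)
  then show ?case by (auto intro!: typing.ty_CaseOr)
next
  case (ty_LamT \<gamma> \<Gamma> \<pi> Q P)
  have "typing (map (wk [\<gamma>]) (map (sub_fm \<theta>) \<Gamma>)) (tsub_pf (up \<gamma> \<theta>) \<pi>) (sub_fm (up \<gamma> \<theta>) Q)"
    using ty_LamT.IH[of "up \<gamma> \<theta>"] ty_LamT.prems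
    by (simp add: up_eq_ups comp_def tcomp_shifts_ups)
  then show ?case using ty_LamT eqf_sub[of P "All \<gamma> Q" \<theta>] by (auto intro!: typing.ty_LamT)
next
  case (ty_AppT \<Gamma> \<pi> \<gamma> Q t P)
  have "tcomp (insts [\<gamma>] [t]) \<theta> = tcomp (up \<gamma> \<theta>) (insts [\<gamma>] [sub_tm \<theta> t])"
    using tcomp_ups_insts[of "[t]" "[\<gamma>]" \<theta>] by (simp add: up_eq_ups)
  then show ?case using ty_AppT eqf_sub[OF ty_AppT.hyps(3), of \<theta>]
    by (auto intro!: typing.ty_AppT)
next
  case (ty_Pack \<Gamma> \<pi> \<gamma> t Q P)
  have "tcomp (insts [\<gamma>] [t]) \<theta> = tcomp (up \<gamma> \<theta>) (insts [\<gamma>] [sub_tm \<theta> t])"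
    using tcomp_ups_insts[of "[t]" "[\<gamma>]" \<theta>] by (simp add: up_eq_ups)
  then show ?case using ty_Pack ty_Pack.IH[of \<theta>] eqf_sub[of P "Ex \<gamma> Q" \<theta>]
    by (auto intro!: typing.ty_Pack[where \<gamma> = \<gamma> and Q = "sub_fm (up \<gamma> \<theta>) Q"])
next
  case (ty_CaseEx \<Gamma> \<pi> \<gamma> Q \<pi>' P)
  have "typing (sub_fm (up \<gamma> \<theta>) Q # map (wk [\<gamma>]) (map (sub_fm \<theta>) \<Gamma>))
      (tsub_pf (up \<gamma> \<theta>) \<pi>') (wk [\<gamma>] (sub_fm \<theta> P))"
    using ty_CaseEx.IH(2)[of "up \<gamma> \<theta>"] ty_CaseEx.prems
    by (simp add: up_eq_ups comp_def tcomp_shifts_ups)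
  then show ?case using ty_CaseEx by (auto intro!: typing.ty_CaseEx)
next
  case (ty_Refl P t \<Gamma>)
  then show ?case using eqf_sub[of P "Eq t t" \<theta>] by (auto intro!: typing.ty_Refl)
next
  case (ty_CaseEq \<theta>' \<Gamma> u v Q \<Gamma>' \<pi> \<sigma> bs P)
  then show ?case using eqf_sub[of P "sub_fm \<theta>' Q" \<theta>] by (auto intro!: typing.ty_CaseEq)
next
  case (ty_MuI \<Gamma> \<pi> \<gamma>s B ts P)
  then have "wff (Mu \<gamma>s B ts)" by (auto dest: eqf_wf)
  then show ?case using ty_MuI eqf_sub[of P "Mu \<gamma>s B ts" \<theta>]
    by (auto intro!: typing.ty_MuI simp: sub_unfold sub_mu_pred)
next
  case (ty_MuE \<Gamma> \<pi> \<gamma>s B ts S \<pi>' P)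
  then have wf: "wff (Mu \<gamma>s B ts)" by (auto dest: typing_wff)
  then have l: "length ts = length \<gamma>s" by (auto dest: list_all2_lengthD)
  have "typing (unfold_vars \<gamma>s (sub_fm (ups \<gamma>s \<theta>) B) (sub_fm (ups \<gamma>s \<theta>) S)
      # map (wk \<gamma>s) (map (sub_fm \<theta>) \<Gamma>)) (tsub_pf (ups \<gamma>s \<theta>) \<pi>') (sub_fm (ups \<gamma>s \<theta>) S)"
    using ty_MuE.IH(2)[of "ups \<gamma>s \<theta>"] ty_MuE.prems wf
    by (simp add: comp_def tcomp_shifts_ups sub_unfold_vars)
  moreover have "eqf (sub_fm \<theta> P)
      (sub_fm (insts \<gamma>s (map (sub_tm \<theta>) ts)) (sub_fm (ups \<gamma>s \<theta>) S))"
    using eqf_sub[OF ty_MuE.hyps(3), of \<theta>] ty_MuE.prems by (simp add: tcomp_ups_insts l)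
  ultimately show ?case using ty_MuE.IH(1)[of \<theta>] ty_MuE.prems by (auto intro!: typing.ty_MuE)
next
  case (ty_NuI \<Gamma> \<pi> \<gamma>s ts S \<pi>' B P)
  then have wf: "wff (Nu \<gamma>s B ts)" by (auto dest: eqf_wf)
  then have l: "length ts = length \<gamma>s" by (auto dest: list_all2_lengthD)
  have "typing (sub_fm (ups \<gamma>s \<theta>) S # map (wk \<gamma>s) (map (sub_fm \<theta>) \<Gamma>)) (tsub_pf (ups \<gamma>s \<theta>) \<pi>')
      (unfold_vars \<gamma>s (sub_fm (ups \<gamma>s \<theta>) B) (sub_fm (ups \<gamma>s \<theta>) S))"
    using ty_NuI.IH(2)[of "ups \<gamma>s \<theta>"] ty_NuI.prems wf
    by (simp add: comp_def tcomp_shifts_ups sub_unfold_vars)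
  moreover have "typing (map (sub_fm \<theta>) \<Gamma>) (tsub_pf \<theta> \<pi>)
      (sub_fm (insts \<gamma>s (map (sub_tm \<theta>) ts)) (sub_fm (ups \<gamma>s \<theta>) S))"
    using ty_NuI.IH(1)[of \<theta>] ty_NuI.prems by (simp add: tcomp_ups_insts l)
  ultimately show ?case using eqf_sub[OF ty_NuI.hyps(3), of \<theta>] ty_NuI.prems
    by (auto intro!: typing.ty_NuI)
next
  case (ty_NuE \<Gamma> \<pi> \<gamma>s B ts P)
  then have "wff (Nu \<gamma>s B ts)" by (auto dest: typing_wff)
  then show ?case using ty_NuE eqf_sub[OF ty_NuE.hyps(2), of \<theta>]
    by (auto intro!: typing.ty_NuE simp: sub_unfold sub_nu_pred)
qed

section \<open>Substitution of proofs for hypotheses\<close>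

definition hsub_ok ::
    "('b, 'c, 'a) hsub \<Rightarrow> ('b, 'c, 'a) fm list \<Rightarrow> ('b, 'c, 'a) fm list \<Rightarrow> bool" where
  "hsub_ok \<sigma> \<Gamma> \<Gamma>' \<longleftrightarrow> (\<forall>n<length \<Gamma>. wff (\<Gamma> ! n) \<longrightarrow> typing \<Gamma>' (\<sigma> n) (\<Gamma> ! n))"

lemma hsub_ok_up:
  assumes "hsub_ok \<sigma> \<Gamma> \<Gamma>'"
  shows "hsub_ok (up_h \<sigma>) (A # \<Gamma>) (A # \<Gamma>')"
proof -
  have r: "ren_ok Suc \<Gamma>' (A # \<Gamma>')" by (auto simp: ren_ok_def eqf_refl)
  have "typing (A # \<Gamma>') (Hyp 0) A" if "wff A"
    by (rule ty_Hyp) (simp_all add: eqf_refl that)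
  moreover have "typing (A # \<Gamma>') (ren_pf Suc (\<sigma> n)) (\<Gamma> ! n)" if "n < length \<Gamma>" "wff (\<Gamma> ! n)" for n
    using assms that by (intro typing_ren[OF _ r]) (simp add: hsub_ok_def)
  ultimately show ?thesis
    by (auto simp: hsub_ok_def up_h_def less_Suc_eq_0_disj)
qed

lemma hsub_ok_shift:
  "hsub_ok \<sigma> \<Gamma> \<Gamma>' \<Longrightarrow> hsub_ok (shift_h \<gamma>s \<sigma>) (map (wk \<gamma>s) \<Gamma>) (map (wk \<gamma>s) \<Gamma>')"
  by (auto simp: hsub_ok_def shift_h_def intro: typing_tsub)

lemma typing_hsub: "typing \<Gamma> \<pi> P \<Longrightarrow> hsub_ok \<sigma> \<Gamma> \<Gamma>' \<Longrightarrow> typing \<Gamma>' (hsub_pf \<sigma> \<pi>) P"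
proof (induction arbitrary: \<sigma> \<Gamma>' rule: typing.induct)
  case (ty_Hyp n \<Gamma> P)
  then show ?case by (auto simp: hsub_ok_def dest: eqf_wf intro: typing_conv eqf_sym)
next
  case (ty_CaseEq \<theta> \<Gamma> u v Q \<Gamma>' \<pi> \<sigma>' bs P)
  then show ?case by (auto intro!: typing.ty_CaseEq)
next
  case (ty_CaseOr \<Gamma> \<pi> P1 P2 \<pi>1 P \<pi>2)
  show ?case
    using ty_CaseOr.IH(1)[OF ty_CaseOr.prems] ty_CaseOr.IH(2,3)[OF hsub_ok_up[OF ty_CaseOr.prems]]
    by (auto intro: typing.ty_CaseOr)
next
  case (ty_LamT \<gamma> \<Gamma> \<pi> Q P)
  show ?case
    using ty_LamT.IH[OF hsub_ok_shift[OF ty_LamT.prems]] ty_LamT.hyps(2)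
    by (auto intro: typing.ty_LamT)
next
  case (ty_CaseEx \<Gamma> \<pi> \<gamma> Q \<pi>' P)
  show ?case
    using ty_CaseEx.IH(1)[OF ty_CaseEx.prems] ty_CaseEx.IH(2)[OF hsub_ok_up[OF hsub_ok_shift[OF ty_CaseEx.prems]]]
    by (auto intro: typing.ty_CaseEx)
next
  case (ty_MuE \<Gamma> \<pi> \<gamma>s B ts S \<pi>' P)
  show ?case
    using ty_MuE.IH(1)[OF ty_MuE.prems] ty_MuE.IH(2)[OF hsub_ok_up[OF hsub_ok_shift[OF ty_MuE.prems]]]
      ty_MuE.hyps(3)
    by (auto intro: typing.ty_MuE)
next
  case (ty_NuI \<Gamma> \<pi> \<gamma>s ts S \<pi>' B P)
  show ?case
    using ty_NuI.IH(1)[OF ty_NuI.prems] ty_NuI.IH(2)[OF hsub_ok_up[OF hsub_ok_shift[OF ty_NuI.prems]]]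
      ty_NuI.hyps(3)
    by (auto intro: typing.ty_NuI)
qed (auto intro!: typing.intros intro: typing.intros hsub_ok_up)

text \<open>The two types may differ by the congruence because, in a redex, the argument and the
  hypothesis are typed by different rules.\<close>

lemma typing_hinst:
  assumes "typing (A # \<Gamma>) \<pi>' P" "typing \<Gamma> \<pi> A'" "eqf A' A"
  shows "typing \<Gamma> (hinst \<pi> \<pi>') P"
proof -
  have "hsub_ok (hsubs [\<pi>]) (A # \<Gamma>) \<Gamma>"
    using typing_conv[OF assms(2,3)]
    by (auto simp: hsub_ok_def hsubs_def less_Suc_eq_0_disj intro: ty_Hyp eqf_refl)
  with assms(1) show ?thesis by (rule typing_hsub)
qed


section \<open>Functoriality\<close>

lemma typing_LamP: "typing (A # \<Gamma>) \<pi> B \<Longrightarrow> wff A \<Longrightarrow> typing \<Gamma> (LamP \<pi>) (Imp A B)"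
  by (rule ty_LamP) (auto intro!: eqf_refl dest: typing_wff)

lemma typing_Hyp0: "wff A \<Longrightarrow> typing (A # \<Gamma>) (Hyp 0) A"
  by (rule ty_Hyp) (auto intro: eqf_refl)

lemma typing_identity: "wff A \<Longrightarrow> typing \<Gamma> (LamP (Hyp 0)) (Imp A A)"
  by (simp add: typing_LamP typing_Hyp0)

lemma typing_identity_papp:
  assumes "\<not> occurs 0 \<delta>s Q" "wff Q" "wff S"
  shows "typing \<Gamma> (LamP (Hyp 0)) (Imp (papp \<delta>s Q S) (papp \<delta>s Q S'))"
  using typing_identity[OF wff_papp[OF assms(2,3), of \<delta>s], of \<Gamma>] papp_not_occurs[OF assms(1), of S S']
  by simp

lemma typing_App_hwk:
  "typing \<Gamma> \<pi> (Imp A B) \<Longrightarrow> typing (\<Delta> @ \<Gamma>) \<pi>' A \<Longrightarrow> k = length \<Delta> \<Longrightarrow>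
    typing (\<Delta> @ \<Gamma>) (AppP (hwk k \<pi>) \<pi>') B"
  by (blast intro: ty_AppP typing_hwk)

text \<open>Moves the argument of \<open>functoriality\<close> below the binders \<gamma>s that the
  recursion crosses, while its own binders \<delta>s stay innermost.\<close>

lemma typing_wk_fun:
  assumes "typing (P # map (wk \<delta>s) \<Gamma>) \<pi> P'"
  shows "typing (wk_under \<delta>s \<gamma>s P # map (wk \<delta>s) (map (wk \<gamma>s) \<Gamma>)) (wk_fun \<delta>s \<gamma>s \<pi>) (wk_under \<delta>s \<gamma>s P')"
  using typing_tsub[OF assms, of "ups \<delta>s (shifts \<gamma>s)"] by (simp add: comp_def tcomp_shifts_ups)

lemma wff_source: "wff P \<Longrightarrow> wff P' \<Longrightarrow> wff (source s P P')"
  by (cases s) (simp_all add: source_def)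

text \<open>The induction rule is that of the function, since at a fixed point the recursive call is
  on an unfolded body. \<Gamma> is general because calls below term binders weaken it. The polarity
  hypothesis says that p occurs with polarity s only, and \<open>source\<close> states both
  directions at once so that the implication case can switch between them.\<close>

lemma typing_functoriality:
  assumes "wff Q" "wff P" "wff P'" "\<not> occ (flip s) 0 \<delta>s Q"
    and "typing (P # map (wk \<delta>s) \<Gamma>) \<pi> P'"
  shows "typing \<Gamma> (functoriality s \<delta>s P P' Q \<pi>)
    (Imp (papp \<delta>s Q (source s P P')) (papp \<delta>s Q (source s P' P)))"
  using assms
proof (induction s \<delta>s P P' Q \<pi> arbitrary: \<Gamma> rule: functoriality.induct)
  case (1 s \<delta>s P P' i \<gamma>s ts \<pi>)
  show ?case
  proof (cases "occurs 0 \<delta>s (PVar i \<gamma>s ts :: ('b, 'c, 'a) fm)")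
    case False
    then show ?thesis using 1 by (simp del: papp_simps add: typing_identity_papp wff_source)
  next
    case True
    then have eq: "i = 0" "\<gamma>s = \<delta>s" by (auto simp: occurs_simps)
    \<comment> \<open>The occurrence of p is positive, which the hypothesis excludes for s =
      \<open>Neg\<close>. So the \<open>undefined\<close> branch of \<open>functoriality\<close> is
      never reached.\<close>
    with 1 have s: "s = Pos" by (cases s) auto
    have ts: "list_all2 wt ts \<delta>s" using 1 eq by simp
    then have "typing (sub_fm (insts \<delta>s ts) P # \<Gamma>) (tsub_pf (insts \<delta>s ts) \<pi>) (sub_fm (insts \<delta>s ts) P')"
      using typing_tsub[OF 1(5), of "insts \<delta>s ts"] by (simp add: comp_def list_all2_lengthD)
    then show ?thesis using 1(2) ts True
      by (simp add: eq s source_def papp_def typing_LamP)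
  qed
next
  case (2 s \<delta>s P P' A B \<pi>)
  show ?case
  proof (cases "occurs 0 \<delta>s (And A B)")
    case False
    then show ?thesis using 2 by (simp del: papp_simps add: typing_identity_papp wff_source)
  next
    case True
    let ?X = "source s P P'" and ?Y = "source s P' P"
    let ?H = "papp \<delta>s (And A B) ?X"
    have wf: "wff A" "wff B" "wff ?X" "wff ?Y" using 2 by (auto simp: wff_source)
    have h: "typing (?H # \<Gamma>) (Hyp 0) (And (papp \<delta>s A ?X) (papp \<delta>s B ?X))"
      using typing_Hyp0[of ?H \<Gamma>] wf by simp
    have p: "typing (?H # \<Gamma>) (Proj First (Hyp 0)) (papp \<delta>s A ?X)"
      "typing (?H # \<Gamma>) (Proj Second (Hyp 0)) (papp \<delta>s B ?X)"
      by (rule ty_Proj[OF h], simp add: eqf_refl wf)+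
    have "typing ([?H] @ \<Gamma>) (AppP (hwk 1 (functoriality s \<delta>s P P' A \<pi>)) (Proj First (Hyp 0))) (papp \<delta>s A ?Y)"
      by (rule typing_App_hwk[OF 2(1)]) (use 2 True p in auto)
    moreover have "typing ([?H] @ \<Gamma>) (AppP (hwk 1 (functoriality s \<delta>s P P' B \<pi>)) (Proj Second (Hyp 0))) (papp \<delta>s B ?Y)"
      by (rule typing_App_hwk[OF 2(2)]) (use 2 True p in auto)
    ultimately show ?thesis using True wf
      by (auto intro!: typing_LamP ty_Pair eqf_refl)
  qed
next
  case (3 s \<delta>s P P' A B \<pi>)
  show ?case
  proof (cases "occurs 0 \<delta>s (Or A B)")
    case False
    then show ?thesis using 3 by (simp del: papp_simps add: typing_identity_papp wff_source)
  next
    case True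
    let ?X = "source s P P'" and ?Y = "source s P' P"
    let ?H = "papp \<delta>s (Or A B) ?X"
    have wf: "wff A" "wff B" "wff ?X" "wff ?Y" using 3 by (auto simp: wff_source)
    have h: "typing (?H # \<Gamma>) (Hyp 0) (Or (papp \<delta>s A ?X) (papp \<delta>s B ?X))"
      using typing_Hyp0[of ?H \<Gamma>] wf by simp
    have "typing ([papp \<delta>s A ?X, ?H] @ \<Gamma>) (AppP (hwk 2 (functoriality s \<delta>s P P' A \<pi>)) (Hyp 0)) (papp \<delta>s A ?Y)"
      by (rule typing_App_hwk[OF 3(1)]) (use 3 True wf in \<open>auto intro!: typing_Hyp0\<close>)
    moreover have "typing ([papp \<delta>s B ?X, ?H] @ \<Gamma>) (AppP (hwk 2 (functoriality s \<delta>s P P' B \<pi>)) (Hyp 0)) (papp \<delta>s B ?Y)"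
      by (rule typing_App_hwk[OF 3(2)]) (use 3 True wf in \<open>auto intro!: typing_Hyp0\<close>)
    ultimately have "typing (?H # \<Gamma>) (CaseOr (Hyp 0)
        (In First (AppP (hwk 2 (functoriality s \<delta>s P P' A \<pi>)) (Hyp 0)))
        (In Second (AppP (hwk 2 (functoriality s \<delta>s P P' B \<pi>)) (Hyp 0)))) (papp \<delta>s (Or A B) ?Y)"
      by (intro ty_CaseOr[OF h] ty_In[where ?P1.0 = "papp \<delta>s A ?Y" and ?P2.0 = "papp \<delta>s B ?Y"])
        (use wf in \<open>simp_all add: eqf_refl\<close>)
    then show ?thesis using True wf by (simp add: typing_LamP)
  qed
next
  case (4 s \<delta>s P P' A B \<pi>)
  show ?case
  proof (cases "occurs 0 \<delta>s (Imp A B)")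
    case False
    then show ?thesis using 4 by (simp del: papp_simps add: typing_identity_papp wff_source)
  next
    case True
    let ?X = "source s P P'" and ?Y = "source s P' P"
    let ?H = "papp \<delta>s (Imp A B) ?X"
    have wf: "wff A" "wff B" "wff ?X" "wff ?Y" using 4 by (auto simp: wff_source)
    let ?\<Delta> = "[papp \<delta>s A ?Y, ?H]"
    have h: "typing (?\<Delta> @ \<Gamma>) (Hyp 1) (Imp (papp \<delta>s A ?X) (papp \<delta>s B ?X))"
      using wf by (auto intro!: ty_Hyp eqf_refl)
    \<comment> \<open>Contravariance: with the polarity flipped, \<open>source_flip\<close> turns
      the map for A around, from \<open>?Y\<close> to \<open>?X\<close>.\<close>
    have "typing \<Gamma> (functoriality (flip s) \<delta>s P P' A \<pi>) (Imp (papp \<delta>s A ?Y) (papp \<delta>s A ?X))"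
      using 4(2)[of \<Gamma>] 4(3-) True by simp
    then have "typing (?\<Delta> @ \<Gamma>) (AppP (hwk 2 (functoriality (flip s) \<delta>s P P' A \<pi>)) (Hyp 0)) (papp \<delta>s A ?X)"
      by (rule typing_App_hwk) (use wf in \<open>auto intro!: typing_Hyp0\<close>)
    with h have a: "typing (?\<Delta> @ \<Gamma>) (AppP (Hyp 1) (AppP (hwk 2 (functoriality (flip s) \<delta>s P P' A \<pi>)) (Hyp 0)))
        (papp \<delta>s B ?X)"
      by (rule ty_AppP)
    have "typing \<Gamma> (functoriality s \<delta>s P P' B \<pi>) (Imp (papp \<delta>s B ?X) (papp \<delta>s B ?Y))"
      using 4(1)[of \<Gamma>] 4(3-) True by simp
    from typing_App_hwk[OF this a, of 2] show ?thesis using True wf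
      by (simp add: typing_LamP)
  qed
next
  case (5 s \<delta>s P P' \<gamma> A \<pi>)
  show ?case
  proof (cases "occurs 0 \<delta>s (All \<gamma> A)")
    case False
    then show ?thesis using 5 by (simp del: papp_simps add: typing_identity_papp wff_source)
  next
    case True
    let ?w = "wk_under \<delta>s [\<gamma>]"
    let ?X = "source s P P'" and ?Y = "source s P' P"
    let ?H = "papp \<delta>s (All \<gamma> A) ?X"
    let ?F = "functoriality s \<delta>s (?w P) (?w P') A (wk_fun \<delta>s [\<gamma>] \<pi>)"
    have wf: "wff A" "wff ?X" "wff ?Y" using 5 by (auto simp: wff_source)
    have F: "typing (map (wk [\<gamma>]) \<Gamma>) ?F (Imp (papp \<delta>s A (?w ?X)) (papp \<delta>s A (?w ?Y)))"
      using 5(1)[of "map (wk [\<gamma>]) \<Gamma>"] 5(2-5) typing_wk_fun[OF 5(6), of "[\<gamma>]"] True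
      by (simp add: source_app)
    have h: "typing ([wk [\<gamma>] ?H] @ map (wk [\<gamma>]) \<Gamma>) (Hyp 0) (All \<gamma> (sub_fm (up \<gamma> (shifts [\<gamma>])) (papp \<delta>s A (?w ?X))))"
      using typing_Hyp0[of "wk [\<gamma>] ?H" "map (wk [\<gamma>]) \<Gamma>"] wf by simp
    \<comment> \<open>Instantiating the weakened quantifier with the variable just bound restores
      its body, by \<open>insts_Var0\<close>.\<close>
    have "typing ([wk [\<gamma>] ?H] @ map (wk [\<gamma>]) \<Gamma>) (AppT (Hyp 0) (Var 0 \<gamma>)) (papp \<delta>s A (?w ?X))"
      by (rule ty_AppT[OF h]) (use wf in \<open>auto simp: insts_Var0 intro!: eqf_refl\<close>)
    from typing_App_hwk[OF F this, of 1] have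
      "typing (map (wk [\<gamma>]) (?H # \<Gamma>)) (AppP (hwk 1 ?F) (AppT (Hyp 0) (Var 0 \<gamma>))) (papp \<delta>s A (?w ?Y))"
      by simp
    then have "typing (?H # \<Gamma>) (LamT \<gamma> (AppP (hwk 1 ?F) (AppT (Hyp 0) (Var 0 \<gamma>)))) (papp \<delta>s (All \<gamma> A) ?Y)"
      by (rule ty_LamT) (use wf in \<open>auto intro!: eqf_refl\<close>)
    then show ?thesis using True wf by (simp add: typing_LamP)
  qed
next
  case (6 s \<delta>s P P' \<gamma> A \<pi>)
  show ?case
  proof (cases "occurs 0 \<delta>s (Ex \<gamma> A)")
    case False
    then show ?thesis using 6 by (simp del: papp_simps add: typing_identity_papp wff_source)
  next
    case True
    let ?w = "wk_under \<delta>s [\<gamma>]"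
    let ?X = "source s P P'" and ?Y = "source s P' P"
    let ?H = "papp \<delta>s (Ex \<gamma> A) ?X"
    let ?F = "functoriality s \<delta>s (?w P) (?w P') A (wk_fun \<delta>s [\<gamma>] \<pi>)"
    have wf: "wff A" "wff ?X" "wff ?Y" using 6 by (auto simp: wff_source)
    have F: "typing (map (wk [\<gamma>]) \<Gamma>) ?F (Imp (papp \<delta>s A (?w ?X)) (papp \<delta>s A (?w ?Y)))"
      using 6(1)[of "map (wk [\<gamma>]) \<Gamma>"] 6(2-5) typing_wk_fun[OF 6(6), of "[\<gamma>]"] True
      by (simp add: source_app)
    let ?\<Delta> = "[papp \<delta>s A (?w ?X), wk [\<gamma>] ?H]"
    have "typing (?\<Delta> @ map (wk [\<gamma>]) \<Gamma>) (AppP (hwk 2 ?F) (Hyp 0)) (papp \<delta>s A (?w ?Y))"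
      by (rule typing_App_hwk[OF F]) (use wf in \<open>auto intro!: typing_Hyp0\<close>)
    \<comment> \<open>The unpacked witness is packed again. The matrix is given explicitly as the
      weakened one, whose instance at this witness is the original by
      \<open>insts_Var0\<close>.\<close>
    then have "typing (?\<Delta> @ map (wk [\<gamma>]) \<Gamma>) (Pack (Var 0 \<gamma>) (AppP (hwk 2 ?F) (Hyp 0)))
        (wk [\<gamma>] (papp \<delta>s (Ex \<gamma> A) ?Y))"
      by (intro ty_Pack[where \<gamma> = \<gamma> and Q = "sub_fm (up \<gamma> (shifts [\<gamma>])) (papp \<delta>s A (?w ?Y))"])
        (use wf in \<open>auto simp: insts_Var0 wt_sub_up intro!: eqf_refl\<close>)
    then have "typing (?H # \<Gamma>) (CaseEx \<gamma> (Hyp 0) (Pack (Var 0 \<gamma>) (AppP (hwk 2 ?F) (Hyp 0))))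
        (papp \<delta>s (Ex \<gamma> A) ?Y)"
      by (intro ty_CaseEx[where Q = "papp \<delta>s A (?w ?X)"])
        (use typing_Hyp0[of ?H \<Gamma>] wf in auto)
    then show ?thesis using True wf by (simp add: typing_LamP)
  qed
next
  case (7 s \<delta>s P P' \<gamma>s R ts \<pi>)
  show ?case
  proof (cases "occurs 0 \<delta>s (Mu \<gamma>s R ts)")
    case False
    then show ?thesis using 7 by (simp del: papp_simps add: typing_identity_papp wff_source)
  next
    case True
    let ?X = "source s P P'" and ?Y = "source s P' P"
    let ?w = "wk_under \<delta>s \<gamma>s"
    define BX where "BX = psub_fm (pup \<gamma>s (pinst \<delta>s ?X)) R"
    define BY where "BY = psub_fm (pup \<gamma>s (pinst \<delta>s ?Y)) R"
    \<comment> \<open>The induction runs with the target fixed point as invariant; M is this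
      invariant seen below the variables that \<open>MuE\<close> binds.\<close>
    define M where "M = wk_under \<gamma>s \<gamma>s (mu_pred \<gamma>s BY)"
    define F where "F = functoriality s \<delta>s (?w P) (?w P') (papp \<gamma>s R (pwk \<delta>s M)) (wk_fun \<delta>s \<gamma>s \<pi>)"
    have wf: "wff R" "\<not> occ Neg 0 \<gamma>s R" "list_all2 wt ts \<gamma>s" "wff ?X" "wff ?Y"
      using 7(2-4) by (auto simp: wff_source)
    then have l: "length ts = length \<gamma>s" by (simp add: list_all2_lengthD)
    have wfB: "wff BX" "wff BY" "\<not> occ Neg 0 \<gamma>s BX" "\<not> occ Neg 0 \<gamma>s BY"
      using wf by (simp_all add: BX_def BY_def)
    have wfM: "wff M" using wfB by (simp add: M_def)
    have M': "M = mu_pred \<gamma>s (wk_under \<gamma>s \<gamma>s BY)" by (simp add: M_def sub_mu_pred)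
    have pX: "papp \<delta>s (Mu \<gamma>s R ts) ?X = Mu \<gamma>s BX ts" and pY: "papp \<delta>s (Mu \<gamma>s R ts) ?Y = Mu \<gamma>s BY ts"
      by (simp_all add: papp_def BX_def BY_def)
    have Y: "(case s of Pos \<Rightarrow> P' | Neg \<Rightarrow> P) = ?Y" by (simp add: source_def)
    have fn: "functoriality s \<delta>s P P' (Mu \<gamma>s R ts) \<pi> = LamP (MuE \<gamma>s (mu_pred \<gamma>s BY) (Hyp 0)
         (MuI \<gamma>s (wk_under \<gamma>s \<gamma>s BY) (vars \<gamma>s) (AppP (hwk 2 F) (Hyp 0))))"
      using True by (simp add: Y BY_def[symmetric] M_def[symmetric] F_def)
    \<comment> \<open>The recursive call sees R with its fixed point variable replaced by a formula
      free of p, so \<open>occ_papp_pwk\<close> provides the polarity condition.\<close>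
    have "typing (map (wk \<gamma>s) \<Gamma>) F
        (Imp (papp \<delta>s (papp \<gamma>s R (pwk \<delta>s M)) (source s (?w P) (?w P')))
          (papp \<delta>s (papp \<gamma>s R (pwk \<delta>s M)) (source s (?w P') (?w P))))"
      unfolding F_def M_def BY_def Y[symmetric]
      by (rule 7(1)[OF _ refl])
        (use True 7(2-5) wf wfB(2,4) typing_wk_fun[OF 7(6), of \<gamma>s] in
          \<open>auto simp: occ_papp_pwk Y BY_def split: if_splits\<close>)
    \<comment> \<open>Exchanging the two replacements by \<open>papp_papp_pwk\<close> exhibits the
      bodies of the source and of the target fixed point, both applied to M.\<close>
    then have F: "typing (map (wk \<gamma>s) \<Gamma>) F (Imp (papp \<gamma>s BX M) (papp \<gamma>s BY M))"
      using wf wfM by (simp add: source_app papp_papp_pwk BX_def BY_def)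
    \<comment> \<open>The first entry is the induction hypothesis bound by \<open>MuE\<close>, that
      is, the source body at the invariant; the second is the assumption of the outer abstraction,
      weakened. They account for the 2 in \<open>hwk 2\<close>.\<close>
    let ?\<Delta> = "[papp \<gamma>s BX M, wk \<gamma>s (Mu \<gamma>s BX ts)]"
    have "typing (?\<Delta> @ map (wk \<gamma>s) \<Gamma>) (AppP (hwk 2 F) (Hyp 0)) (papp \<gamma>s BY M)"
      by (rule typing_App_hwk[OF F]) (use wfB wfM in \<open>auto intro!: typing_Hyp0\<close>)
    then have "typing (?\<Delta> @ map (wk \<gamma>s) \<Gamma>)
        (MuI \<gamma>s (wk_under \<gamma>s \<gamma>s BY) (vars \<gamma>s) (AppP (hwk 2 F) (Hyp 0))) (mu_pred \<gamma>s BY)"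
      by (intro ty_MuI) (use wfB in \<open>simp_all add: unfold_wk_vars M' mu_pred_def[of _ BY] eqf_refl\<close>)
    then have "typing (Mu \<gamma>s BX ts # \<Gamma>) (MuE \<gamma>s (mu_pred \<gamma>s BY) (Hyp 0)
         (MuI \<gamma>s (wk_under \<gamma>s \<gamma>s BY) (vars \<gamma>s) (AppP (hwk 2 F) (Hyp 0)))) (Mu \<gamma>s BY ts)"
      by (intro ty_MuE[where B = BX and ts = ts] typing_Hyp0)
        (use wf wfB l in \<open>auto simp: unfold_vars_def M_def insts_mu_pred intro!: eqf_refl\<close>)
    then show ?thesis unfolding pX pY fn using wf wfB by (simp add: typing_LamP)
  qed
next
  case (8 s \<delta>s P P' \<gamma>s R ts \<pi>)
  show ?case
  proof (cases "occurs 0 \<delta>s (Nu \<gamma>s R ts)")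
    case False
    then show ?thesis using 8 by (simp del: papp_simps add: typing_identity_papp wff_source)
  next
    case True
    let ?X = "source s P P'" and ?Y = "source s P' P"
    let ?w = "wk_under \<delta>s \<gamma>s"
    define BX where "BX = psub_fm (pup \<gamma>s (pinst \<delta>s ?X)) R"
    define BY where "BY = psub_fm (pup \<gamma>s (pinst \<delta>s ?Y)) R"
    \<comment> \<open>Dually, the coinvariant is the source fixed point.\<close>
    define M where "M = wk_under \<gamma>s \<gamma>s (nu_pred \<gamma>s BX)"
    define F where "F = functoriality s \<delta>s (?w P) (?w P') (papp \<gamma>s R (pwk \<delta>s M)) (wk_fun \<delta>s \<gamma>s \<pi>)"
    have wf: "wff R" "\<not> occ Neg 0 \<gamma>s R" "list_all2 wt ts \<gamma>s" "wff ?X" "wff ?Y"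
      using 8(2-4) by (auto simp: wff_source)
    then have l: "length ts = length \<gamma>s" by (simp add: list_all2_lengthD)
    have wfB: "wff BX" "wff BY" "\<not> occ Neg 0 \<gamma>s BX" "\<not> occ Neg 0 \<gamma>s BY"
      using wf by (simp_all add: BX_def BY_def)
    have wfM: "wff M" using wfB by (simp add: M_def)
    have pX: "papp \<delta>s (Nu \<gamma>s R ts) ?X = Nu \<gamma>s BX ts" and pY: "papp \<delta>s (Nu \<gamma>s R ts) ?Y = Nu \<gamma>s BY ts"
      by (simp_all add: papp_def BX_def BY_def)
    have X: "(case s of Pos \<Rightarrow> P | Neg \<Rightarrow> P') = ?X" by (simp add: source_def)
    have fn: "functoriality s \<delta>s P P' (Nu \<gamma>s R ts) \<pi> = LamP (NuI \<gamma>s (nu_pred \<gamma>s BX) (Hyp 0)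
         (AppP (hwk 2 F) (NuE \<gamma>s (wk_under \<gamma>s \<gamma>s BX) (vars \<gamma>s) (Hyp 0))))"
      using True by (simp add: X BX_def[symmetric] M_def[symmetric] F_def)
    have "typing (map (wk \<gamma>s) \<Gamma>) F
        (Imp (papp \<delta>s (papp \<gamma>s R (pwk \<delta>s M)) (source s (?w P) (?w P')))
          (papp \<delta>s (papp \<gamma>s R (pwk \<delta>s M)) (source s (?w P') (?w P))))"
      unfolding F_def M_def BX_def X[symmetric]
      by (rule 8(1)[OF _ refl])
        (use True 8(2-5) wf wfB(1,3) typing_wk_fun[OF 8(6), of \<gamma>s] in
          \<open>auto simp: occ_papp_pwk X BX_def split: if_splits\<close>)
    then have F: "typing (map (wk \<gamma>s) \<Gamma>) F (Imp (papp \<gamma>s BX M) (papp \<gamma>s BY M))"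
      using wf wfM by (simp add: source_app papp_papp_pwk BX_def BY_def)
    let ?\<Delta> = "[nu_pred \<gamma>s BX, wk \<gamma>s (Nu \<gamma>s BX ts)]"
    have h: "typing (?\<Delta> @ map (wk \<gamma>s) \<Gamma>) (Hyp 0) (Nu \<gamma>s (wk_under \<gamma>s \<gamma>s BX) (vars \<gamma>s))"
      using typing_Hyp0[of "nu_pred \<gamma>s BX"] wfB by (simp add: nu_pred_def)
    \<comment> \<open>The source is unfolded before the recursive map is applied, whereas for a
      least fixed point the target is folded after it. Unfolding at the variables of the block is
      \<open>papp\<close> by the eta law \<open>unfold_wk_vars\<close>.\<close>
    have "typing (?\<Delta> @ map (wk \<gamma>s) \<Gamma>) (NuE \<gamma>s (wk_under \<gamma>s \<gamma>s BX) (vars \<gamma>s) (Hyp 0)) (papp \<gamma>s BX M)"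
      by (rule ty_NuE[OF h])
        (use wfB wfM in \<open>auto simp: unfold_wk_vars M_def sub_nu_pred intro!: eqf_refl\<close>)
    from typing_App_hwk[OF F this, of 2]
    have "typing (?\<Delta> @ map (wk \<gamma>s) \<Gamma>)
        (AppP (hwk 2 F) (NuE \<gamma>s (wk_under \<gamma>s \<gamma>s BX) (vars \<gamma>s) (Hyp 0))) (papp \<gamma>s BY M)"
      by simp
    then have "typing (Nu \<gamma>s BX ts # \<Gamma>) (NuI \<gamma>s (nu_pred \<gamma>s BX) (Hyp 0)
        (AppP (hwk 2 F) (NuE \<gamma>s (wk_under \<gamma>s \<gamma>s BX) (vars \<gamma>s) (Hyp 0)))) (Nu \<gamma>s BY ts)"
      by (intro ty_NuI[where B = BY and ts = ts])
        (use wf wfB l in \<open>auto simp: unfold_vars_def M_def insts_nu_pred intro!: eqf_refl typing_Hyp0\<close>)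
    then show ?thesis unfolding pX pY fn using wf wfB by (simp add: typing_LamP)
  qed
qed (simp_all add: typing_identity papp_def)

section \<open>Subject reduction\<close>

inductive_cases typing_BotE: "typing \<Gamma> (BotE \<pi>) P"
inductive_cases typing_LamPE: "typing \<Gamma> (LamP \<pi>) P"
inductive_cases typing_AppPE: "typing \<Gamma> (AppP \<pi> \<pi>') P"
inductive_cases typing_PairPE: "typing \<Gamma> (PairP \<pi> \<pi>') P"
inductive_cases typing_ProjE: "typing \<Gamma> (Proj k \<pi>) P"
inductive_cases typing_InE: "typing \<Gamma> (In k \<pi>) P"
inductive_cases typing_CaseOrE: "typing \<Gamma> (CaseOr \<pi> \<pi>1 \<pi>2) P"
inductive_cases typing_LamTE: "typing \<Gamma> (LamT \<gamma> \<pi>) P"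
inductive_cases typing_AppTE: "typing \<Gamma> (AppT \<pi> t) P"
inductive_cases typing_PackE: "typing \<Gamma> (Pack t \<pi>) P"
inductive_cases typing_CaseExE: "typing \<Gamma> (CaseEx \<gamma> \<pi> \<pi>') P"
inductive_cases typing_CaseEqE: "typing \<Gamma>' (CaseEq \<Gamma> \<theta> \<sigma> u v Q \<pi> bs) P"
inductive_cases typing_MuIE: "typing \<Gamma> (MuI \<gamma>s B ts \<pi>) P"
inductive_cases typing_MuEE: "typing \<Gamma> (MuE \<gamma>s S \<pi> \<pi>') P"
inductive_cases typing_NuIE: "typing \<Gamma> (NuI \<gamma>s S \<pi> \<pi>') P"
inductive_cases typing_NuEE: "typing \<Gamma> (NuE \<gamma>s B ts \<pi>) P"

lemma non_confusingD:
  assumes non_confusing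
  shows "eqf (Imp A B) (Imp A' B') \<Longrightarrow> eqf A A' \<and> eqf B B'"
    and "eqf (And A B) (And A' B') \<Longrightarrow> eqf A A' \<and> eqf B B'"
    and "eqf (Or A B) (Or A' B') \<Longrightarrow> eqf A A' \<and> eqf B B'"
    and "eqf (All \<gamma> A) (All \<gamma>' A') \<Longrightarrow> \<gamma> = \<gamma>' \<and> eqf A A'"
    and "eqf (Ex \<gamma> A) (Ex \<gamma>' A') \<Longrightarrow> \<gamma> = \<gamma>' \<and> eqf A A'"
    and "eqf (Mu \<gamma>s A ts) (Mu \<gamma>s' A' ts') \<Longrightarrow> \<gamma>s = \<gamma>s' \<and> eqf A A' \<and> list_all2 eqt ts ts'"
    and "eqf (Nu \<gamma>s A ts) (Nu \<gamma>s' A' ts') \<Longrightarrow> \<gamma>s = \<gamma>s' \<and> eqf A A' \<and> list_all2 eqt ts ts'"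
proof -
  note nc = assms[unfolded non_confusing_def]
  show "eqf (Imp A B) (Imp A' B') \<Longrightarrow> eqf A A' \<and> eqf B B'"
    using nc[THEN conjunct1] by blast
  show "eqf (And A B) (And A' B') \<Longrightarrow> eqf A A' \<and> eqf B B'"
    using nc[THEN conjunct2, THEN conjunct1] by blast
  show "eqf (Or A B) (Or A' B') \<Longrightarrow> eqf A A' \<and> eqf B B'"
    using nc[THEN conjunct2, THEN conjunct2, THEN conjunct1] by blast
  show "eqf (All \<gamma> A) (All \<gamma>' A') \<Longrightarrow> \<gamma> = \<gamma>' \<and> eqf A A'"
    using nc[THEN conjunct2, THEN conjunct2, THEN conjunct2, THEN conjunct1] by blast
  show "eqf (Ex \<gamma> A) (Ex \<gamma>' A') \<Longrightarrow> \<gamma> = \<gamma>' \<and> eqf A A'"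
    using nc[THEN conjunct2, THEN conjunct2, THEN conjunct2, THEN conjunct2, THEN conjunct1] by blast
  show "eqf (Mu \<gamma>s A ts) (Mu \<gamma>s' A' ts') \<Longrightarrow> \<gamma>s = \<gamma>s' \<and> eqf A A' \<and> list_all2 eqt ts ts'"
    using nc[THEN conjunct2, THEN conjunct2, THEN conjunct2, THEN conjunct2, THEN conjunct2, THEN conjunct1] by blast
  show "eqf (Nu \<gamma>s A ts) (Nu \<gamma>s' A' ts') \<Longrightarrow> \<gamma>s = \<gamma>s' \<and> eqf A A' \<and> list_all2 eqt ts ts'"
    using nc[THEN conjunct2, THEN conjunct2, THEN conjunct2, THEN conjunct2, THEN conjunct2, THEN conjunct2] by blast
qed

lemma eqf_unfold_vars: "eqf B B' \<Longrightarrow> wff S \<Longrightarrow> eqf (unfold_vars \<gamma>s B S) (unfold_vars \<gamma>s B' S)"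
  by (simp add: unfold_vars_def papp_def eqf_psub)

lemma eqf_unfold:
  "eqf B B' \<Longrightarrow> wff S \<Longrightarrow> list_all2 wt ts \<gamma>s \<Longrightarrow> eqf (unfold \<gamma>s B S ts) (unfold \<gamma>s B' S ts)"
  by (simp add: unfold_def papp_def eqf_psub eqf_sub)

lemma eqf_insts:
  assumes "wff S" "list_all2 eqt ts ts'" "list_all2 wt ts \<gamma>s" "list_all2 wt ts' \<gamma>s"
  shows "eqf (sub_fm (insts \<gamma>s ts) S) (sub_fm (insts \<gamma>s ts') S)"
  using assms
  by (intro eqf_sub_cong) (simp_all add: eqt_insts list_all2_lengthD[OF assms(3)])

lemma typing_insts:
  assumes "typing (A # map (wk \<gamma>s) \<Gamma>) \<pi> P" "list_all2 wt ts \<gamma>s"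
  shows "typing (sub_fm (insts \<gamma>s ts) A # \<Gamma>) (tsub_pf (insts \<gamma>s ts) \<pi>) (sub_fm (insts \<gamma>s ts) P)"
  using typing_tsub[OF assms(1), of "insts \<gamma>s ts"] assms(2) list_all2_lengthD[OF assms(2)]
  by (simp add: comp_def)

lemma typing_unfold_functoriality:
  assumes "wff B" "\<not> occ Neg 0 \<gamma>s B" "list_all2 wt ts \<gamma>s" "wff P" "wff P'"
    and "typing (P # map (wk \<gamma>s) \<Gamma>) \<pi> P'"
  shows "typing \<Gamma> (functoriality Pos \<gamma>s P P' (sub_fm (insts \<gamma>s ts) B) \<pi>)
    (Imp (unfold \<gamma>s B P ts) (unfold \<gamma>s B P' ts))"
  using typing_functoriality[of "sub_fm (insts \<gamma>s ts) B" P P' Pos \<gamma>s \<Gamma> \<pi>] assms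
  by (simp add: source_def unfold_def)

text \<open>A contractum for a fixed point repeats the body \<pi> of the recursion inside the
  argument of \<open>functoriality\<close>, thus below a second copy of \<gamma>s and in presence of
  the hypothesis C of that argument. \<open>up_hren Suc\<close> steps over C and keeps the
  hypothesis of \<pi> itself, which may be converted to A'.\<close>

lemma typing_wk_step:
  assumes "typing (A # map (wk \<gamma>s) \<Gamma>) \<pi> P" "eqf (wk_under \<gamma>s \<gamma>s A) A'"
  shows "typing (A' # map (wk \<gamma>s) (C # map (wk \<gamma>s) \<Gamma>))
    (ren_pf (up_hren Suc) (wk_fun \<gamma>s \<gamma>s \<pi>)) (wk_under \<gamma>s \<gamma>s P)"
proof (rule typing_ren[OF typing_wk_fun[OF assms(1)]], rule ren_ok_up)
  show "ren_ok Suc (map (wk \<gamma>s) (map (wk \<gamma>s) \<Gamma>)) (map (wk \<gamma>s) (C # map (wk \<gamma>s) \<Gamma>))"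
    by (auto simp: ren_ok_def eqf_refl)
qed (rule assms(2))

section \<open>Contraction of fixed point and equality redexes\<close>

text \<open>\<open>MuI\<close> fixes B and ts, while \<open>MuE\<close> was typed with some B0 and
  ts0. Injectivity of the fixed point constructor makes them congruent, and the conversions in the
  proof bridge this difference.\<close>

lemma red_mu_typing:
  assumes nc: non_confusing and ty: "typing \<Gamma> (MuE \<gamma>s S (MuI \<gamma>s B ts \<pi>) \<pi>') P"
  shows "typing \<Gamma> (hinst
      (AppP
        (functoriality Pos \<gamma>s (mu_pred \<gamma>s B) S (sub_fm (insts \<gamma>s ts) B)
          (MuE \<gamma>s (wk_under \<gamma>s \<gamma>s S) (Hyp 0) (ren_pf (up_hren Suc) (wk_fun \<gamma>s \<gamma>s \<pi>'))))
        \<pi>)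
      (tsub_pf (insts \<gamma>s ts) \<pi>')) P"
proof -
  from ty obtain B0 ts0 where
    ty1: "typing \<Gamma> (MuI \<gamma>s B ts \<pi>) (Mu \<gamma>s B0 ts0)" and
    ty2: "typing (unfold_vars \<gamma>s B0 S # map (wk \<gamma>s) \<Gamma>) \<pi>' S" and
    P: "eqf P (sub_fm (insts \<gamma>s ts0) S)"
    by (auto elim: typing_MuEE)
  from ty1 have ty3: "typing \<Gamma> \<pi> (unfold \<gamma>s B (mu_pred \<gamma>s B) ts)"
    and eq: "eqf (Mu \<gamma>s B0 ts0) (Mu \<gamma>s B ts)"
    by (auto elim: typing_MuIE)
  have B0: "eqf B0 B" and ts0: "list_all2 eqt ts0 ts" using non_confusingD(6)[OF nc eq] by auto
  have wf: "wff B" "\<not> occ Neg 0 \<gamma>s B" "wff B0" "list_all2 wt ts \<gamma>s" "list_all2 wt ts0 \<gamma>s" "wff S"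
    using eqf_wf[OF eq] typing_wff[OF ty2] by auto
  \<comment> \<open>The invariance proof assumes an unfolding of B0, but the recursion inside the
    contractum is over B.\<close>
  have U: "eqf (wk_under \<gamma>s \<gamma>s (unfold_vars \<gamma>s B0 S))
      (unfold_vars \<gamma>s (wk_under \<gamma>s \<gamma>s B) (wk_under \<gamma>s \<gamma>s S))"
    using eqf_sub[OF eqf_unfold_vars[OF B0 \<open>wff S\<close>], of "ups \<gamma>s (shifts \<gamma>s)" \<gamma>s] wf
    by (simp add: sub_unfold_vars)
  \<comment> \<open>The argument of functoriality is the recursion itself, run on a hypothetical
    element of the fixed point at generic arguments \<open>vars \<gamma>s\<close>.\<close>
  have "typing (mu_pred \<gamma>s B # map (wk \<gamma>s) \<Gamma>)
      (MuE \<gamma>s (wk_under \<gamma>s \<gamma>s S) (Hyp 0) (ren_pf (up_hren Suc) (wk_fun \<gamma>s \<gamma>s \<pi>'))) S"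
  proof (rule ty_MuE[OF _ typing_wk_step[OF ty2 U]])
    show "typing (mu_pred \<gamma>s B # map (wk \<gamma>s) \<Gamma>) (Hyp 0) (Mu \<gamma>s (wk_under \<gamma>s \<gamma>s B) (vars \<gamma>s))"
      using typing_Hyp0[of "mu_pred \<gamma>s B"] wf by (simp add: mu_pred_def)
    show "eqf S (sub_fm (insts \<gamma>s (vars \<gamma>s)) (wk_under \<gamma>s \<gamma>s S))"
      using wf by (simp add: eqf_refl)
  qed
  then have "typing \<Gamma> (functoriality Pos \<gamma>s (mu_pred \<gamma>s B) S (sub_fm (insts \<gamma>s ts) B)
      (MuE \<gamma>s (wk_under \<gamma>s \<gamma>s S) (Hyp 0) (ren_pf (up_hren Suc) (wk_fun \<gamma>s \<gamma>s \<pi>'))))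
      (Imp (unfold \<gamma>s B (mu_pred \<gamma>s B) ts) (unfold \<gamma>s B S ts))"
    using wf by (intro typing_unfold_functoriality) simp_all
  \<comment> \<open>The functoriality map delivers B S ts, while the instantiated invariance proof
    expects B0 S ts.\<close>
  moreover have "eqf (unfold \<gamma>s B S ts) (sub_fm (insts \<gamma>s ts) (unfold_vars \<gamma>s B0 S))"
    using eqf_unfold[OF eqf_sym[OF B0] \<open>wff S\<close> wf(4)] wf by (simp add: insts_unfold_vars)
  ultimately show ?thesis
    by (blast intro: typing_conv[OF typing_hinst[OF typing_insts[OF ty2 wf(4)] ty_AppP[OF _ ty3]]]
        eqf_sym[OF eqf_trans[OF P eqf_insts[OF wf(6) ts0 wf(5,4)]]])
qed

lemma red_nu_typing:
  assumes nc: non_confusing and ty: "typing \<Gamma> (NuE \<gamma>s B ts (NuI \<gamma>s S \<pi> \<pi>')) P"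
  shows "typing \<Gamma> (AppP
      (functoriality Pos \<gamma>s S (nu_pred \<gamma>s B) (sub_fm (insts \<gamma>s ts) B)
        (NuI \<gamma>s (wk_under \<gamma>s \<gamma>s S) (Hyp 0) (ren_pf (up_hren Suc) (wk_fun \<gamma>s \<gamma>s \<pi>'))))
      (hinst \<pi> (tsub_pf (insts \<gamma>s ts) \<pi>'))) P"
proof -
  from ty have ty1: "typing \<Gamma> (NuI \<gamma>s S \<pi> \<pi>') (Nu \<gamma>s B ts)"
    and P: "eqf P (unfold \<gamma>s B (nu_pred \<gamma>s B) ts)"
    by (auto elim: typing_NuEE)
  from ty1 obtain B0 ts0 where
    ty2: "typing \<Gamma> \<pi> (sub_fm (insts \<gamma>s ts0) S)" and
    ty3: "typing (S # map (wk \<gamma>s) \<Gamma>) \<pi>' (unfold_vars \<gamma>s B0 S)" and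
    eq: "eqf (Nu \<gamma>s B ts) (Nu \<gamma>s B0 ts0)"
    by (auto elim: typing_NuIE)
  have B0: "eqf B B0" and ts0: "list_all2 eqt ts ts0" using non_confusingD(7)[OF nc eq] by auto
  have wf: "wff B" "\<not> occ Neg 0 \<gamma>s B" "wff B0" "list_all2 wt ts \<gamma>s" "list_all2 wt ts0 \<gamma>s"
    using eqf_wf[OF eq] by auto
  have S: "wff S" using typing_wff[OF ty2] wf by simp
  have U: "eqf (wk_under \<gamma>s \<gamma>s (unfold_vars \<gamma>s B0 S))
      (unfold_vars \<gamma>s (wk_under \<gamma>s \<gamma>s B) (wk_under \<gamma>s \<gamma>s S))"
    using eqf_sub[OF eqf_unfold_vars[OF eqf_sym[OF B0] S], of "ups \<gamma>s (shifts \<gamma>s)" \<gamma>s] wf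
    by (simp add: sub_unfold_vars)
  have "typing (S # map (wk \<gamma>s) \<Gamma>)
      (NuI \<gamma>s (wk_under \<gamma>s \<gamma>s S) (Hyp 0) (ren_pf (up_hren Suc) (wk_fun \<gamma>s \<gamma>s \<pi>'))) (nu_pred \<gamma>s B)"
  proof (rule ty_NuI)
    show "typing (S # map (wk \<gamma>s) \<Gamma>) (Hyp 0) (sub_fm (insts \<gamma>s (vars \<gamma>s)) (wk_under \<gamma>s \<gamma>s S))"
      using S by (simp add: typing_Hyp0)
    show "typing (wk_under \<gamma>s \<gamma>s S # map (wk \<gamma>s) (S # map (wk \<gamma>s) \<Gamma>))
        (ren_pf (up_hren Suc) (wk_fun \<gamma>s \<gamma>s \<pi>'))
        (unfold_vars \<gamma>s (wk_under \<gamma>s \<gamma>s B) (wk_under \<gamma>s \<gamma>s S))"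
      \<comment> \<open>For a coinvariant the unfolding is the conclusion, so B0 is converted to B
        there and the hypothesis S is kept.\<close>
      by (rule typing_conv[OF typing_wk_step[OF ty3] U]) (simp add: eqf_refl S)
    show "eqf (nu_pred \<gamma>s B) (Nu \<gamma>s (wk_under \<gamma>s \<gamma>s B) (vars \<gamma>s))"
      unfolding nu_pred_def using wf by (intro eqf_refl) simp
  qed
  then have "typing \<Gamma> (functoriality Pos \<gamma>s S (nu_pred \<gamma>s B) (sub_fm (insts \<gamma>s ts) B)
      (NuI \<gamma>s (wk_under \<gamma>s \<gamma>s S) (Hyp 0) (ren_pf (up_hren Suc) (wk_fun \<gamma>s \<gamma>s \<pi>'))))
      (Imp (unfold \<gamma>s B S ts) (unfold \<gamma>s B (nu_pred \<gamma>s B) ts))"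
    using wf S by (intro typing_unfold_functoriality) simp_all
  \<comment> \<open>\<pi> proves S at ts0, while the coinvariance proof is instantiated at ts; these
    instances of S are congruent by \<open>eqf_insts\<close>.\<close>
  moreover have "typing \<Gamma> (hinst \<pi> (tsub_pf (insts \<gamma>s ts) \<pi>')) (unfold \<gamma>s B0 S ts)"
    using typing_hinst[OF typing_insts[OF ty3 wf(4)] ty2] eqf_sym[OF eqf_insts[OF S ts0 wf(4,5)]] wf
    by (simp add: insts_unfold_vars)
  then have "typing \<Gamma> (hinst \<pi> (tsub_pf (insts \<gamma>s ts) \<pi>')) (unfold \<gamma>s B S ts)"
    by (rule typing_conv) (rule eqf_unfold[OF eqf_sym[OF B0] S wf(4)])
  ultimately show ?thesis
    by (rule typing_conv[OF ty_AppP eqf_sym[OF P]])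
qed

lemma red_eq_typing:
  assumes ty: "typing \<Gamma>' (CaseEq \<Gamma> \<theta> \<sigma> u v Q (Refl w) bs) P"
    and b: "(\<theta>', \<pi>) \<in> set bs" and wt: "wt_sub \<theta>''" and eq: "sub_eq \<theta> (tcomp \<theta>' \<theta>'')"
  shows "typing \<Gamma>' (hsub_pf (hsubs \<sigma>) (tsub_pf \<theta>'' \<pi>)) P"
proof -
  from ty have wf: "wt_sub \<theta>" "\<forall>A\<in>set \<Gamma>. wff A" "wff Q" and l: "length \<sigma> = length \<Gamma>"
    and \<sigma>: "\<forall>n<length \<Gamma>. typing \<Gamma>' (\<sigma> ! n) (sub_fm \<theta> (\<Gamma> ! n))"
    and csu: "csu u v (fst ` set bs)"
    and bs: "\<forall>(\<theta>', \<pi>')\<in>set bs. typing (map (sub_fm \<theta>') \<Gamma>) \<pi>' (sub_fm \<theta>' Q)"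
    and P: "eqf P (sub_fm \<theta> Q)"
    by (auto elim: typing_CaseEqE)
  \<comment> \<open>The members of a complete set of unifiers are unifiers, hence well
    typed.\<close>
  have wt': "wt_sub \<theta>'" using csu b by (force simp: csu_def unifier_def)
  have conv: "eqf (sub_fm \<theta> A) (sub_fm (tcomp \<theta>' \<theta>'') A)" if "wff A" for A
    using that wf(1) wt wt' eq by (intro eqf_sub_cong) (auto simp: sub_eq_def intro: eqt_beta_eta)
  have "typing (map (sub_fm (tcomp \<theta>' \<theta>'')) \<Gamma>) (tsub_pf \<theta>'' \<pi>) (sub_fm (tcomp \<theta>' \<theta>'') Q)"
    using typing_tsub[of "map (sub_fm \<theta>') \<Gamma>" \<pi> "sub_fm \<theta>' Q" \<theta>''] bs b wt by (auto simp: comp_def)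
  \<comment> \<open>The proofs in \<sigma> have types in \<Gamma>\<theta>, while the branch after
    \<theta>'' expects \<Gamma>\<theta>'\<theta>''. Since all formulas recorded in \<Gamma> are well
    formed, \<open>conv\<close> applies to each of them.\<close>
  moreover have "hsub_ok (hsubs \<sigma>) (map (sub_fm (tcomp \<theta>' \<theta>'')) \<Gamma>) \<Gamma>'"
    using \<sigma> l wf(2) by (auto simp: hsub_ok_def hsubs_def intro: typing_conv[OF _ conv])
  ultimately have "typing \<Gamma>' (hsub_pf (hsubs \<sigma>) (tsub_pf \<theta>'' \<pi>)) (sub_fm (tcomp \<theta>' \<theta>'') Q)"
    by (rule typing_hsub)
  then show ?thesis
    by (rule typing_conv) (blast intro: eqf_sym eqf_trans P conv wf(3))
qed

lemma subject_reduction: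
  assumes "red \<pi> \<pi>'" "typing \<Gamma> \<pi> P" and nc: non_confusing
  shows "typing \<Gamma> \<pi>' P"
  using assms(1,2)
proof (induction arbitrary: \<Gamma> P rule: red.induct)
  case (red_imp \<pi> \<pi>')
  then obtain Q P1 P2 where *: "typing (P1 # \<Gamma>) \<pi> P2" "typing \<Gamma> \<pi>' Q" "eqf (Imp Q P) (Imp P1 P2)"
    by (auto elim!: typing_AppPE typing_LamPE)
  have "eqf Q P1" "eqf P P2" using non_confusingD(1)[OF nc *(3)] by auto
  with * show ?case by (blast intro: typing_conv typing_hinst eqf_sym)
next
  case (red_and k \<pi>1 \<pi>2)
  then obtain P1 P2 Q1 Q2 where *: "typing \<Gamma> \<pi>1 Q1" "typing \<Gamma> \<pi>2 Q2"
    "eqf (And P1 P2) (And Q1 Q2)" "eqf P (pick k P1 P2)"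
    by (auto elim!: typing_ProjE typing_PairPE)
  have "eqf P1 Q1" "eqf P2 Q2" using non_confusingD(2)[OF nc *(3)] by auto
  with * show ?case by (cases k) (auto intro: typing_conv eqf_sym eqf_trans)
next
  case (red_or k \<pi> \<pi>1 \<pi>2)
  then obtain P1 P2 Q1 Q2 where *: "typing \<Gamma> \<pi> (pick k Q1 Q2)" "typing (P1 # \<Gamma>) \<pi>1 P"
    "typing (P2 # \<Gamma>) \<pi>2 P" "eqf (Or P1 P2) (Or Q1 Q2)"
    by (auto elim!: typing_CaseOrE typing_InE)
  have "eqf P1 Q1" "eqf P2 Q2" using non_confusingD(3)[OF nc *(4)] by auto
  with * show ?case by (cases k) (auto intro: typing_hinst eqf_sym)
next
  case (red_all \<gamma> \<pi> t)
  then obtain \<gamma>' Q Q' where *: "typing (map (wk [\<gamma>]) \<Gamma>) \<pi> Q'" "eqf (All \<gamma>' Q) (All \<gamma> Q')" "wt t \<gamma>'"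
    "eqf P (sub_fm (insts [\<gamma>'] [t]) Q)"
    by (auto elim!: typing_AppTE typing_LamTE)
  have Q: "\<gamma>' = \<gamma>" "eqf Q Q'" using non_confusingD(4)[OF nc *(2)] by auto
  with * have "eqf (sub_fm (insts [\<gamma>] [t]) Q) (sub_fm (insts [\<gamma>] [t]) Q')" by (simp add: eqf_sub)
  moreover have "typing \<Gamma> (tsub_pf (insts [\<gamma>] [t]) \<pi>) (sub_fm (insts [\<gamma>] [t]) Q')"
    using typing_tsub[OF *(1), of "insts [\<gamma>] [t]"] * Q by (simp add: comp_def)
  ultimately show ?case using * Q by (blast intro: typing_conv eqf_sym eqf_trans)
next
  case (red_ex \<gamma> t \<pi> \<pi>')
  then obtain \<gamma>' Q Q' where *: "typing \<Gamma> \<pi> (sub_fm (insts [\<gamma>'] [t]) Q')" "eqf (Ex \<gamma> Q) (Ex \<gamma>' Q')"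
    "wt t \<gamma>'" "typing (Q # map (wk [\<gamma>]) \<Gamma>) \<pi>' (wk [\<gamma>] P)"
    by (auto elim!: typing_CaseExE typing_PackE)
  have Q: "\<gamma>' = \<gamma>" "eqf Q Q'" using non_confusingD(5)[OF nc *(2)] by auto
  with * have "eqf (sub_fm (insts [\<gamma>] [t]) Q') (sub_fm (insts [\<gamma>] [t]) Q)"
    by (simp add: eqf_sub eqf_sym)
  \<comment> \<open>The branch concludes P weakened past the eigenvariable, so inserting the witness
    gives P back.\<close>
  moreover have "typing (sub_fm (insts [\<gamma>] [t]) Q # \<Gamma>) (tsub_pf (insts [\<gamma>] [t]) \<pi>') P"
    using typing_insts[OF *(4), of "[t]"] * Q by simp
  ultimately show ?case using * Q by (blast intro: typing_hinst)
next
  case (red_mu \<gamma>s S B ts \<pi> \<pi>')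
  then show ?case by (rule red_mu_typing[OF nc])
next
  case (red_nu \<gamma>s B ts S \<pi> \<pi>')
  then show ?case by (rule red_nu_typing[OF nc])
next
  case (red_eq \<theta>' \<pi> bs \<theta>'' \<theta> \<Gamma>' \<sigma> u v Q w)
  then show ?case by (blast intro: red_eq_typing)
next
  case (ctx_CaseEq1 \<pi> \<pi>' \<Gamma>' \<theta> \<sigma> u v Q bs)
  from ctx_CaseEq1.prems show ?case
    by (elim typing_CaseEqE) (auto intro!: ty_CaseEq ctx_CaseEq1.IH)
next
  case (ctx_CaseEq2 \<pi> \<pi>' \<Gamma>' \<theta> \<sigma>1 \<sigma>2 u v Q \<pi>1 bs)
  then have \<sigma>: "\<forall>n<length \<Gamma>'. typing \<Gamma> ((\<sigma>1 @ \<pi> # \<sigma>2) ! n) (sub_fm \<theta> (\<Gamma>' ! n))"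
    by (auto elim: typing_CaseEqE)
  have "typing \<Gamma> ((\<sigma>1 @ \<pi>' # \<sigma>2) ! n) (sub_fm \<theta> (\<Gamma>' ! n))" if "n < length \<Gamma>'" for n
  proof (cases "n = length \<sigma>1")
    case True
    with \<sigma> that have "typing \<Gamma> \<pi> (sub_fm \<theta> (\<Gamma>' ! n))" by (metis nth_append_length)
    with True show ?thesis by (simp add: ctx_CaseEq2.IH)
  next
    case False
    then have "(\<sigma>1 @ \<pi>' # \<sigma>2) ! n = (\<sigma>1 @ \<pi> # \<sigma>2) ! n"
      by (auto simp: nth_append nth_Cons split: nat.splits)
    with \<sigma> that show ?thesis by simp
  qed
  with ctx_CaseEq2.prems show ?case
    by (elim typing_CaseEqE) (auto intro!: ty_CaseEq)
next
  case (ctx_CaseEq3 \<pi> \<pi>' \<Gamma>' \<theta> \<sigma> u v Q \<pi>1 bs1 \<theta>' bs2)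
  \<comment> \<open>A step inside a branch leaves the substitutions of the family alone, so they
    remain a complete set of unifiers.\<close>
  from ctx_CaseEq3.prems show ?case
    by (elim typing_CaseEqE) (auto intro!: ty_CaseEq ctx_CaseEq3.IH)
next
  case ctx_BotE
  from ctx_BotE.prems show ?case by (elim typing_BotE) (blast intro: ty_BotE ctx_BotE.IH)
next
  case ctx_LamP
  from ctx_LamP.prems show ?case by (elim typing_LamPE) (blast intro: ty_LamP ctx_LamP.IH)
next
  case ctx_AppP1
  from ctx_AppP1.prems show ?case by (elim typing_AppPE) (blast intro: ty_AppP ctx_AppP1.IH)
next
  case ctx_AppP2
  from ctx_AppP2.prems show ?case by (elim typing_AppPE) (blast intro: ty_AppP ctx_AppP2.IH)
next
  case ctx_Pair1
  from ctx_Pair1.prems show ?case by (elim typing_PairPE) (blast intro: ty_Pair ctx_Pair1.IH)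
next
  case ctx_Pair2
  from ctx_Pair2.prems show ?case by (elim typing_PairPE) (blast intro: ty_Pair ctx_Pair2.IH)
next
  case ctx_Proj
  from ctx_Proj.prems show ?case by (elim typing_ProjE) (blast intro: ty_Proj ctx_Proj.IH)
next
  case ctx_In
  from ctx_In.prems show ?case by (elim typing_InE) (blast intro: ty_In ctx_In.IH)
next
  case ctx_CaseOr1
  from ctx_CaseOr1.prems show ?case by (elim typing_CaseOrE) (blast intro: ty_CaseOr ctx_CaseOr1.IH)
next
  case ctx_CaseOr2
  from ctx_CaseOr2.prems show ?case by (elim typing_CaseOrE) (blast intro: ty_CaseOr ctx_CaseOr2.IH)
next
  case ctx_CaseOr3
  from ctx_CaseOr3.prems show ?case by (elim typing_CaseOrE) (blast intro: ty_CaseOr ctx_CaseOr3.IH)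
next
  case ctx_LamT
  from ctx_LamT.prems show ?case by (elim typing_LamTE) (blast intro: ty_LamT ctx_LamT.IH)
next
  case ctx_AppT
  from ctx_AppT.prems show ?case by (elim typing_AppTE) (blast intro: ty_AppT ctx_AppT.IH)
next
  case ctx_Pack
  from ctx_Pack.prems show ?case by (elim typing_PackE) (blast intro: ty_Pack ctx_Pack.IH)
next
  case ctx_CaseEx1
  from ctx_CaseEx1.prems show ?case by (elim typing_CaseExE) (blast intro: ty_CaseEx ctx_CaseEx1.IH)
next
  case ctx_CaseEx2
  from ctx_CaseEx2.prems show ?case by (elim typing_CaseExE) (blast intro: ty_CaseEx ctx_CaseEx2.IH)
next
  case ctx_MuI
  from ctx_MuI.prems show ?case by (elim typing_MuIE) (blast intro: ty_MuI ctx_MuI.IH)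
next
  case ctx_MuE1
  from ctx_MuE1.prems show ?case by (elim typing_MuEE) (blast intro: ty_MuE ctx_MuE1.IH)
next
  case ctx_MuE2
  from ctx_MuE2.prems show ?case by (elim typing_MuEE) (blast intro: ty_MuE ctx_MuE2.IH)
next
  case ctx_NuI1
  from ctx_NuI1.prems show ?case by (elim typing_NuIE) (blast intro: ty_NuI ctx_NuI1.IH)
next
  case ctx_NuI2
  from ctx_NuI2.prems show ?case by (elim typing_NuIE) (blast intro: ty_NuI ctx_NuI2.IH)
next
  case ctx_NuE
  from ctx_NuE.prems show ?case by (elim typing_NuEE) (blast intro: ty_NuE ctx_NuE.IH)
qed

end

theorem theorem1:
  fixes ctyp :: "'c \<Rightarrow> 'b ty" and atyp :: "'a \<Rightarrow> 'b ty list"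
    and eqt :: "('b, 'c) tm \<Rightarrow> ('b, 'c) tm \<Rightarrow> bool"
    and eqf :: "('b, 'c, 'a) fm \<Rightarrow> ('b, 'c, 'a) fm \<Rightarrow> bool"
    and \<Gamma> :: "('b, 'c, 'a) fm list" and \<pi> \<pi>' :: "('b, 'c, 'a) pf" and P :: "('b, 'c, 'a) fm"
  assumes "congruence ctyp atyp eqt eqf"
    and "congruence.non_confusing eqt eqf"
    and "congruence.typing ctyp atyp eqt eqf \<Gamma> \<pi> P"
    and "signature.red ctyp \<pi> \<pi>'"
  shows "congruence.typing ctyp atyp eqt eqf \<Gamma> \<pi>' P"
  using congruence.subject_reduction[OF assms(1,4,3,2)] .

end
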